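(* Let $\mathcal{H}=\{h_1,\dots,h_N\}\subset R_P$ be a subset of $N$ elements with attached nonnegative integers $0\le e_1\le\cdots\le e_N$ such that (i) $h_l\in\mathfrak{m}_P^{p^{e_l}}$ and $(h_l\bmod\mathfrak{m}_P^{p^{e_l}+1})=v_l^{p^{e_l}}$ with $v_l\in\mathfrak{m}_P/\mathfrak{m}_P^2$ for $l=1,\dots,N$; (ii) $v_1,\dots,v_N$ are $N$ distinct and $k$-linearly independent elements of $\mathfrak{m}_P/\mathfrak{m}_P^2$. Let $X=(x_1,\dots,x_d)$ be a regular system of parameters of $R_P$ associated to $H=(h_1,\dots,h_N)$, i.e. $v_l=(x_l\bmod\mathfrak{m}_P^2)$ for $l=1,\dots,N$. Let $\mathbb{I}_P$ be a $\mathfrak{D}$-saturated idealistic filtration over $R_P$ such that (iii) $(h_l,p^{e_l})\in\mathbb{I}_P$ for $l=1,\dots,N$. Let $\widehat{\mathbb{I}_P}$ be the completion of $\mathbb{I}_P$. Take $(f,a)\in\widehat{\mathbb{I}_P}$, and let $f=\sum_{B\in(\mathbb{Z}_{\ge0})^N}a_BH^B$ be its power series expansion of the form $(\star)$ with respect to $H$ and $X$. Then $$(a_B,\,a-|[B]|)\in\widehat{\mathbb{I}_P}\qquad\forall B\in(\mathbb{Z}_{\ge0})^N.$$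
   Context: Standing setting: $k$ is an algebraically closed field of characteristic $p>0$ or of characteristic $0$; in characteristic $0$ one formally sets $p=\infty$ with $p^0=1$, so that all exponents $e_l$ are $0$. $W$ is a nonsingular variety over $k$ of dimension $d$, $P\in W$ a closed point, $R_P=\mathcal{O}_{W,P}$ with maximal ideal $\mathfrak{m}_P$ and completion $\widehat{R_P}$. An idealistic filtration over a ring $A$ is a subset $\mathbb{I}\subset A\times\mathbb{R}$ such that, writing $\mathbb{I}_a=\{f\in A: (f,a)\in\mathbb{I}\}$: each $\mathbb{I}_a$ is an ideal of $A$, with $\mathbb{I}_a=A$ for $a\le 0$; $(f,a),(g,b)\in\mathbb{I}$ implies $(fg,a+b)\in\mathbb{I}$; and $(f,a)\in\mathbb{I}$, $b\le a$ implies $(f,b)\in\mathbb{I}$. An idealistic filtration $\mathbb{I}_P$ over $R_P$ is $\mathfrak{D}$-saturated if $(f,a)\in\mathbb{I}_P$ and $D$ a $k$-linear (Grothendieck) differential operator on $R_P$ of degree $\le t$ imply $(D(f),a-t)\in\mathbb{I}_P$. Its completion $\widehat{\mathbb{I}_P}$ is the idealistic filtration over $\widehat{R_P}$ with $(\widehat{\mathbb{I}_P})_a=(\mathbb{I}_P)_a\widehat{R_P}$ for all $a\in\mathbb{R}$. For $B=(b_1,\dots,b_N)\in(\mathbb{Z}_{\ge0})^N$: $[B]=(p^{e_1}b_1,\dots,p^{e_N}b_N)$, $|[B]|=\sum_{l=1}^Np^{e_l}b_l$, $H^B=\prod_lh_l^{b_l}$. Power series expansion of the form $(\star)$: every $f\in\widehat{R_P}$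 can be written uniquely as $f=\sum_{B\in(\mathbb{Z}_{\ge0})^N}a_BH^B$ with $a_B=\sum_Kb_{B,K}X^K$, where each $b_{B,K}$ is a power series (with coefficients in $k$) in $(x_{N+1},\dots,x_d)$ and $K=(k_1,\dots,k_d)\in(\mathbb{Z}_{\ge0})^d$ ranges over $0\le k_l\le p^{e_l}-1$ for $l=1,\dots,N$ and $k_l=0$ for $l=N+1,\dots,d$. *)

theory Defs
  imports "HOL-Analysis.Analysis" "HOL-Computational_Algebra.Polynomial" "HOL-Library.Set_Algebras"
begin

section \<open>Ideals and local rings\<close>

text \<open>Ideals of a commutative ring are its submodules as a module over itself.\<close>

abbreviation is_ideal :: "'a::comm_ring_1 set \<Rightarrow> bool" where
  "is_ideal \<equiv> module.subspace ((*) :: 'a \<Rightarrow> 'a \<Rightarrow> 'a)"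

abbreviation ideal_gen :: "'a::comm_ring_1 set \<Rightarrow> 'a set" where
  "ideal_gen \<equiv> module.span ((*) :: 'a \<Rightarrow> 'a \<Rightarrow> 'a)"

lemma self_module: "module ((*) :: 'a::comm_ring_1 \<Rightarrow> 'a \<Rightarrow> 'a)"
  by unfold_locales (simp_all add: algebra_simps)

primrec ideal_power :: "'a::comm_ring_1 set \<Rightarrow> nat \<Rightarrow> 'a set" where
  "ideal_power I 0 = UNIV"
| "ideal_power I (Suc n) = ideal_gen {x * y |x y. x \<in> I \<and> y \<in> ideal_power I n}"

class local_ring = comm_ring_1 +
  assumes nonunit_add: "\<not> x dvd 1 \<Longrightarrow> \<not> y dvd 1 \<Longrightarrow> \<not> (x + y) dvd 1"

definition max_ideal :: "'a::local_ring set" where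
  "max_ideal = {x. \<not> x dvd 1}"

abbreviation mpow :: "nat \<Rightarrow> 'a::local_ring set" where
  "mpow \<equiv> ideal_power max_ideal"

lemma is_ideal_mpow: "is_ideal (mpow n :: 'a::local_ring set)"
  by (cases n) (simp_all add: module.subspace_UNIV[OF self_module] module.subspace_span[OF self_module])

lemma is_ideal_max_ideal: "is_ideal (max_ideal :: 'a::local_ring set)"
  unfolding max_ideal_def module.subspace_def[OF self_module]
  by (auto simp: nonunit_add dest: dvd_mult_right)

lemma mpow_1: "mpow 1 = (max_ideal :: 'a::local_ring set)"
proof -
  have "{x * y |x y. x \<in> (max_ideal :: 'a set) \<and> y \<in> UNIV} = max_ideal" (is "?L = _")
  proof
    show "?L \<subseteq> max_ideal"
      using module.subspace_scale[OF self_module is_ideal_max_ideal] by (auto simp: mult.commute)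
    show "max_ideal \<subseteq> ?L"
    proof
      fix x :: 'a assume "x \<in> max_ideal"
      then have "x = x * 1 \<and> x \<in> max_ideal \<and> (1 :: 'a) \<in> UNIV" by simp
      then show "x \<in> ?L" by blast
    qed
  qed
  then show ?thesis
    using module.span_eq_iff[OF self_module, THEN iffD2, OF is_ideal_max_ideal] by simp
qed

lemma one_notin_mpow_1: "(1 :: 'a::local_ring) \<notin> mpow 1"
  unfolding mpow_1 by (simp add: max_ideal_def)


section \<open>Completion of a local ring\<close>

text \<open>
  The inverse limit of the rings \<open>R / \<mm>\<^sup>n\<close>.  An element is represented by a sequence \<open>X\<close> of
  representatives of its components, \<open>X n\<close> being taken modulo \<open>\<mm>\<^sup>n\<close>.
\<close>

definition coherent :: "(nat \<Rightarrow> 'a::local_ring) \<Rightarrow> bool" where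
  "coherent X \<longleftrightarrow> (\<forall>n. X (Suc n) - X n \<in> mpow n)"

definition compl_rel :: "(nat \<Rightarrow> 'a::local_ring) \<Rightarrow> (nat \<Rightarrow> 'a) \<Rightarrow> bool" where
  "compl_rel X Y \<longleftrightarrow> coherent X \<and> coherent Y \<and> (\<forall>n. X n - Y n \<in> mpow n)"

lemma mpow_simps:
  "(0 :: 'a::local_ring) \<in> mpow n"
  "x \<in> mpow n \<Longrightarrow> y \<in> mpow n \<Longrightarrow> x + y \<in> mpow n"
  "x \<in> mpow n \<Longrightarrow> y \<in> mpow n \<Longrightarrow> x - y \<in> mpow n"
  "x \<in> mpow n \<Longrightarrow> - x \<in> mpow n"
  "y \<in> mpow n \<Longrightarrow> x * y \<in> mpow n"
  "x \<in> mpow n \<Longrightarrow> x * y \<in> mpow n"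
  for x y :: "'a::local_ring"
  using module.subspace_0[OF self_module is_ideal_mpow, of n]
    module.subspace_add[OF self_module is_ideal_mpow, of x n y]
    module.subspace_diff[OF self_module is_ideal_mpow, of x n y]
    module.subspace_neg[OF self_module is_ideal_mpow, of x n]
    module.subspace_scale[OF self_module is_ideal_mpow, of y n x]
    module.subspace_scale[OF self_module is_ideal_mpow, of x n y]
  by (simp_all only: mult.commute)

lemma mpow_add_cong:
  "a - b \<in> mpow n \<Longrightarrow> c - d \<in> mpow n \<Longrightarrow> (a + c) - (b + d) \<in> mpow n"
  for a :: "'a::local_ring"
  using mpow_simps(2)[of "a - b" n "c - d"] by (simp add: algebra_simps)

lemma mpow_minus_swap: "a - b \<in> mpow n \<Longrightarrow> b - a \<in> mpow n"
  for a :: "'a::local_ring"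
  using mpow_simps(4)[of "a - b" n] by simp

lemma mpow_minus_cong: "a - b \<in> mpow n \<Longrightarrow> (- a) - (- b) \<in> mpow n"
  for a :: "'a::local_ring"
  by (simp add: mpow_minus_swap)

lemma mpow_diff_cong:
  "a - b \<in> mpow n \<Longrightarrow> c - d \<in> mpow n \<Longrightarrow> (a - c) - (b - d) \<in> mpow n"
  for a :: "'a::local_ring"
  using mpow_simps(3)[of "a - b" n "c - d"] by (simp add: algebra_simps)

lemma mpow_mult_cong:
  "a - b \<in> mpow n \<Longrightarrow> c - d \<in> mpow n \<Longrightarrow> a * c - b * d \<in> mpow n"
  for a :: "'a::local_ring"
  using mpow_simps(2)[OF mpow_simps(6)[of "a - b" n c] mpow_simps(5)[of "c - d" n b]]
  by (simp add: algebra_simps)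

lemma coherent_intros:
  "coherent (\<lambda>_. x)"
  "coherent X \<Longrightarrow> coherent Y \<Longrightarrow> coherent (\<lambda>n. X n + Y n)"
  "coherent X \<Longrightarrow> coherent Y \<Longrightarrow> coherent (\<lambda>n. X n - Y n)"
  "coherent X \<Longrightarrow> coherent (\<lambda>n. - X n)"
  "coherent X \<Longrightarrow> coherent Y \<Longrightarrow> coherent (\<lambda>n. X n * Y n)"
  unfolding coherent_def
  by (simp_all only: mpow_add_cong mpow_diff_cong mpow_minus_cong mpow_mult_cong mpow_simps(1) diff_self simp_thms)

lemma compl_rel_eqI:
  "coherent X \<Longrightarrow> coherent Y \<Longrightarrow> (\<And>n. X n = Y n) \<Longrightarrow> compl_rel X Y"
  by (simp add: compl_rel_def mpow_simps)

quotient_type (overloaded) 'a completion = "nat \<Rightarrow> 'a::local_ring" / partial: compl_rel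
proof (rule part_equivpI)
  show "\<exists>X :: nat \<Rightarrow> 'a. compl_rel X X"
    by (auto simp: compl_rel_def coherent_def mpow_simps intro!: exI[of _ "\<lambda>_. 0"])
  show "symp (compl_rel :: (nat \<Rightarrow> 'a) \<Rightarrow> _)"
  proof (rule sympI)
    fix X Y :: "nat \<Rightarrow> 'a"
    assume "compl_rel X Y"
    then show "compl_rel Y X"
      using mpow_simps(4)[of "X n - Y n" n for n] by (auto simp: compl_rel_def)
  qed
  show "transp (compl_rel :: (nat \<Rightarrow> 'a) \<Rightarrow> _)"
  proof (rule transpI)
    fix X Y Z :: "nat \<Rightarrow> 'a"
    assume "compl_rel X Y" "compl_rel Y Z"
    then show "compl_rel X Z"
      using mpow_simps(2)[of "X n - Y n" n "Y n - Z n" for n] by (auto simp: compl_rel_def)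
  qed
qed

lift_definition to_completion :: "'a::local_ring \<Rightarrow> 'a completion" is "\<lambda>x _. x"
  by (simp add: compl_rel_def coherent_def mpow_simps)

text \<open>Congruence modulo the kernel of the projection of the completion onto \<open>R / \<mm>\<^sup>n\<close>.\<close>

lift_definition compl_cong :: "nat \<Rightarrow> 'a::local_ring completion \<Rightarrow> 'a completion \<Rightarrow> bool"
  is "\<lambda>n X Y. X n - Y n \<in> mpow n"
proof -
  fix n and X X' Y Y' :: "nat \<Rightarrow> 'a"
  assume "compl_rel X X'" "compl_rel Y Y'"
  then have *: "X n - X' n \<in> mpow n" "Y n - Y' n \<in> mpow n"
    by (auto simp: compl_rel_def)
  have "X n - Y n = (X' n - Y' n) + ((X n - X' n) - (Y n - Y' n))"
    "X' n - Y' n = (X n - Y n) - ((X n - X' n) - (Y n - Y' n))" by simp_all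
  with * show "(X n - Y n \<in> mpow n) = (X' n - Y' n \<in> mpow n)"
    using mpow_simps(2,3) by metis
qed

instantiation completion :: (local_ring) comm_ring_1
begin

lift_definition zero_completion :: "'a completion" is "\<lambda>_. 0"
  by (simp add: compl_rel_def coherent_def mpow_simps)

lift_definition one_completion :: "'a completion" is "\<lambda>_. 1"
  by (simp add: compl_rel_def coherent_def mpow_simps)

lift_definition plus_completion :: "'a completion \<Rightarrow> 'a completion \<Rightarrow> 'a completion"
  is "\<lambda>X Y n. X n + Y n"
  by (simp add: compl_rel_def coherent_intros mpow_add_cong)

lift_definition uminus_completion :: "'a completion \<Rightarrow> 'a completion" is "\<lambda>X n. - X n"
  by (simp add: compl_rel_def coherent_intros mpow_minus_swap)

lift_definition minus_completion :: "'a completion \<Rightarrow> 'a completion \<Rightarrow> 'a completion"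
  is "\<lambda>X Y n. X n - Y n"
  by (simp add: compl_rel_def coherent_intros mpow_diff_cong)

lift_definition times_completion :: "'a completion \<Rightarrow> 'a completion \<Rightarrow> 'a completion"
  is "\<lambda>X Y n. X n * Y n"
  by (simp add: compl_rel_def coherent_intros mpow_mult_cong)

instance
proof
  fix a b c :: "'a completion"
  show "a * b * c = a * (b * c)"
    by transfer (rule compl_rel_eqI; simp add: coherent_intros compl_rel_def mult.assoc)
  show "a * b = b * a"
    by transfer (rule compl_rel_eqI; simp add: coherent_intros compl_rel_def mult.commute)
  show "1 * a = a"
    by transfer (rule compl_rel_eqI; simp add: coherent_intros compl_rel_def)
  show "a + b + c = a + (b + c)"
    by transfer (rule compl_rel_eqI; simp add: coherent_intros compl_rel_def add.assoc)
  show "a + b = b + a"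
    by transfer (rule compl_rel_eqI; simp add: coherent_intros compl_rel_def add.commute)
  show "0 + a = a"
    by transfer (rule compl_rel_eqI; simp add: coherent_intros compl_rel_def)
  show "- a + a = 0"
    by transfer (rule compl_rel_eqI; simp add: coherent_intros compl_rel_def)
  show "a - b = a + - b"
    by transfer (rule compl_rel_eqI; simp add: coherent_intros compl_rel_def)
  show "(a + b) * c = a * c + b * c"
    by transfer (rule compl_rel_eqI; simp add: coherent_intros compl_rel_def distrib_right)
  show "(0 :: 'a completion) \<noteq> 1"
  proof transfer
    show "\<not> compl_rel (\<lambda>_. 0 :: 'a) (\<lambda>_. 1)"
    proof
      assume "compl_rel (\<lambda>_. 0 :: 'a) (\<lambda>_. 1)"
      then have "0 - 1 \<in> (mpow 1 :: 'a set)" unfolding compl_rel_def by blast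
      then have "- (0 - 1) \<in> (mpow 1 :: 'a set)" by (rule mpow_simps(4))
      then show False using one_notin_mpow_1[where 'a = 'a] by (simp del: ideal_power.simps)
    qed
  qed
qed

end

text \<open>
  The inverse limit topology, every \<open>R / \<mm>\<^sup>n\<close> being discrete.  For noetherian \<open>R\<close> this is the
  adic topology of the maximal ideal of the completion.
\<close>

instantiation completion :: (local_ring) topological_space
begin

definition open_completion :: "'a completion set \<Rightarrow> bool" where
  "open_completion U \<longleftrightarrow> (\<forall>f\<in>U. \<exists>n. \<forall>g. compl_cong n g f \<longrightarrow> g \<in> U)"

instance
proof
  show "open (UNIV :: 'a completion set)" by (simp add: open_completion_def)
next
  fix K :: "'a completion set set"
  assume "\<forall>S\<in>K. open S"
  then show "open (\<Union>K)" unfolding open_completion_def by (meson UnionE UnionI)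
next
  have step: "compl_cong n g f" if "compl_cong (Suc n) g f" for n and f g :: "'a completion"
    using that
  proof transfer
    fix n and f g :: "nat \<Rightarrow> 'a"
    assume g: "compl_rel g g" and f: "compl_rel f f"
      and d: "g (Suc n) - f (Suc n) \<in> mpow (Suc n)"
    have "mpow (Suc n) \<subseteq> (mpow n :: 'a set)"
      unfolding ideal_power.simps
      by (rule module.span_minimal[OF self_module]) (auto simp: mpow_simps is_ideal_mpow)
    with d have d: "g (Suc n) - f (Suc n) \<in> mpow n" by blast
    have "g (Suc n) - g n \<in> mpow n" "f (Suc n) - f n \<in> mpow n"
      using f g by (simp_all add: compl_rel_def coherent_def)
    from mpow_simps(3)[OF d mpow_simps(3)[OF this]] show "g n - f n \<in> mpow n"
      by (simp add: algebra_simps)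
  qed
  have mono: "compl_cong m g f" if "m \<le> n" "compl_cong n g f" for m n and f g :: "'a completion"
    using that by (induction rule: inc_induct) (auto intro: step)
  fix S T :: "'a completion set"
  assume S: "open S" and T: "open T"
  show "open (S \<inter> T)" unfolding open_completion_def
  proof
    fix f assume "f \<in> S \<inter> T"
    then obtain m n where "\<forall>g. compl_cong m g f \<longrightarrow> g \<in> S" "\<forall>g. compl_cong n g f \<longrightarrow> g \<in> T"
      using S T unfolding open_completion_def by blast
    then have "\<forall>g. compl_cong (max m n) g f \<longrightarrow> g \<in> S \<inter> T"
      using mono by (meson IntI max.cobounded1 max.cobounded2)
    then show "\<exists>n. \<forall>g. compl_cong n g f \<longrightarrow> g \<in> S \<inter> T" by blast
  qed
qed

end


section \<open>Multi-indices\<close>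

definition multi_idx :: "'i set \<Rightarrow> ('i \<Rightarrow> nat) set" where
  "multi_idx I = {J. \<forall>i. i \<notin> I \<longrightarrow> J i = 0}"

definition mono_pow :: "('i \<Rightarrow> 'a::comm_monoid_mult) \<Rightarrow> 'i set \<Rightarrow> ('i \<Rightarrow> nat) \<Rightarrow> 'a" where
  "mono_pow x I J = (\<Prod>i\<in>I. x i ^ J i)"


section \<open>Algebras over a field and local rings of nonsingular varieties\<close>

locale k_algebra = vector_space smul
  for smul :: "'k::field \<Rightarrow> 'a::comm_ring_1 \<Rightarrow> 'a" +
  assumes smul_mult: "smul c x * y = smul c (x * y)"

definition is_subalgebra :: "('k::field \<Rightarrow> 'a::comm_ring_1 \<Rightarrow> 'a) \<Rightarrow> 'a set \<Rightarrow> bool" where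
  "is_subalgebra smul A \<longleftrightarrow>
     module.subspace smul A \<and> 1 \<in> A \<and> (\<forall>x\<in>A. \<forall>y\<in>A. x * y \<in> A)"

definition fin_gen_subalgebra :: "('k::field \<Rightarrow> 'a::comm_ring_1 \<Rightarrow> 'a) \<Rightarrow> 'a set \<Rightarrow> bool" where
  "fin_gen_subalgebra smul A \<longleftrightarrow> (\<exists>S. finite S \<and> A = is_subalgebra smul hull S)"

definition alg_indep :: "('k::field \<Rightarrow> 'a::comm_ring_1 \<Rightarrow> 'a) \<Rightarrow> 'a set \<Rightarrow> bool" where
  "alg_indep smul Y \<longleftrightarrow>
     (\<forall>F c. finite F \<longrightarrow> F \<subseteq> multi_idx Y \<longrightarrow>
        (\<Sum>J\<in>F. smul (c J) (mono_pow (\<lambda>y. y) Y J)) = 0 \<longrightarrow> (\<forall>J\<in>F. c J = 0))"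

definition has_trdeg :: "('k::field \<Rightarrow> 'a::comm_ring_1 \<Rightarrow> 'a) \<Rightarrow> 'a set \<Rightarrow> nat \<Rightarrow> bool" where
  "has_trdeg smul A d \<longleftrightarrow>
     (\<exists>Y\<subseteq>A. finite Y \<and> card Y = d \<and> alg_indep smul Y) \<and>
     (\<forall>Y\<subseteq>A. finite Y \<longrightarrow> alg_indep smul Y \<longrightarrow> card Y \<le> d)"

definition is_ideal_of :: "'a::comm_ring_1 set \<Rightarrow> 'a set \<Rightarrow> bool" where
  "is_ideal_of A I \<longleftrightarrow>
     I \<subseteq> A \<and> 0 \<in> I \<and> (\<forall>x\<in>I. \<forall>y\<in>I. x + y \<in> I) \<and> (\<forall>a\<in>A. \<forall>x\<in>I. a * x \<in> I)"

definition maximal_ideal_of :: "'a::comm_ring_1 set \<Rightarrow> 'a set \<Rightarrow> bool" where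
  "maximal_ideal_of A M \<longleftrightarrow>
     is_ideal_of A M \<and> M \<noteq> A \<and> (\<forall>I. is_ideal_of A I \<longrightarrow> M \<subseteq> I \<longrightarrow> I = M \<or> I = A)"

text \<open>The dimension of \<open>V / U\<close> is \<open>n\<close>: there are \<open>n\<close> elements of \<open>V\<close> inducing a basis of it.\<close>

definition has_quot_dim ::
  "('k::field \<Rightarrow> 'a::comm_ring_1 \<Rightarrow> 'a) \<Rightarrow> 'a set \<Rightarrow> 'a set \<Rightarrow> nat \<Rightarrow> bool" where
  "has_quot_dim smul V U n \<longleftrightarrow>
     (\<exists>b. (\<forall>i\<in>{1..n}. b i \<in> V) \<and>
          (\<forall>c. (\<Sum>i=1..n. smul (c i) (b i)) \<in> U \<longrightarrow> (\<forall>i\<in>{1..n}. c i = 0)) \<and>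
          (\<forall>v\<in>V. \<exists>c. v - (\<Sum>i=1..n. smul (c i) (b i)) \<in> U))"

text \<open>
  \<open>A\<close> is the coordinate ring of a nonsingular affine variety of dimension \<open>d\<close> (it is integral
  because the ambient ring is).  The dimension of a variety is the transcendence degree of its
  function field, and a closed point \<open>M\<close> is nonsingular if its Zariski cotangent space
  \<open>M / M\<^sup>2\<close> has that dimension; \<open>module.span smul\<close> of the products of elements of \<open>M\<close> is \<open>M\<^sup>2\<close>.
\<close>

definition nonsingular_affine ::
  "('k::field \<Rightarrow> 'a::idom \<Rightarrow> 'a) \<Rightarrow> 'a set \<Rightarrow> nat \<Rightarrow> bool" where
  "nonsingular_affine smul A d \<longleftrightarrow>
     fin_gen_subalgebra smul A \<and> has_trdeg smul A d \<and>
     (\<forall>M. maximal_ideal_of A M \<longrightarrow>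
        has_quot_dim smul M (module.span smul {x * y |x y. x \<in> M \<and> y \<in> M}) d)"

text \<open>The whole ring is the localization of its subring \<open>A\<close> at the prime ideal \<open>M\<close> of \<open>A\<close>.\<close>

definition is_localization_at :: "'a::idom set \<Rightarrow> 'a set \<Rightarrow> bool" where
  "is_localization_at A M \<longleftrightarrow>
     (\<forall>s\<in>A - M. s dvd 1) \<and> (\<forall>r. \<exists>a\<in>A. \<exists>s\<in>A - M. s * r = a)"

text \<open>
  The ring is, as a \<open>k\<close>-algebra, the local ring of a nonsingular variety \<open>W\<close> of dimension \<open>d\<close> at
  a closed point \<open>P\<close>: \<open>A\<close> is the coordinate ring of an affine open neighbourhood of \<open>P\<close> in \<open>W\<close>,
  and \<open>M\<close> is the ideal of \<open>P\<close> in it.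
\<close>

definition local_ring_of_nonsingular_variety ::
  "('k::field \<Rightarrow> 'a::{idom, local_ring} \<Rightarrow> 'a) \<Rightarrow> nat \<Rightarrow> bool" where
  "local_ring_of_nonsingular_variety smul d \<longleftrightarrow>
     k_algebra smul \<and>
     (\<exists>A M. nonsingular_affine smul A d \<and> maximal_ideal_of A M \<and> is_localization_at A M)"

text \<open>Here \<open>d\<close> has to be the dimension of the ring.\<close>

definition regular_system_of_parameters :: "nat \<Rightarrow> (nat \<Rightarrow> 'a::local_ring) \<Rightarrow> bool" where
  "regular_system_of_parameters d x \<longleftrightarrow> ideal_gen (x ` {1..d}) = max_ideal"


section \<open>The associated graded ring\<close>

text \<open>Elements of \<open>\<mm>\<^sup>n / \<mm>\<^sup>n\<^sup>+\<^sup>1\<close> are cosets, and \<open>residue n x\<close> is the class of \<open>x \<in> \<mm>\<^sup>n\<close> there.\<close>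

definition residue :: "nat \<Rightarrow> 'a::local_ring \<Rightarrow> 'a set" where
  "residue n x = x +o mpow (Suc n)"

definition cotangent_space :: "'a::local_ring set set" where
  "cotangent_space = residue 1 ` max_ideal"

text \<open>
  The \<open>q\<close>-th power in the associated graded ring of \<open>v \<in> \<mm> / \<mm>\<^sup>2\<close>.  All members of the union are
  the same coset.
\<close>

definition gr_power :: "'a::local_ring set \<Rightarrow> nat \<Rightarrow> 'a set" where
  "gr_power v q = (\<Union>y\<in>v. residue q (y ^ q))"

definition cotangent_independent ::
  "('k::field \<Rightarrow> 'a::local_ring \<Rightarrow> 'a) \<Rightarrow> nat \<Rightarrow> (nat \<Rightarrow> 'a set) \<Rightarrow> bool" where
  "cotangent_independent smul N v \<longleftrightarrow>
     (\<forall>y c. (\<forall>l\<in>{1..N}. y l \<in> v l) \<longrightarrow>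
        residue 1 (\<Sum>l=1..N. smul (c l) (y l)) = residue 1 0 \<longrightarrow> (\<forall>l\<in>{1..N}. c l = 0))"


section \<open>Idealistic filtrations\<close>

definition level :: "('a \<times> real) set \<Rightarrow> real \<Rightarrow> 'a set" where
  "level \<I> a = {f. (f, a) \<in> \<I>}"

definition idealistic_filtration :: "('a::comm_ring_1 \<times> real) set \<Rightarrow> bool" where
  "idealistic_filtration \<I> \<longleftrightarrow>
     (\<forall>a. is_ideal (level \<I> a)) \<and>
     (\<forall>a\<le>0. level \<I> a = UNIV) \<and>
     (\<forall>f a g b. (f, a) \<in> \<I> \<longrightarrow> (g, b) \<in> \<I> \<longrightarrow> (f * g, a + b) \<in> \<I>) \<and>
     (\<forall>f a b. (f, a) \<in> \<I> \<longrightarrow> b \<le> a \<longrightarrow> (f, b) \<in> \<I>)"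

fun diff_op ::
  "('k::field \<Rightarrow> 'a::comm_ring_1 \<Rightarrow> 'a) \<Rightarrow> nat \<Rightarrow> ('a \<Rightarrow> 'a) \<Rightarrow> bool" where
  "diff_op smul 0 D \<longleftrightarrow>
     Vector_Spaces.linear smul smul D \<and> (\<forall>f g. D (f * g) - f * D g = 0)"
| "diff_op smul (Suc t) D \<longleftrightarrow>
     Vector_Spaces.linear smul smul D \<and> (\<forall>f. diff_op smul t (\<lambda>g. D (f * g) - f * D g))"

definition diff_saturated ::
  "('k::field \<Rightarrow> 'a::comm_ring_1 \<Rightarrow> 'a) \<Rightarrow> ('a \<times> real) set \<Rightarrow> bool" where
  "diff_saturated smul \<I> \<longleftrightarrow>
     (\<forall>f a t D. (f, a) \<in> \<I> \<longrightarrow> diff_op smul t D \<longrightarrow> (D f, a - real t) \<in> \<I>)"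

definition filtration_completion ::
  "('a::local_ring \<times> real) set \<Rightarrow> ('a completion \<times> real) set" where
  "filtration_completion \<I> = {(f, a). f \<in> ideal_gen (to_completion ` level \<I> a)}"


section \<open>Power series expansions\<close>

definition power_series_in ::
  "('k::field \<Rightarrow> 'a::local_ring \<Rightarrow> 'a) \<Rightarrow> (nat \<Rightarrow> 'a) \<Rightarrow> nat set \<Rightarrow> 'a completion \<Rightarrow> bool" where
  "power_series_in smul x I g \<longleftrightarrow>
     (\<exists>c. ((\<lambda>J. to_completion (smul (c J) (mono_pow x I J))) has_sum g) (multi_idx I))"

definition index_box :: "(nat \<Rightarrow> nat) \<Rightarrow> nat \<Rightarrow> nat \<Rightarrow> (nat \<Rightarrow> nat) set" where
  "index_box q N d =
     {K \<in> multi_idx {1..d}. (\<forall>l\<in>{1..N}. K l \<le> q l - 1) \<and> (\<forall>l\<in>{N+1..d}. K l = 0)}"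

text \<open>
  \<open>f = \<Sum>\<^sub>B a\<^sub>B H\<^sup>B\<close> with \<open>a\<^sub>B = \<Sum>\<^sub>K b\<^sub>B\<^sub>,\<^sub>K X\<^sup>K\<close>, the \<open>b\<^sub>B\<^sub>,\<^sub>K\<close> being power series in
  \<open>x\<^sub>N\<^sub>+\<^sub>1, \<dots>, x\<^sub>d\<close>; here \<open>q l\<close> stands for \<open>p\<close> to the power \<open>e\<^sub>l\<close>.
\<close>

definition star_expansion ::
  "('k::field \<Rightarrow> 'a::local_ring \<Rightarrow> 'a) \<Rightarrow> (nat \<Rightarrow> nat) \<Rightarrow> nat \<Rightarrow> nat \<Rightarrow> (nat \<Rightarrow> 'a) \<Rightarrow> (nat \<Rightarrow> 'a) \<Rightarrow>
     'a completion \<Rightarrow> ((nat \<Rightarrow> nat) \<Rightarrow> 'a completion) \<Rightarrow> bool" where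
  "star_expansion smul q N d h x f aa \<longleftrightarrow>
     (\<exists>b. (\<forall>B\<in>multi_idx {1..N}. \<forall>K\<in>index_box q N d. power_series_in smul x {N+1..d} (b B K)) \<and>
          (\<forall>B\<in>multi_idx {1..N}.
             aa B = (\<Sum>K\<in>index_box q N d. b B K * to_completion (mono_pow x {1..d} K)))) \<and>
     ((\<lambda>B. aa B * to_completion (mono_pow h {1..N} B)) has_sum f) (multi_idx {1..N})"

end

theory Submission
  imports Defs "HOL-Computational_Algebra.Fraction_Field" "HOL-Computational_Algebra.Primes"
    "HOL-Library.Fun_Lexorder" "HOL-Library.Function_Algebras"
begin

text \<open>
  On the local ring there are Hasse operators: differential operators \<open>D\<^sub>i\<^sub>,\<^sub>n\<close> of order \<open>n\<close> mapping
  \<open>X\<^sup>L\<close> to \<open>binom L\<^sub>i n\<close> times \<open>X\<^sup>L\<close> divided by \<open>x\<^sub>i\<^sup>n\<close>.  For \<open>n = 1\<close> they are partial derivatives;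
  the Jacobian equations for these are solvable because the rank of the Jacobian matrix is known at a
  general closed point, all closed points being nonsingular.  In characteristic \<open>0\<close> take
  \<open>D\<^sub>i\<^sub>,\<^sub>1\<^sup>n / n!\<close>.  In characteristic \<open>p\<close> the monomials with exponents below \<open>p\<^sup>e\<close> are a basis of the
  ring over its \<open>p\<^sup>e\<close>-th powers, and operators that are linear over these powers are differential
  operators, so their values on this basis can be prescribed.

  By Lucas' theorem, \<open>D\<^sub>l\<^sub>,\<^sub>q\<^sub>b\<close> with \<open>q = p\<^sup>e\<^sup>l\<close> treats the polynomials with exponents below \<open>q\<close> as
  constants and acts on the powers of \<open>x\<^sub>l\<^sup>q\<close>, which is the leading form of \<open>h\<^sub>l\<close>, like a divided
  derivative.  Combinations of \<open>h\<^sub>l\<^sup>j D\<^sub>l\<^sub>,\<^sub>q\<^sub>(\<^sub>c\<^sub>+\<^sub>j\<^sub>)\<close> therefore extract the leading form of each coefficient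
  of the expansion without leaving the filtration.  Correcting by these, \<open>a\<^sub>B\<close> is congruent modulo
  every power of the maximal ideal to an element of level \<open>a - |[B]|\<close>.  Finally, the extension of
  an ideal to the completion is closed: by Dickson's lemma finitely many leading exponents generate all
  leading exponents of the ideal, and division by the corresponding elements converges.
\<close>

section \<open>Linear algebra over fields and local rings\<close>

text \<open>Differential saturation concerns operators on the ring itself, so no operator is ever
  extended to the completion: the expansion is truncated, and all extraction takes place in the
  ring, modulo a power of the maximal ideal. The obstacle is that one operator only sees initial
  forms. Since \<open>h l\<close> agrees with \<open>x l ^ q l\<close> to a single order, the
  extracted element \<open>G C\<close> equals the coefficient at \<open>C\<close> plus an error. But
  \<open>G C\<close> lies in the filtration and has an expansion of its own, so the error is treated
  by the same statement at lower precision. The coefficient at exponent zero has no order bound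
  there; hence the operators for other exponents must annihilate it exactly. Every power of the
  maximal ideal yields a different filtration element, which is why closedness of the ideal is
  needed at the end. Likewise, nonsingularity is given as the dimension of cotangent spaces; the
  derivations come from linear algebra over the fraction field, and Nakayama's lemma, applied to the
  module generated by the values on \<open>S\<close>, forces these values back into the
  ring.\<close>

lemma homogeneous_system_nontrivial_solution:
  fixes M :: "'j \<Rightarrow> 'i \<Rightarrow> 'k::field"
  assumes "finite J" "finite I" "card J < card I"
  shows "\<exists>t. (\<exists>i\<in>I. t i \<noteq> 0) \<and> (\<forall>j\<in>J. (\<Sum>i\<in>I. M j i * t i) = 0)"
  using assms
proof (induction J arbitrary: I M rule: finite_induct)
  case empty
  then obtain i where "i \<in> I" by fastforce
  then show ?case by (intro exI[of _ "\<lambda>_. 1"]) auto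
next
  case (insert j0 J)
  show ?case
  proof (cases "\<forall>i\<in>I. M j0 i = 0")
    case True
    have "card J < card I" using insert by simp
    from insert.IH[OF insert.prems(1) this, of M] True show ?thesis by auto
  next
    case False
    then obtain i0 where i0: "i0 \<in> I" "M j0 i0 \<noteq> 0" by blast
    let ?I = "I - {i0}"
    let ?M = "\<lambda>j i. M j i - M j i0 * M j0 i / M j0 i0"
    have "card J < card ?I" using insert i0 by simp
    from insert.IH[of ?I ?M, OF _ this] insert.prems(1) obtain t
      where t: "\<exists>i\<in>?I. t i \<noteq> 0" "\<And>j. j \<in> J \<Longrightarrow> (\<Sum>i\<in>?I. ?M j i * t i) = 0"
      by auto
    define u where "u i = (if i = i0 then - (\<Sum>i\<in>?I. M j0 i * t i) / M j0 i0 else t i)" for i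
    have s: "(\<Sum>i\<in>I. M j i * u i) = M j i0 * u i0 + (\<Sum>i\<in>?I. M j i * t i)" for j
      using insert.prems(1) i0(1) by (simp add: sum.remove[of I i0] u_def)
    have "(\<Sum>i\<in>I. M j0 i * u i) = 0" unfolding s using i0(2) by (simp add: u_def)
    moreover have "(\<Sum>i\<in>I. M j i * u i) = 0" if "j \<in> J" for j
    proof -
      have "(\<Sum>i\<in>?I. ?M j i * t i)
        = (\<Sum>i\<in>?I. M j i * t i) - M j i0 / M j0 i0 * (\<Sum>i\<in>?I. M j0 i * t i)"
        by (simp add: sum_subtractf sum_distrib_left algebra_simps)
      then show ?thesis unfolding s using t(2)[OF that] i0(2) by (simp add: u_def)
    qed
    moreover have "\<exists>i\<in>I. u i \<noteq> 0" using t(1) by (auto simp: u_def)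
    ultimately show ?thesis by (intro exI[of _ u]) auto
  qed
qed

lemma vector_space_fun:
  "vector_space (\<lambda>(c::'k::field) f (s::'s). c * f s)"
  by unfold_locales (auto simp: algebra_simps)

lemma vector_space_self: "vector_space ((*) :: 'k::field \<Rightarrow> 'k \<Rightarrow> 'k)"
  by unfold_locales (auto simp: algebra_simps)

text \<open>A functional that is 1 on \<open>t\<close> and 0 on a basis of the span of
  \<open>X\<close> becomes the vector \<open>v\<close> of its values on unit vectors, because all
  rows involved are supported in the finite set \<open>S\<close>. This will produce solutions of the
  Jacobian equations.\<close>

lemma fredholm_alternative:
  fixes X :: "('s \<Rightarrow> 'k::field) set"
  assumes S: "finite S" and X: "\<And>r s. r \<in> insert t X \<Longrightarrow> s \<notin> S \<Longrightarrow> r s = 0"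
  shows "t \<in> module.span (\<lambda>c f s. c * f s) X \<or>
     (\<exists>v. (\<forall>r\<in>X. (\<Sum>s\<in>S. r s * v s) = 0) \<and> (\<Sum>s\<in>S. t s * v s) = 1)"
proof -
  let ?sc = "\<lambda>(c::'k) f (s::'s). c * f s"
  interpret V: vector_space ?sc by (rule vector_space_fun)
  interpret P: vector_space_pair ?sc "(*) :: 'k \<Rightarrow> 'k \<Rightarrow> 'k"
    by (intro vector_space_pair.intro vector_space_fun vector_space_self)
  show ?thesis
  proof (cases "t \<in> V.span X")
    case False
    obtain B where B: "B \<subseteq> X" "V.independent B" "X \<subseteq> V.span B"
      using V.maximal_independent_subset[of X] by blast
    have tB: "t \<notin> V.span B" using False B(1) V.span_mono by blast
    then have ind: "V.independent (insert t B)" using B(2) by (rule V.independent_insertI)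
    obtain g where g: "Vector_Spaces.linear ?sc (*) g"
      "\<forall>x\<in>insert t B. g x = (if x = t then 1 else 0)"
      using P.linear_independent_extend[OF ind, of "\<lambda>x. if x = t then 1 else 0"] by blast
    interpret g: Vector_Spaces.linear ?sc "(*)" g by fact
    define v where "v s = g (\<lambda>s'. if s' = s then 1 else 0)" for s
    have gv: "g r = (\<Sum>s\<in>S. r s * v s)" if "r \<in> insert t X" for r
    proof -
      have "r = (\<Sum>s\<in>S. ?sc (r s) (\<lambda>s'. if s' = s then 1 else 0))"
      proof
        fix s'
        have "(\<Sum>s\<in>S. ?sc (r s) (\<lambda>s'. if s' = s then 1 else 0)) s' = (\<Sum>s\<in>S. if s' = s then r s else 0)"
          by (induction S rule: infinite_finite_induct) auto
        also have "\<dots> = r s'" using S X[OF that, of s'] by (simp add: sum.delta)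
        finally show "r s' = (\<Sum>s\<in>S. ?sc (r s) (\<lambda>s'. if s' = s then 1 else 0)) s'" ..
      qed
      then have "g r = g (\<Sum>s\<in>S. ?sc (r s) (\<lambda>s'. if s' = s then 1 else 0))" by simp
      then show ?thesis unfolding g.sum g.scale v_def .
    qed
    have g0: "g r = 0" if "r \<in> V.span B" for r
    proof (rule g.eq_0_on_span[OF _ that])
      fix x assume x: "x \<in> B"
      then have "x \<noteq> t" using tB V.span_base by blast
      then show "g x = 0" using g(2) x by auto
    qed
    have "\<forall>r\<in>X. (\<Sum>s\<in>S. r s * v s) = 0" using g0 gv B(3) by (metis insertI2 subsetD)
    moreover have "(\<Sum>s\<in>S. t s * v s) = 1" using g(2) gv[of t] by auto
    ultimately show ?thesis by blast
  qed simp
qed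

lemma (in module) span_image_sum:
  assumes "finite I" "z \<in> span (f ` I)"
  shows "\<exists>c. z = (\<Sum>i\<in>I. scale (c i) (f i))"
  using assms(2)
proof (induction rule: span_induct_alt)
  case base
  show ?case by (intro exI[of _ "\<lambda>_. 0"]) simp
next
  case (step a y z)
  then obtain i c where ic: "i \<in> I" "y = f i" "z = (\<Sum>i\<in>I. scale (c i) (f i))" by blast
  have "scale a y + z = (\<Sum>j\<in>I. (if j = i then scale a (f j) else 0) + scale (c j) (f j))"
    unfolding sum.distrib using assms(1) ic by simp
  also have "\<dots> = (\<Sum>j\<in>I. scale ((if j = i then a else 0) + c j) (f j))"
    by (intro sum.cong) (auto simp: scale_left_distrib)
  finally show ?case by (intro exI[of _ "\<lambda>j. (if j = i then a else 0) + c j"])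
qed

text \<open>The generators are eliminated one at a time: the unit \<open>1 - c g0\<close> solves for
  \<open>g0\<close>, and substitution keeps the other coefficients in \<open>\<mm>\<close>.
  \<open>scale\<close> stays arbitrary because two actions occur: of the ring on its fraction field,
  and of the ring on itself through \<open>q\<close>-th powers.\<close>

lemma (in module) nakayama:
  fixes G W :: "'b set" and \<mm> :: "'a set"
  assumes "finite G" and W: "subspace W"
    and m: "\<And>y z. y \<in> \<mm> \<Longrightarrow> z \<in> \<mm> \<Longrightarrow> y + z \<in> \<mm>" "\<And>r z. z \<in> \<mm> \<Longrightarrow> r * z \<in> \<mm>"
      "\<And>z. z \<in> \<mm> \<Longrightarrow> \<exists>u. u * (1 - z) = 1"
    and "\<And>g. g \<in> G \<Longrightarrow> \<exists>w\<in>W. \<exists>c. (\<forall>g'\<in>G. c g' \<in> \<mm>) \<and> g = w + (\<Sum>g'\<in>G. scale (c g') g')"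
  shows "G \<subseteq> W"
  using assms(1,6)
proof (induction G rule: finite_induct)
  case (insert g0 G)
  obtain w c where w: "w \<in> W" "\<And>g. g \<in> insert g0 G \<Longrightarrow> c g \<in> \<mm>"
    "g0 = w + (\<Sum>g'\<in>insert g0 G. scale (c g') g')" using insert.prems[of g0] by auto
  obtain u where u: "u * (1 - c g0) = 1" using m(3)[of "c g0"] w(2) by blast
  define w' c' where "w' = scale u w" and "c' g = u * c g" for g
  have w': "w' \<in> W" using w(1) W subspace_scale w'_def by blast
  have c': "c' g \<in> \<mm>" if "g \<in> G" for g using that m(2) w(2) c'_def by simp
  have "scale (1 - c g0) g0 = w + (\<Sum>g'\<in>G. scale (c g') g')"
    using w(3) insert.hyps by (simp add: algebra_simps scale_left_diff_distrib)
  then have "scale u (scale (1 - c g0) g0) = scale u (w + (\<Sum>g'\<in>G. scale (c g') g'))" by simp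
  then have g0: "g0 = w' + (\<Sum>g'\<in>G. scale (c' g') g')"
    by (simp only: scale_scale u scale_one scale_right_distrib scale_sum_right w'_def c'_def)
  have G: "G \<subseteq> W"
  proof (rule insert.IH)
    fix g assume "g \<in> G"
    then obtain v b where v: "v \<in> W" "\<And>g. g \<in> insert g0 G \<Longrightarrow> b g \<in> \<mm>"
      "g = v + (\<Sum>g'\<in>insert g0 G. scale (b g') g')" using insert.prems[of g] by auto
    have "g = v + (scale (b g0) g0 + (\<Sum>g'\<in>G. scale (b g') g'))"
      using v(3) insert.hyps by simp
    also have "scale (b g0) g0 = scale (b g0) (w' + (\<Sum>g'\<in>G. scale (c' g') g'))" using g0 by simp
    finally have "g = (v + scale (b g0) w') + (\<Sum>g'\<in>G. scale (b g0 * c' g' + b g') g')"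
      by (simp only: scale_right_distrib scale_sum_right scale_scale scale_left_distrib sum.distrib add.assoc)
    moreover have "v + scale (b g0) w' \<in> W" using v(1) w' W subspace_add subspace_scale by blast
    moreover have "b g0 * c' g' + b g' \<in> \<mm>" if "g' \<in> G" for g'
      using that m c' v(2) by simp
    ultimately show "\<exists>w\<in>W. \<exists>c. (\<forall>g'\<in>G. c g' \<in> \<mm>) \<and> g = w + (\<Sum>g'\<in>G. scale (c g') g')"
      by (intro bexI[of _ "v + scale (b g0) w'"] exI[of _ "\<lambda>g'. b g0 * c' g' + b g'"]) auto
  qed
  have "g0 \<in> W" by (subst g0, intro subspace_add[OF W] w' subspace_sum[OF W] subspace_scale[OF W]) (use G in auto)
  with G show ?case by simp
qed simp

section \<open>Homomorphisms from finitely generated algebras to the base field\<close>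

definition sub_alg :: "('k::field \<Rightarrow> 'a::comm_ring_1 \<Rightarrow> 'a) \<Rightarrow> 'a set \<Rightarrow> 'a set" where
  "sub_alg smul S = is_subalgebra smul hull S"

text \<open>These are the \<open>k\<close>-points of \<open>A\<close>; the function
  \<open>\<psi>\<close> is total, but only its values on \<open>A\<close> are meant. The
  normalisation on constants also yields the values at 0 and 1.\<close>

definition hom_on :: "('k::field \<Rightarrow> 'a::comm_ring_1 \<Rightarrow> 'a) \<Rightarrow> 'a set \<Rightarrow> ('a \<Rightarrow> 'k) \<Rightarrow> bool" where
  "hom_on smul A \<psi> \<longleftrightarrow> (\<forall>a\<in>A. \<forall>b\<in>A. \<psi> (a + b) = \<psi> a + \<psi> b \<and> \<psi> (a * b) = \<psi> a * \<psi> b) \<and>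
     (\<forall>c. \<psi> (smul c 1) = c)"

text \<open>The polynomial ring over \<open>A\<close>, which is a set and not a type, as a subset of
  the polynomials over the ambient ring.\<close>

definition coeffs_in :: "'a::zero set \<Rightarrow> 'a poly set" where
  "coeffs_in A = {p. \<forall>i. coeff p i \<in> A}"

context k_algebra begin

lemma is_subalgebra_sub_alg: "is_subalgebra smul (sub_alg smul S)"
  unfolding sub_alg_def
  by (rule hull_in) (auto simp: is_subalgebra_def subspace_Inter)

lemma sub_alg_superset: "S \<subseteq> sub_alg smul S"
  unfolding sub_alg_def by (rule hull_subset)

lemma sub_alg_minimal: "S \<subseteq> A \<Longrightarrow> is_subalgebra smul A \<Longrightarrow> sub_alg smul S \<subseteq> A"
  unfolding sub_alg_def by (rule hull_minimal)

lemma smul_eq_mult: "smul c a = smul c 1 * a"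
  by (simp add: smul_mult)

lemma smul_one_mult: "smul (c * c') 1 = smul c 1 * smul c' 1"
  by (simp add: smul_mult)

lemma mult_smul: "a * smul c b = smul c (a * b)"
  by (metis mult.commute smul_mult)

lemma subalgebra_closed:
  assumes "is_subalgebra smul A"
  shows "0 \<in> A" "1 \<in> A" "a \<in> A \<Longrightarrow> b \<in> A \<Longrightarrow> a + b \<in> A" "a \<in> A \<Longrightarrow> b \<in> A \<Longrightarrow> a * b \<in> A"
    "a \<in> A \<Longrightarrow> b \<in> A \<Longrightarrow> a - b \<in> A" "a \<in> A \<Longrightarrow> - a \<in> A" "a \<in> A \<Longrightarrow> smul c a \<in> A"
    "(\<And>i. i \<in> I \<Longrightarrow> f i \<in> A) \<Longrightarrow> sum f I \<in> A" "a \<in> A \<Longrightarrow> a ^ n \<in> A"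
proof -
  have s: "subspace A" and o: "1 \<in> A" and m: "\<And>x y. x \<in> A \<Longrightarrow> y \<in> A \<Longrightarrow> x * y \<in> A"
    using assms by (auto simp: is_subalgebra_def)
  show "0 \<in> A" "1 \<in> A" "a \<in> A \<Longrightarrow> b \<in> A \<Longrightarrow> a + b \<in> A" "a \<in> A \<Longrightarrow> b \<in> A \<Longrightarrow> a * b \<in> A"
    "a \<in> A \<Longrightarrow> b \<in> A \<Longrightarrow> a - b \<in> A" "a \<in> A \<Longrightarrow> - a \<in> A" "a \<in> A \<Longrightarrow> smul c a \<in> A"
    "(\<And>i. i \<in> I \<Longrightarrow> f i \<in> A) \<Longrightarrow> sum f I \<in> A"
    by (fact o m[of a b] subspace_0[OF s] subspace_add[OF s] subspace_diff[OF s] subspace_neg[OF s]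
        subspace_scale[OF s] subspace_sum[OF s])+
  show "a \<in> A \<Longrightarrow> a ^ n \<in> A" using o m by (induction n) auto
qed

lemma hom_on_simps:
  assumes \<psi>: "hom_on smul A \<psi>" and A: "is_subalgebra smul A"
  shows "\<psi> 0 = 0" "\<psi> 1 = 1" "a \<in> A \<Longrightarrow> b \<in> A \<Longrightarrow> \<psi> (a + b) = \<psi> a + \<psi> b"
    "a \<in> A \<Longrightarrow> b \<in> A \<Longrightarrow> \<psi> (a * b) = \<psi> a * \<psi> b" "\<psi> (smul c 1) = c"
    "a \<in> A \<Longrightarrow> b \<in> A \<Longrightarrow> \<psi> (a - b) = \<psi> a - \<psi> b"
    "(\<And>i. i \<in> I \<Longrightarrow> f i \<in> A) \<Longrightarrow> \<psi> (sum f I) = (\<Sum>i\<in>I. \<psi> (f i))"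
    "a \<in> A \<Longrightarrow> \<psi> (a ^ n) = \<psi> a ^ n"
proof -
  have c: "\<psi> (smul c 1) = c" for c using \<psi> by (simp add: hom_on_def)
  show z: "\<psi> 0 = 0" using c[of 0] by simp
  show one: "\<psi> 1 = 1" using c[of 1] by simp
  show add: "a \<in> A \<Longrightarrow> b \<in> A \<Longrightarrow> \<psi> (a + b) = \<psi> a + \<psi> b" for a b using \<psi> by (simp add: hom_on_def)
  show mult: "a \<in> A \<Longrightarrow> b \<in> A \<Longrightarrow> \<psi> (a * b) = \<psi> a * \<psi> b" for a b using \<psi> by (simp add: hom_on_def)
  show "\<psi> (smul c 1) = c" by (rule c)
  show "\<psi> (a - b) = \<psi> a - \<psi> b" if "a \<in> A" "b \<in> A"
    using add[of "a - b" b] that subalgebra_closed[OF A] by (simp add: algebra_simps)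
  show "(\<And>i. i \<in> I \<Longrightarrow> f i \<in> A) \<Longrightarrow> \<psi> (sum f I) = (\<Sum>i\<in>I. \<psi> (f i))"
    by (induction I rule: infinite_finite_induct) (auto simp: z add subalgebra_closed[OF A])
  show "a \<in> A \<Longrightarrow> \<psi> (a ^ n) = \<psi> a ^ n"
    by (induction n) (auto simp: one mult subalgebra_closed[OF A])
qed

lemma coeffs_in_closed:
  assumes A: "is_subalgebra smul A"
  shows "0 \<in> coeffs_in A" "1 \<in> coeffs_in A" "p \<in> coeffs_in A \<Longrightarrow> q \<in> coeffs_in A \<Longrightarrow> p + q \<in> coeffs_in A"
    "p \<in> coeffs_in A \<Longrightarrow> q \<in> coeffs_in A \<Longrightarrow> p - q \<in> coeffs_in A"
    "p \<in> coeffs_in A \<Longrightarrow> q \<in> coeffs_in A \<Longrightarrow> p * q \<in> coeffs_in A"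
    "a \<in> A \<Longrightarrow> monom a n \<in> coeffs_in A" "a \<in> A \<Longrightarrow> p \<in> coeffs_in A \<Longrightarrow> Polynomial.smult a p \<in> coeffs_in A"
proof -
  note cl = subalgebra_closed[OF A]
  show "0 \<in> coeffs_in A" "1 \<in> coeffs_in A" using cl(1,2) by (auto simp: coeffs_in_def coeff_1)
  show "p \<in> coeffs_in A \<Longrightarrow> q \<in> coeffs_in A \<Longrightarrow> p + q \<in> coeffs_in A"
    "p \<in> coeffs_in A \<Longrightarrow> q \<in> coeffs_in A \<Longrightarrow> p - q \<in> coeffs_in A"
    using cl(3,5) by (simp_all add: coeffs_in_def)
  show "p \<in> coeffs_in A \<Longrightarrow> q \<in> coeffs_in A \<Longrightarrow> p * q \<in> coeffs_in A"
    unfolding coeffs_in_def mem_Collect_eq coeff_mult by (intro allI cl(8) cl(4)) simp_all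
  show "a \<in> A \<Longrightarrow> monom a n \<in> coeffs_in A" using cl(1) by (simp add: coeffs_in_def)
  show "a \<in> A \<Longrightarrow> p \<in> coeffs_in A \<Longrightarrow> Polynomial.smult a p \<in> coeffs_in A"
    using cl(4) by (simp add: coeffs_in_def)
qed

lemma poly_coeffs_in:
  assumes A: "is_subalgebra smul A" and "p \<in> coeffs_in A" "b \<in> A"
  shows "poly p b \<in> A"
  unfolding poly_altdef using assms(2,3)
  by (intro subalgebra_closed(4,8,9)[OF A]) (auto simp: coeffs_in_def)

lemma sub_alg_insert:
  "sub_alg smul (insert b S) = {poly p b |p. p \<in> coeffs_in (sub_alg smul S)}" (is "?B = ?C")
proof
  note A = is_subalgebra_sub_alg[of S]
  note cl = coeffs_in_closed[OF A] subalgebra_closed[OF A]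
  have "is_subalgebra smul ?C"
    unfolding is_subalgebra_def subspace_def
  proof (intro conjI ballI allI)
    show "0 \<in> ?C" using cl(1) by (auto intro!: exI[of _ 0])
    show "1 \<in> ?C" using cl(2) by (auto intro!: exI[of _ 1])
    fix x assume "x \<in> ?C"
    then obtain p where p: "x = poly p b" "p \<in> coeffs_in (sub_alg smul S)" by auto
    have "smul c x = poly (Polynomial.smult (smul c 1) p) b" for c using p by (simp add: smul_mult)
    moreover have "Polynomial.smult (smul c 1) p \<in> coeffs_in (sub_alg smul S)" for c
      by (intro cl(7) p(2) cl(14) cl(9))
    ultimately show "smul c x \<in> ?C" for c by blast
    fix y assume "y \<in> ?C"
    then obtain q where q: "y = poly q b" "q \<in> coeffs_in (sub_alg smul S)" by auto
    have "x + y = poly (p + q) b" "x * y = poly (p * q) b" using p q by simp_all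
    then show "x + y \<in> ?C" using cl(3)[OF p(2) q(2)] by blast
    show "x * y \<in> ?C" using \<open>x * y = _\<close> cl(5)[OF p(2) q(2)] by blast
  qed
  moreover have "insert b S \<subseteq> ?C"
  proof
    fix s assume "s \<in> insert b S"
    then consider "s = b" | "s \<in> sub_alg smul S" using sub_alg_superset[of S] by blast
    then show "s \<in> ?C"
    proof cases
      case 1
      then have "s = poly (monom 1 1) b" by (simp add: poly_monom)
      with cl(6)[OF cl(9)] show ?thesis by blast
    next
      case 2
      have "s = poly (monom s 0) b" by (simp add: poly_monom)
      with cl(6)[OF 2] show ?thesis by blast
    qed
  qed
  ultimately show "?B \<subseteq> ?C" by (rule sub_alg_minimal[rotated])
  have "sub_alg smul S \<subseteq> ?B"
    by (rule sub_alg_minimal[OF _ is_subalgebra_sub_alg]) (use sub_alg_superset in blast)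
  then have "coeffs_in (sub_alg smul S) \<subseteq> coeffs_in ?B" by (auto simp: coeffs_in_def)
  moreover have "b \<in> ?B" using sub_alg_superset[of "insert b S"] by simp
  ultimately show "?C \<subseteq> ?B" using poly_coeffs_in[OF is_subalgebra_sub_alg, of _ "insert b S" b] by auto
qed

lemma map_poly_hom_on:
  assumes \<psi>: "hom_on smul A \<psi>" and A: "is_subalgebra smul A" and "p \<in> coeffs_in A" "q \<in> coeffs_in A"
  shows "map_poly \<psi> (p + q) = map_poly \<psi> p + map_poly \<psi> q"
    "map_poly \<psi> (p - q) = map_poly \<psi> p - map_poly \<psi> q"
    "map_poly \<psi> (p * q) = map_poly \<psi> p * map_poly \<psi> q"
proof -
  note h = hom_on_simps[OF \<psi> A]
  have c: "coeff (map_poly \<psi> p) i = \<psi> (coeff p i)" for p i by (simp add: coeff_map_poly h(1))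
  have pq: "coeff p i \<in> A" "coeff q i \<in> A" for i using assms(3,4) by (auto simp: coeffs_in_def)
  show "map_poly \<psi> (p + q) = map_poly \<psi> p + map_poly \<psi> q"
    "map_poly \<psi> (p - q) = map_poly \<psi> p - map_poly \<psi> q"
    "map_poly \<psi> (p * q) = map_poly \<psi> p * map_poly \<psi> q"
    by (rule poly_eqI; simp add: c h pq coeff_mult subalgebra_closed[OF A])+
qed

end

text \<open>Over a ring the leading coefficient of \<open>F\<close> cannot be inverted, so division
  with remainder costs a power of it; points are later chosen where this power does not
  vanish.\<close>

lemma (in k_algebra) pseudo_division:
  fixes F :: "'a poly"
  assumes A: "is_subalgebra smul A" and F: "F \<in> coeffs_in A" "degree F > 0" and p: "p \<in> coeffs_in A"
  shows "\<exists>m Q R. Q \<in> coeffs_in A \<and> R \<in> coeffs_in A \<and> degree R < degree F \<and>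
     Polynomial.smult (lead_coeff F ^ m) p = Q * F + R"
  using p
proof (induction "degree p" arbitrary: p rule: less_induct)
  case less
  note cl = coeffs_in_closed[OF A] subalgebra_closed[OF A]
  show ?case
  proof (cases "degree p < degree F")
    case True
    then show ?thesis using less.prems cl(1) by (intro exI[of _ 0] exI[of _ p]) auto
  next
    case False
    let ?l = "lead_coeff F" and ?k = "degree p - degree F"
    let ?M = "monom (lead_coeff p) ?k"
    let ?p = "Polynomial.smult ?l p - ?M * F"
    have lA: "?l \<in> A" "lead_coeff p \<in> A" using F less.prems by (auto simp: coeffs_in_def)
    have pA: "?p \<in> coeffs_in A" using F less.prems lA cl by auto
    have MA: "?M \<in> coeffs_in A" using lA cl by auto
    have dp: "degree p > 0" using False F(2) by simp
    have "degree ?p < degree p"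
    proof -
      have "degree (?M * F) \<le> degree p"
        using degree_mult_le[of ?M F] degree_monom_le[of "lead_coeff p" ?k] False by linarith
      then have 1: "degree ?p \<le> degree p"
        by (intro degree_diff_le) (auto intro: degree_smult_le)
      have "coeff (?M * F) (degree p) = lead_coeff p * coeff F (degree p - ?k)"
        by (subst coeff_monom_mult) (use False in auto)
      then have "coeff ?p (degree p) = 0" using False by simp
      with 1 dp show ?thesis by (metis degree_0 eq_zero_or_degree_less)
    qed
    from less.hyps[OF this pA] obtain m Q R where
      *: "Q \<in> coeffs_in A" "R \<in> coeffs_in A" "degree R < degree F"
        "Polynomial.smult (?l ^ m) ?p = Q * F + R" by blast
    have "Polynomial.smult (?l ^ Suc m) p = Polynomial.smult (?l ^ m) ?p + Polynomial.smult (?l ^ m) (?M * F)"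
      by (simp add: smult_diff_right mult.commute)
    also have "\<dots> = (Q + Polynomial.smult (?l ^ m) ?M) * F + R" by (simp only: *(4) distrib_right mult_smult_left) (simp add: ac_simps)
    finally have "Polynomial.smult (?l ^ Suc m) p = (Q + Polynomial.smult (?l ^ m) ?M) * F + R" .
    moreover have "Q + Polynomial.smult (?l ^ m) ?M \<in> coeffs_in A"
      by (intro cl(3) *(1) cl(7) MA cl(16) lA)
    ultimately show ?thesis using *(2,3) by metis
  qed
qed

section \<open>Extension of points along one new generator\<close>

context
  fixes smul :: "'k::alg_closed_field \<Rightarrow> 'a::idom \<Rightarrow> 'a" and A :: "'a set" and b :: 'a
  assumes alg: "k_algebra smul" and A: "is_subalgebra smul A"
begin

interpretation k_algebra smul by (rule alg)

text \<open>The value at an element of \<open>A[b]\<close> is read off from a chosen polynomial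
  expression; \<open>wd\<close>, applied to the difference of two expressions, shows that the choice
  does not matter.\<close>

lemma hom_on_adjoin:
  assumes \<psi>: "hom_on smul A \<psi>"
    and wd: "\<And>p. p \<in> coeffs_in A \<Longrightarrow> poly p b = 0 \<Longrightarrow> poly (map_poly \<psi> p) c = 0"
  shows "\<exists>\<phi>. hom_on smul {poly p b |p. p \<in> coeffs_in A} \<phi> \<and>
     (\<forall>p\<in>coeffs_in A. \<phi> (poly p b) = poly (map_poly \<psi> p) c)"
proof -
  note cl = coeffs_in_closed[OF A] subalgebra_closed[OF A]
  note h = hom_on_simps[OF \<psi> A]
  define \<phi> where "\<phi> z = poly (map_poly \<psi> (SOME p. p \<in> coeffs_in A \<and> poly p b = z)) c" for z
  have \<phi>: "\<phi> (poly p b) = poly (map_poly \<psi> p) c" if p: "p \<in> coeffs_in A" for p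
  proof -
    let ?q = "SOME q. q \<in> coeffs_in A \<and> poly q b = poly p b"
    have q: "?q \<in> coeffs_in A \<and> poly ?q b = poly p b" by (rule someI) (use p in simp)
    then have "poly (map_poly \<psi> (?q - p)) c = 0" using p cl(4) by (intro wd) auto
    then show ?thesis unfolding \<phi>_def using map_poly_hom_on(2)[OF \<psi> A, of ?q p] q p by simp
  qed
  have "hom_on smul {poly p b |p. p \<in> coeffs_in A} \<phi>"
    unfolding hom_on_def
  proof (intro conjI ballI allI)
    fix k
    have "\<phi> (poly (monom (smul k 1) 0) b) = poly (map_poly \<psi> (monom (smul k 1) 0)) c"
      by (rule \<phi>) (intro cl(6) cl(14) cl(9))
    then show "\<phi> (smul k 1) = k" by (simp add: poly_monom map_poly_monom h(1) h(5))
  next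
    fix x y assume "x \<in> {poly p b |p. p \<in> coeffs_in A}" "y \<in> {poly p b |p. p \<in> coeffs_in A}"
    then obtain p q where pq: "p \<in> coeffs_in A" "q \<in> coeffs_in A" "x = poly p b" "y = poly q b" by auto
    have "\<phi> (poly (p + q) b) = \<phi> x + \<phi> y" "\<phi> (poly (p * q) b) = \<phi> x * \<phi> y"
      using \<phi>[OF cl(3)[OF pq(1,2)]] \<phi>[OF cl(5)[OF pq(1,2)]] map_poly_hom_on[OF \<psi> A pq(1,2)] \<phi> pq
      by simp_all
    then show "\<phi> (x + y) = \<phi> x + \<phi> y" "\<phi> (x * y) = \<phi> x * \<phi> y" using pq by simp_all
  qed
  with \<phi> show ?thesis by blast
qed

text \<open>Over the fraction field of \<open>A\<close> a relation \<open>F\<close> of least degree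
  is irreducible, so the value of \<open>G\<close> at \<open>b\<close> is invertible;
  \<open>V\<close> and \<open>\<gamma>\<close> are numerator and denominator of the inverse. They
  are found by Euclid's algorithm: the remainder of \<open>F\<close> by \<open>G\<close> takes a
  multiple of \<open>poly G b\<close> as its value at \<open>b\<close>.\<close>

lemma minimal_degree_relation_not_dvd:
  assumes F: "F \<in> coeffs_in A" "poly F b = 0" "F \<noteq> 0"
    and min: "\<And>p. p \<in> coeffs_in A \<Longrightarrow> p \<noteq> 0 \<Longrightarrow> poly p b = 0 \<Longrightarrow> degree F \<le> degree p"
    and G: "G \<in> coeffs_in A" "G \<noteq> 0" "degree G < degree F"
  shows "\<exists>V\<in>coeffs_in A. \<exists>\<gamma>\<in>A. \<gamma> \<noteq> 0 \<and> poly V b * poly G b = \<gamma>"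
  using G
proof (induction "degree G" arbitrary: G rule: less_induct)
  case less
  note cl = coeffs_in_closed[OF A] subalgebra_closed[OF A]
  show ?case
  proof (cases "degree G = 0")
    case True
    then obtain g where g: "G = [:g:]" by (metis degree_eq_zeroE)
    then have "g \<in> A" "g \<noteq> 0" using less.prems by (auto simp: coeffs_in_def dest: spec[of _ 0])
    then show ?thesis using g cl(2) by (intro bexI[of _ 1] bexI[of _ g]) auto
  next
    case False
    obtain m Q R where *: "Q \<in> coeffs_in A" "R \<in> coeffs_in A" "degree R < degree G"
        "Polynomial.smult (lead_coeff G ^ m) F = Q * G + R"
      using pseudo_division[OF A less.prems(1) _ F(1)] False by auto
    have l: "lead_coeff G ^ m \<noteq> 0" using less.prems by simp
    have Qne: "Q * G \<noteq> 0"
    proof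
      assume "Q * G = 0"
      then have "degree F \<le> degree R" using *(4) l by (metis add_0 degree_smult_eq order_refl)
      then show False using *(3) less.prems(3) by simp
    qed
    \<comment> \<open>A zero remainder would make \<open>Q\<close> or \<open>G\<close> a relation of
      smaller degree than \<open>F\<close>.\<close>
    have "R \<noteq> 0"
    proof
      assume "R = 0"
      then have "poly Q b * poly G b = 0" using *(4) F(2) by (metis add.right_neutral mult_zero_right poly_mult poly_smult)
      then have "poly Q b = 0 \<or> poly G b = 0" by simp
      moreover have "degree Q + degree G = degree F"
        using *(4) \<open>R = 0\<close> l Qne degree_mult_eq[of Q G] by (metis add.right_neutral degree_smult_eq mult_zero_left mult_zero_right)
      then have "degree Q < degree F" using False by simp
      ultimately show False using min[OF *(1)] min[OF less.prems(1)] Qne less.prems by auto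
    qed
    have "degree R < degree F" using *(3) less.prems(3) by simp
    from less.hyps[OF *(3) *(2) \<open>R \<noteq> 0\<close> this] obtain V \<gamma> where
      V: "V \<in> coeffs_in A" "\<gamma> \<in> A" "\<gamma> \<noteq> 0" "poly V b * poly R b = \<gamma>" by blast
    have "lead_coeff G ^ m * poly F b = poly Q b * poly G b + poly R b"
      by (metis *(4) poly_add poly_mult poly_smult)
    then have "poly R b = - (poly Q b * poly G b)" using F(2) by (simp add: eq_neg_iff_add_eq_0 add.commute)
    then have "poly ((0 - V) * Q) b * poly G b = \<gamma>" using V(4) by (simp add: mult.assoc)
    moreover have "(0 - V) * Q \<in> coeffs_in A" by (intro cl *(1) V(1))
    ultimately show ?thesis using V by blast
  qed
qed

lemma alg_closed_infinite: "infinite (UNIV :: 'k set)"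
proof
  assume fin: "finite (UNIV :: 'k set)"
  let ?P = "\<Prod>a\<in>UNIV. [:- a, 1 :: 'k:]"
  have "degree ?P = card (UNIV :: 'k set)" by (subst degree_prod_eq_sum_degree) auto
  then have "degree (?P + 1) > 0" using fin by (simp add: degree_add_eq_left finite_UNIV_card_ge_0)
  then obtain c where "poly (?P + 1) c = 0" using alg_closed_imp_poly_has_root by blast
  moreover have "poly ?P c = 0" using fin by (simp add: poly_prod)
  ultimately show False by simp
qed

text \<open>A transcendental \<open>b\<close> may go anywhere outside the finitely many roots of the
  image of \<open>G\<close>; an algebraic \<open>b\<close> is sent to a root of the image of its
  minimal relation.\<close>

lemma hom_on_adjoin_nonvanishing:
  assumes ex: "\<And>g. g \<in> A \<Longrightarrow> g \<noteq> 0 \<Longrightarrow> \<exists>\<psi>. hom_on smul A \<psi> \<and> \<psi> g \<noteq> 0"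
    and G: "G \<in> coeffs_in A" "poly G b \<noteq> 0"
  shows "\<exists>\<phi>. hom_on smul {poly p b |p. p \<in> coeffs_in A} \<phi> \<and> \<phi> (poly G b) \<noteq> 0"
proof (cases "\<exists>F\<in>coeffs_in A. F \<noteq> 0 \<and> poly F b = 0")
  case False
  have "G \<noteq> 0" using G by auto
  then obtain \<psi> where \<psi>: "hom_on smul A \<psi>" "\<psi> (lead_coeff G) \<noteq> 0"
    using ex[of "lead_coeff G"] G by (auto simp: coeffs_in_def)
  note h = hom_on_simps[OF \<psi>(1) A]
  have "coeff (map_poly \<psi> G) (degree G) \<noteq> 0" using \<psi>(2) by (simp add: coeff_map_poly h(1))
  then have "map_poly \<psi> G \<noteq> 0" by auto
  then have "finite {c. poly (map_poly \<psi> G) c = 0}" by (rule poly_roots_finite)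
  then obtain c where c: "poly (map_poly \<psi> G) c \<noteq> 0"
    using ex_new_if_finite[OF alg_closed_infinite] by blast
  have "poly (map_poly \<psi> p) c = 0" if "p \<in> coeffs_in A" "poly p b = 0" for p
    using False that by auto
  from hom_on_adjoin[OF \<psi>(1) this] obtain \<phi> where
    "hom_on smul {poly p b |p. p \<in> coeffs_in A} \<phi>"
    "\<forall>p\<in>coeffs_in A. \<phi> (poly p b) = poly (map_poly \<psi> p) c" by blast
  with c G(1) show ?thesis by auto
next
  case True
  note cl = coeffs_in_closed[OF A] subalgebra_closed[OF A]
  define n where "n = (LEAST n. \<exists>F\<in>coeffs_in A. F \<noteq> 0 \<and> poly F b = 0 \<and> degree F = n)"
  have "\<exists>F\<in>coeffs_in A. F \<noteq> 0 \<and> poly F b = 0 \<and> degree F = n"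
    unfolding n_def by (rule LeastI_ex) (use True in blast)
  then obtain F where F: "F \<in> coeffs_in A" "F \<noteq> 0" "poly F b = 0" "degree F = n" by blast
  have min: "degree F \<le> degree p" if "p \<in> coeffs_in A" "p \<noteq> 0" "poly p b = 0" for p
    unfolding F(4) n_def by (rule Least_le) (use that in blast)
  let ?\<alpha> = "lead_coeff F"
  have \<alpha>: "?\<alpha> \<in> A" "?\<alpha> \<noteq> 0" using F by (auto simp: coeffs_in_def)
  have deg: "degree F > 0"
  proof (rule ccontr)
    assume "\<not> degree F > 0"
    then obtain f where "F = [:f:]" by (metis degree_eq_zeroE gr0I)
    then show False using F by simp
  qed
  obtain m Q R where R: "Q \<in> coeffs_in A" "R \<in> coeffs_in A" "degree R < degree F"
    "Polynomial.smult (?\<alpha> ^ m) G = Q * F + R"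
    using pseudo_division[OF A F(1) deg G(1)] by auto
  have Rb: "poly R b = ?\<alpha> ^ m * poly G b" using arg_cong[OF R(4), of "\<lambda>p. poly p b"] F(3) by simp
  then have "R \<noteq> 0" using G(2) \<alpha>(2) by auto
  from minimal_degree_relation_not_dvd[OF F(1,3,2) min R(2) this R(3)]
  obtain V \<gamma> where V: "V \<in> coeffs_in A" "\<gamma> \<in> A" "\<gamma> \<noteq> 0" "poly V b * poly R b = \<gamma>" by blast
  \<comment> \<open>\<open>?\<alpha>\<close> must survive so that the image of \<open>F\<close>
    still has a root and powers of \<open>?\<alpha>\<close> can be cancelled after applying
    \<open>\<psi>\<close>; \<open>\<gamma>\<close> must survive because it is a multiple of
    \<open>poly G b\<close>.\<close>
  obtain \<psi> where \<psi>: "hom_on smul A \<psi>" "\<psi> (?\<alpha> * \<gamma>) \<noteq> 0"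
    using ex[of "?\<alpha> * \<gamma>"] \<alpha> V cl by auto
  note h = hom_on_simps[OF \<psi>(1) A]
  have \<psi>\<alpha>: "\<psi> ?\<alpha> \<noteq> 0" "\<psi> \<gamma> \<noteq> 0" using \<psi>(2) h(4)[OF \<alpha>(1) V(2)] by auto
  have "coeff (map_poly \<psi> F) n \<noteq> 0" using \<psi>\<alpha> F(4) by (simp add: coeff_map_poly h(1))
  then have "degree (map_poly \<psi> F) > 0" using deg F(4) le_degree by fastforce
  then obtain c where c: "poly (map_poly \<psi> F) c = 0" using alg_closed_imp_poly_has_root by blast
  have wd: "poly (map_poly \<psi> p) c = 0" if p: "p \<in> coeffs_in A" "poly p b = 0" for p
  proof -
    obtain m Q R where R: "Q \<in> coeffs_in A" "R \<in> coeffs_in A" "degree R < degree F"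
      "Polynomial.smult (?\<alpha> ^ m) p = Q * F + R"
      using pseudo_division[OF A F(1) deg p(1)] by auto
    have "poly R b = 0" using arg_cong[OF R(4), of "\<lambda>p. poly p b"] F(3) p(2) by simp
    then have "R = 0" using min[OF R(2)] R(3) by auto
    then have "monom (?\<alpha> ^ m) 0 * p = Q * F" using R(4) by (simp add: monom_0)
    then have "map_poly \<psi> (monom (?\<alpha> ^ m) 0 * p) = map_poly \<psi> (Q * F)" by simp
    moreover have "monom (?\<alpha> ^ m) 0 \<in> coeffs_in A" by (intro cl(6) cl(16) \<alpha>(1))
    ultimately have "map_poly \<psi> (monom (?\<alpha> ^ m) 0) * map_poly \<psi> p = map_poly \<psi> Q * map_poly \<psi> F"
      using map_poly_hom_on(3)[OF \<psi>(1) A] p(1) R(1) F(1) by metis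
    then have "monom (\<psi> ?\<alpha> ^ m) 0 * map_poly \<psi> p = map_poly \<psi> Q * map_poly \<psi> F"
      by (simp add: map_poly_monom h(1) h(8) \<alpha>(1))
    from arg_cong[OF this, of "\<lambda>p. poly p c"] c \<psi>\<alpha> show ?thesis by (simp add: poly_monom)
  qed
  from hom_on_adjoin[OF \<psi>(1) wd] obtain \<phi> where \<phi>: "hom_on smul {poly p b |p. p \<in> coeffs_in A} \<phi>"
    "\<And>p. p \<in> coeffs_in A \<Longrightarrow> \<phi> (poly p b) = poly (map_poly \<psi> p) c" by blast
  have "poly (V * monom (?\<alpha> ^ m) 0) b * poly G b = poly (monom \<gamma> 0) b"
    using V(4) Rb by (simp add: poly_monom mult.assoc)
  then have "\<phi> (poly (V * monom (?\<alpha> ^ m) 0) b * poly G b) = \<phi> (poly (monom \<gamma> 0) b)" by simp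
  also have "\<dots> = \<psi> \<gamma>" using \<phi>(2)[OF cl(6)[OF V(2)], of 0] by (simp add: poly_monom map_poly_monom h(1))
  also have "\<phi> (poly (V * monom (?\<alpha> ^ m) 0) b * poly G b) = \<phi> (poly (V * monom (?\<alpha> ^ m) 0) b) * \<phi> (poly G b)"
    using \<phi>(1) cl(5)[OF V(1) cl(6)[OF cl(16)[OF \<alpha>(1)]]] G(1) unfolding hom_on_def by blast
  finally show ?thesis using \<psi>\<alpha>(2) \<phi>(1) by auto
qed

end

text \<open>Nonvanishing at \<open>g\<close> is carried through the induction on the generators,
  since adjoining one needs a point of the smaller algebra at which a leading coefficient and a
  denominator survive. It also yields the general closed point for the Jacobian matrix.\<close>

theorem nullstellensatz_point:
  fixes smul :: "'k::alg_closed_field \<Rightarrow> 'a::idom \<Rightarrow> 'a"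
  assumes "k_algebra smul" "finite S" "g \<in> sub_alg smul S" "g \<noteq> 0"
  shows "\<exists>\<psi>. hom_on smul (sub_alg smul S) \<psi> \<and> \<psi> g \<noteq> 0"
proof -
  interpret k_algebra smul by fact
  show ?thesis using assms(2-)
  proof (induction S arbitrary: g rule: finite_induct)
    case empty
    have inj: "smul c 1 = smul c' 1 \<longleftrightarrow> c = c'" for c c' by simp
    define \<psi> where "\<psi> z = (THE c. z = smul c 1)" for z
    have \<psi>: "\<psi> (smul c 1) = c" for c unfolding \<psi>_def by simp
    have "is_subalgebra smul (range (\<lambda>c. smul c 1))"
      unfolding is_subalgebra_def subspace_def
      by (auto simp flip: scale_left_distrib smul_one_mult intro: range_eqI[of _ _ 0] range_eqI[of _ _ 1])
    then have sub: "sub_alg smul {} \<subseteq> range (\<lambda>c. smul c 1)" by (intro sub_alg_minimal) auto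
    have "hom_on smul (range (\<lambda>c. smul c 1)) \<psi>"
      unfolding hom_on_def by (auto simp: \<psi> simp flip: scale_left_distrib smul_one_mult)
    then have "hom_on smul (sub_alg smul {}) \<psi>" using sub unfolding hom_on_def by blast
    moreover have "\<psi> g \<noteq> 0" using sub empty \<psi> by auto
    ultimately show ?case by blast
  next
    case (insert b S)
    then obtain G where "G \<in> coeffs_in (sub_alg smul S)" "g = poly G b" unfolding sub_alg_insert by auto
    with hom_on_adjoin_nonvanishing[OF assms(1) is_subalgebra_sub_alg insert.IH] insert.prems(2)
    show ?case unfolding sub_alg_insert by blast
  qed
qed

section \<open>Residue fields of closed points\<close>

lemma max_ideal_closed:
  fixes r :: "'a::local_ring"
  shows "0 \<in> (max_ideal :: 'a set)" "r \<in> max_ideal \<Longrightarrow> r' \<in> max_ideal \<Longrightarrow> r + r' \<in> max_ideal"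
    "r \<in> max_ideal \<Longrightarrow> s * r \<in> max_ideal" "r \<in> max_ideal \<Longrightarrow> r * s \<in> max_ideal"
    "r \<in> max_ideal \<Longrightarrow> r' \<in> max_ideal \<Longrightarrow> r - r' \<in> max_ideal"
    "(\<And>i. i \<in> I \<Longrightarrow> f i \<in> max_ideal) \<Longrightarrow> sum f I \<in> (max_ideal :: 'a set)"
proof -
  note m = is_ideal_max_ideal[where 'a = 'a]
  show "0 \<in> (max_ideal :: 'a set)" by (rule module.subspace_0[OF self_module m])
  show "r \<in> max_ideal \<Longrightarrow> r' \<in> max_ideal \<Longrightarrow> r + r' \<in> max_ideal" by (rule module.subspace_add[OF self_module m])
  show "r \<in> max_ideal \<Longrightarrow> s * r \<in> max_ideal" by (rule module.subspace_scale[OF self_module m])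
  then show "r \<in> max_ideal \<Longrightarrow> r * s \<in> max_ideal" by (simp add: mult.commute)
  show "r \<in> max_ideal \<Longrightarrow> r' \<in> max_ideal \<Longrightarrow> r - r' \<in> max_ideal" by (rule module.subspace_diff[OF self_module m])
  show "(\<And>i. i \<in> I \<Longrightarrow> f i \<in> max_ideal) \<Longrightarrow> sum f I \<in> (max_ideal :: 'a set)" by (rule module.subspace_sum[OF self_module m])
qed

lemma one_minus_max_ideal:
  fixes z :: "'a::local_ring"
  assumes "z \<in> max_ideal"
  shows "\<exists>u. u * (1 - z) = 1"
proof -
  have "(1 - z) dvd 1"
  proof (rule ccontr)
    assume "\<not> (1 - z) dvd 1"
    then have "(1 - z) + z \<in> max_ideal" using assms max_ideal_closed(2) unfolding max_ideal_def by blast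
    then show False by (simp add: max_ideal_def)
  qed
  then show ?thesis by (auto simp: dvd_def mult.commute)
qed

lemma is_ideal_ofD:
  assumes "is_ideal_of A I"
  shows "I \<subseteq> A" "0 \<in> I" "a \<in> I \<Longrightarrow> b \<in> I \<Longrightarrow> a + b \<in> I" "c \<in> A \<Longrightarrow> a \<in> I \<Longrightarrow> c * a \<in> I"
  using assms by (auto simp: is_ideal_of_def)

context k_algebra begin

lemma maximal_ideal_inverse:
  assumes A: "is_subalgebra smul A" and M: "maximal_ideal_of A M" and a: "a \<in> A" "a \<notin> M"
  shows "\<exists>u\<in>A. u * a - 1 \<in> M"
proof -
  note cl = subalgebra_closed[OF A]
  have MI: "is_ideal_of A M" using M by (simp add: maximal_ideal_of_def)
  note m = is_ideal_ofD[OF MI]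
  let ?I = "{z + u * a |z u. z \<in> M \<and> u \<in> A}"
  have "is_ideal_of A ?I"
    unfolding is_ideal_of_def
  proof (intro conjI ballI)
    show "?I \<subseteq> A" using m(1) a(1) cl(3,4) by auto
    have "0 = 0 + 0 * a" by simp
    then show "0 \<in> ?I" using m(2) cl(1) by blast
  next
    fix y z assume "y \<in> ?I" "z \<in> ?I"
    then obtain y1 u1 z1 u2 where *: "y1 \<in> M" "u1 \<in> A" "y = y1 + u1 * a" "z1 \<in> M" "u2 \<in> A" "z = z1 + u2 * a" by blast
    then have "y + z = (y1 + z1) + (u1 + u2) * a" by (simp add: algebra_simps)
    then show "y + z \<in> ?I" using m(3)[OF *(1,4)] cl(3)[OF *(2,5)] by blast
  next
    fix c y assume "c \<in> A" "y \<in> ?I"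
    then obtain y1 u1 where *: "c \<in> A" "y1 \<in> M" "u1 \<in> A" "y = y1 + u1 * a" by blast
    then have "c * y = c * y1 + (c * u1) * a" by (simp add: algebra_simps)
    then show "c * y \<in> ?I" using m(4)[OF *(1,2)] cl(4)[OF *(1,3)] by blast
  qed
  moreover have "M \<subseteq> ?I"
  proof
    fix z assume "z \<in> M"
    moreover have "z = z + 0 * a" by simp
    ultimately show "z \<in> ?I" using cl(1) by blast
  qed
  moreover have "a \<in> ?I"
  proof -
    have "a = 0 + 1 * a" by simp
    then show ?thesis using m(2) cl(2) by blast
  qed
  ultimately have "?I = A" using M a(2) unfolding maximal_ideal_of_def by blast
  then obtain z u where zu: "1 = z + u * a" "z \<in> M" "u \<in> A" using cl(2) by blast
  have "(- 1) * z \<in> M" by (intro m(4) zu(2) cl(6) cl(2))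
  moreover have "u * a - 1 = (-1) * z" using zu(1) by (simp add: algebra_simps)
  ultimately show ?thesis using zu(3) by metis
qed

lemma map_poly_smul_one_mult:
  "map_poly (\<lambda>c. smul c 1) (p * q) = map_poly (\<lambda>c. smul c 1) p * map_poly (\<lambda>c. smul c 1) q"
  by (rule poly_eqI) (simp add: coeff_map_poly coeff_mult scale_sum_left smul_one_mult)

end

text \<open>
  \<open>\<mm>/\<mm>\<^sup>2\<close> is nonzero and finite-dimensional over \<open>k\<close>, so \<open>a\<close> satisfies a polynomial equation on some
  nonzero vector of it; splitting off linear factors gives an eigenvalue of \<open>a\<close>.
\<close>
lemma maximal_ideal_residue:
  fixes smul :: "'k::alg_closed_field \<Rightarrow> 'a::comm_ring_1 \<Rightarrow> 'a"
  assumes "k_algebra smul" and A: "is_subalgebra smul A" and M: "maximal_ideal_of A M"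
    and dim: "has_quot_dim smul M (module.span smul {x * y |x y. x \<in> M \<and> y \<in> M}) d" and d: "d > 0"
    and a: "a \<in> A"
  shows "\<exists>c. a - smul c 1 \<in> M"
proof -
  interpret k_algebra smul by fact
  note cl = subalgebra_closed[OF A]
  have MI: "is_ideal_of A M" using M by (simp add: maximal_ideal_of_def)
  note m = is_ideal_ofD[OF MI]
  define U where "U = span {x * y |x y. x \<in> M \<and> y \<in> M}"
  have UI: "u * z \<in> U" if "u \<in> A" "z \<in> U" for u z
    using that(2) unfolding U_def
  proof (induction rule: span_induct_alt)
    case base
    show ?case by (simp add: span_zero)
  next
    case (step c y z)
    then obtain y1 y2 where y: "y = y1 * y2" "y1 \<in> M" "y2 \<in> M" by blast
    have "u * y \<in> span {x * y |x y. x \<in> M \<and> y \<in> M}"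
      using m(4)[OF that(1) y(2)] y(3) by (intro span_base) (auto simp: y(1) mult.assoc[symmetric])
    then show ?case using step.IH by (simp add: distrib_left mult_smul span_add span_scale)
  qed
  have MM: "y * z \<in> U" if "y \<in> M" "z \<in> M" for y z
    unfolding U_def using that by (intro span_base) blast
  obtain b where b0: "\<forall>i\<in>{1..d}. b i \<in> M"
    "\<forall>c. (\<Sum>i=1..d. smul (c i) (b i)) \<in> U \<longrightarrow> (\<forall>i\<in>{1..d}. c i = 0)"
    "\<forall>v\<in>M. \<exists>c. v - (\<Sum>i=1..d. smul (c i) (b i)) \<in> U"
    using dim unfolding has_quot_dim_def U_def[symmetric] by (elim exE conjE) (rule that)
  note b = b0[rule_format]
  have b1: "b 1 \<in> M" using b(1) d by simp
  have b1U: "b 1 \<notin> U"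
  proof
    assume "b 1 \<in> U"
    moreover have "(\<Sum>i=1..d. smul (if i = 1 then 1 else 0) (b i)) = (\<Sum>i=1..d. if i = 1 then b i else 0)"
      by (intro sum.cong) auto
    ultimately have "(\<Sum>i=1..d. smul (if i = 1 then 1 else 0) (b i)) \<in> U" using d by simp
    from b(2)[OF this, of 1] d show False by simp
  qed
  have aM: "a ^ j * b 1 \<in> M" for j using m(4)[OF cl(9)[OF a] b1] .
  obtain C where C: "\<And>j. a ^ j * b 1 - (\<Sum>i=1..d. smul (C j i) (b i)) \<in> U"
    using b(3)[OF aM] by metis
  \<comment> \<open>The \<open>d + 1\<close> vectors \<open>a ^ j * b 1\<close> are dependent modulo
    \<open>U\<close>; the \<open>t j\<close> are the coefficients of a polynomial in
    \<open>a\<close> that kills \<open>b 1\<close>.\<close>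
  have "\<exists>t. (\<exists>j\<in>{0..d}. t j \<noteq> 0) \<and> (\<forall>i\<in>{1..d}. (\<Sum>j=0..d. C j i * t j) = 0)"
    by (rule homogeneous_system_nontrivial_solution) auto
  then obtain t where t: "\<exists>j\<in>{0..d}. t j \<noteq> 0" "\<forall>i\<in>{1..d}. (\<Sum>j=0..d. C j i * t j) = 0"
    by blast
  let ?ev = "\<lambda>p. poly (map_poly (\<lambda>c. smul c 1) p) a"
  define p where "p = (\<Sum>j=0..d. monom (t j) j)"
  have cp: "coeff p j = (if j \<le> d then t j else 0)" for j
    unfolding p_def by (simp add: coeff_sum)
  have "degree p \<le> d" by (rule degree_le) (simp add: cp)
  have "?ev p = (\<Sum>j=0..d. smul (coeff p j) 1 * a ^ j)"
  proof -
    have "degree (map_poly (\<lambda>c. smul c 1) p) \<le> d" by (rule degree_le) (simp add: coeff_map_poly cp)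
    then have "map_poly (\<lambda>c. smul c 1) p = (\<Sum>j\<le>d. monom (coeff (map_poly (\<lambda>c. smul c 1) p) j) j)"
      by (rule poly_as_sum_of_monoms'[symmetric])
    then have "?ev p = (\<Sum>j\<le>d. coeff (map_poly (\<lambda>c. smul c 1) p) j * a ^ j)"
      by (metis (no_types, lifting) poly_monom poly_sum sum.cong)
    then show ?thesis by (simp add: coeff_map_poly atMost_atLeast0)
  qed
  also have "\<dots> = (\<Sum>j=0..d. smul (t j) (a ^ j))" by (intro sum.cong) (auto simp: cp smul_mult)
  finally have "?ev p * b 1 = (\<Sum>j=0..d. smul (t j) (a ^ j * b 1))"
    by (simp add: sum_distrib_right smul_mult)
  also have "\<dots> = (\<Sum>j=0..d. smul (t j) (a ^ j * b 1 - (\<Sum>i=1..d. smul (C j i) (b i))))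
      + (\<Sum>j=0..d. smul (t j) (\<Sum>i=1..d. smul (C j i) (b i)))"
    by (simp add: scale_right_diff_distrib sum_subtractf)
  also have "(\<Sum>j=0..d. smul (t j) (\<Sum>i=1..d. smul (C j i) (b i)))
    = (\<Sum>i=1..d. smul (\<Sum>j=0..d. C j i * t j) (b i))"
    unfolding scale_sum_right scale_sum_left by (subst sum.swap) (simp add: mult.commute)
  also have "\<dots> = 0" using t(2) by simp
  finally have evp: "?ev p * b 1 \<in> U"
    using C unfolding U_def by (auto intro!: span_sum span_scale)
  have pne: "p \<noteq> 0" using t(1) cp by (metis atLeastAtMost_iff coeff_0)
  show ?thesis
  proof (rule ccontr)
    assume no: "\<not> ?thesis"
    have "?ev p * b 1 \<in> U \<Longrightarrow> p \<noteq> 0 \<Longrightarrow> False" for p :: "'k poly"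
    proof (induction "degree p" arbitrary: p)
      case 0
      then obtain c where c: "p = [:c:]" by (metis degree_eq_zeroE)
      then have "smul c (b 1) \<in> U" using 0 by (simp add: map_poly_pCons smul_mult)
      then have "smul (inverse c) (smul c (b 1)) \<in> U" unfolding U_def by (rule span_scale)
      then show False using b1U c 0 by simp
    next
      case (Suc n)
      then obtain c where "poly p c = 0" using alg_closed_imp_poly_has_root[of p] by auto
      then obtain q where q: "p = [:-c, 1:] * q" by (auto simp: poly_eq_0_iff_dvd dvd_def)
      have qne: "q \<noteq> 0" using q Suc by auto
      have "degree q = n" using Suc(2) qne unfolding q by (subst (asm) degree_mult_eq) auto
      have evp: "?ev p = (a - smul c 1) * ?ev q"
        unfolding q map_poly_smul_one_mult poly_mult by (simp add: map_poly_pCons)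
      have acA: "a - smul c 1 \<in> A" by (intro cl(5) a cl(7) cl(2))
      obtain u where u: "u \<in> A" "u * (a - smul c 1) - 1 \<in> M"
        using maximal_ideal_inverse[OF A M acA] no by blast
      have "?ev q \<in> A"
        unfolding poly_altdef by (intro cl(8) cl(4) cl(9) a) (simp add: coeff_map_poly cl(2) cl(7))
      then have "(u * (a - smul c 1) - 1) * (?ev q * b 1) \<in> U"
        using MM[OF u(2) m(4)[OF _ b1]] by simp
      moreover have "u * (?ev p * b 1) \<in> U" by (rule UI[OF u(1) Suc.prems(1)])
      ultimately have "u * (?ev p * b 1) - (u * (a - smul c 1) - 1) * (?ev q * b 1) \<in> U"
        unfolding U_def by (rule span_diff[rotated])
      moreover have "u * (?ev p * b 1) - (u * (a - smul c 1) - 1) * (?ev q * b 1) = ?ev q * b 1"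
        unfolding evp by (simp add: algebra_simps)
      ultimately show False using Suc(1)[of q] \<open>degree q = n\<close> qne by simp
    qed
    then show False using evp pne by blast
  qed
qed

section \<open>Derivations of the local ring\<close>

text \<open>\<open>alg_grad smul S a \<alpha>\<close>: some polynomial expression of \<open>a\<close> in the elements of \<open>S\<close> has the
  partial derivatives \<open>\<alpha>\<close>.  The gradients of \<open>0\<close> are the Jacobian relations between the elements
  of \<open>S\<close>.\<close>

inductive alg_grad :: "('k::field \<Rightarrow> 'a::comm_ring_1 \<Rightarrow> 'a) \<Rightarrow> 'a set \<Rightarrow> 'a \<Rightarrow> ('a \<Rightarrow> 'a) \<Rightarrow> bool"
  for smul S where
  const: "alg_grad smul S (smul c 1) (\<lambda>_. 0)"
| gen: "s \<in> S \<Longrightarrow> alg_grad smul S s (\<lambda>t. if t = s then 1 else 0)"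
| add: "alg_grad smul S a \<alpha> \<Longrightarrow> alg_grad smul S b \<beta> \<Longrightarrow> alg_grad smul S (a + b) (\<lambda>t. \<alpha> t + \<beta> t)"
| mult: "alg_grad smul S a \<alpha> \<Longrightarrow> alg_grad smul S b \<beta> \<Longrightarrow>
    alg_grad smul S (a * b) (\<lambda>t. a * \<beta> t + b * \<alpha> t)"

text \<open>The twist \<open>\<psi>\<close> covers three cases: derivations of the ring (identity),
  derivations into its fraction field (\<open>to_fract\<close>), and tangent vectors at a closed
  point (a \<open>k\<close>-point).\<close>

definition deriv_on ::
  "('k::field \<Rightarrow> 'a::comm_ring_1 \<Rightarrow> 'a) \<Rightarrow> 'a set \<Rightarrow> ('a \<Rightarrow> 'b::comm_ring_1) \<Rightarrow> ('a \<Rightarrow> 'b) \<Rightarrow> bool" where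
  "deriv_on smul A \<psi> D \<longleftrightarrow>
     (\<forall>a\<in>A. \<forall>b\<in>A. D (a + b) = D a + D b \<and> D (a * b) = \<psi> a * D b + \<psi> b * D a) \<and> (\<forall>c. D (smul c 1) = 0)"

context k_algebra begin

lemma alg_grad_exists:
  assumes "a \<in> sub_alg smul S"
  shows "\<exists>\<alpha>. alg_grad smul S a \<alpha>"
proof -
  have "is_subalgebra smul {a. \<exists>\<alpha>. alg_grad smul S a \<alpha>}"
    unfolding is_subalgebra_def subspace_def mem_Collect_eq
  proof (intro conjI ballI allI; (elim CollectE exE)?)
    show "\<exists>\<alpha>. alg_grad smul S 0 \<alpha>" "\<exists>\<alpha>. alg_grad smul S 1 \<alpha>"
      using alg_grad.const[of smul S 0] alg_grad.const[of smul S 1] by auto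
    fix a b c \<alpha> \<beta>
    assume a: "alg_grad smul S a \<alpha>"
    show "\<exists>\<alpha>. alg_grad smul S (smul c a) \<alpha>"
      using alg_grad.mult[OF alg_grad.const[of smul S c] a] by (auto simp: smul_mult)
    assume b: "alg_grad smul S b \<beta>"
    show "\<exists>\<alpha>. alg_grad smul S (a + b) \<alpha>" "\<exists>\<alpha>. alg_grad smul S (a * b) \<alpha>"
      using alg_grad.add[OF a b] alg_grad.mult[OF a b] by auto
  qed
  moreover have "S \<subseteq> {a. \<exists>\<alpha>. alg_grad smul S a \<alpha>}" by (auto intro: alg_grad.gen)
  ultimately show ?thesis using sub_alg_minimal assms by blast
qed

lemma alg_grad_in:
  assumes "alg_grad smul S a \<alpha>"
  shows "a \<in> sub_alg smul S" "\<alpha> s \<in> sub_alg smul S" "s \<notin> S \<Longrightarrow> \<alpha> s = 0"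
proof -
  note cl = subalgebra_closed[OF is_subalgebra_sub_alg[of S]]
  from assms have "a \<in> sub_alg smul S \<and> \<alpha> s \<in> sub_alg smul S \<and> (s \<notin> S \<longrightarrow> \<alpha> s = 0)"
  proof induction
    case (gen s)
    then show ?case using sub_alg_superset[of S] cl(1,2) by auto
  qed (use cl(1-4,7) in auto)
  then show "a \<in> sub_alg smul S" "\<alpha> s \<in> sub_alg smul S" "s \<notin> S \<Longrightarrow> \<alpha> s = 0" by auto
qed

text \<open>Two polynomial expressions of the same element differ by a relation; this is what makes
  derivations defined through gradients well defined.\<close>

lemma alg_grad_diff:
  assumes "alg_grad smul S a \<alpha>" "alg_grad smul S a \<beta>"
  shows "alg_grad smul S 0 (\<lambda>t. \<alpha> t - \<beta> t)"
proof -
  have "smul (- 1) 1 = - 1" by simp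
  with alg_grad.add[OF assms(1) alg_grad.mult[OF alg_grad.const[of smul S "-1"] assms(2)]]
  show ?thesis by simp
qed

text \<open>The chain rule; in particular, every derivation satisfies all Jacobian
  relations.\<close>

lemma deriv_on_alg_grad:
  assumes D: "deriv_on smul (sub_alg smul S) \<psi> D" and S: "finite S"
    and \<psi>: "\<psi> 0 = 0" "\<psi> 1 = 1"
    "\<And>a b. a \<in> sub_alg smul S \<Longrightarrow> b \<in> sub_alg smul S \<Longrightarrow> \<psi> (a + b) = \<psi> a + \<psi> b \<and> \<psi> (a * b) = \<psi> a * \<psi> b"
    and "alg_grad smul S a \<alpha>"
  shows "D a = (\<Sum>s\<in>S. \<psi> (\<alpha> s) * D s)"
  using assms(6)
proof induction
  case (const c)
  then show ?case using D \<psi>(1) by (simp add: deriv_on_def)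
next
  case (gen s)
  have "(\<Sum>t\<in>S. \<psi> (if t = s then 1 else 0) * D t) = (\<Sum>t\<in>S. if t = s then D t else 0)"
    by (intro sum.cong) (auto simp: \<psi>)
  then show ?case using gen S by simp
next
  case (add a \<alpha> b \<beta>)
  have "D (a + b) = D a + D b" using D alg_grad_in(1)[OF add.hyps(1)] alg_grad_in(1)[OF add.hyps(2)]
    by (simp add: deriv_on_def)
  also have "\<dots> = (\<Sum>s\<in>S. \<psi> (\<alpha> s + \<beta> s) * D s)"
    unfolding add.IH sum.distrib[symmetric]
    by (intro sum.cong refl) (simp add: \<psi>(3) alg_grad_in(2)[OF add.hyps(1)] alg_grad_in(2)[OF add.hyps(2)] algebra_simps)
  finally show ?case .
next
  case (mult a \<alpha> b \<beta>)
  note cl = subalgebra_closed[OF is_subalgebra_sub_alg[of S]]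
  note g1 = alg_grad_in[OF mult.hyps(1)] and g2 = alg_grad_in[OF mult.hyps(2)]
  have "D (a * b) = \<psi> a * D b + \<psi> b * D a" using D g1(1) g2(1) by (simp add: deriv_on_def)
  also have "\<dots> = (\<Sum>s\<in>S. \<psi> (a * \<beta> s + b * \<alpha> s) * D s)"
    unfolding mult.IH sum.distrib[symmetric] sum_distrib_left
    by (intro sum.cong refl) (simp add: \<psi>(3) g1 g2 cl(4) algebra_simps)
  finally show ?case .
qed

end

section \<open>Derivations with values in the fraction field\<close>

definition to_fract :: "'a::idom \<Rightarrow> 'a fract" where
  "to_fract r = Fraction_Field.Fract r 1"

lemma to_fract_simps:
  fixes a b :: "'a::idom" and f :: "'i \<Rightarrow> 'a"
  shows "to_fract (0::'a) = 0" "to_fract (1::'a) = 1" "to_fract a = 0 \<longleftrightarrow> a = 0" "to_fract a = to_fract b \<longleftrightarrow> a = b"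
  "to_fract (a + b) = to_fract a + to_fract b" "to_fract (a - b) = to_fract a - to_fract b"
  "to_fract (a * b) = to_fract a * to_fract b" "to_fract (sum f I) = (\<Sum>i\<in>I. to_fract (f i))"
proof -
  have 0: "to_fract (0::'a) = 0" "to_fract (1::'a) = 1" by (simp_all add: to_fract_def Zero_fract_def One_fract_def)
  then show "to_fract (0::'a) = 0" "to_fract (1::'a) = 1" .
  show "to_fract a = to_fract b \<longleftrightarrow> a = b" by (simp add: to_fract_def eq_fract)
  show "to_fract a = 0 \<longleftrightarrow> a = 0" by (simp add: to_fract_def Zero_fract_def eq_fract)
  have add: "to_fract (a + b) = to_fract a + to_fract b" for a b :: 'a by (simp add: to_fract_def)
  then show "to_fract (a + b) = to_fract a + to_fract b" by simp
  show "to_fract (a - b) = to_fract a - to_fract b"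
    "to_fract (a * b) = to_fract a * to_fract b" by (simp_all add: to_fract_def)
  show "to_fract (sum f I) = (\<Sum>i\<in>I. to_fract (f i))"
    by (induction I rule: infinite_finite_induct) (simp_all add: 0 add)
qed

lemma module_fract: "module (\<lambda>r z. to_fract r * (z :: 'a::idom fract))"
  by unfold_locales (simp_all add: to_fract_simps algebra_simps)

text \<open>The quotient rule dictates the extension from \<open>A\<close> to its
  localization.\<close>

lemma deriv_over_fract_extend:
  fixes smul :: "'k::field \<Rightarrow> 'r::idom \<Rightarrow> 'r" and D :: "'r \<Rightarrow> 'r fract"
  assumes "k_algebra smul" and A: "is_subalgebra smul A" and T: "T \<subseteq> A" "1 \<in> T" "0 \<notin> T"
    "\<And>s t. s \<in> T \<Longrightarrow> t \<in> T \<Longrightarrow> s * t \<in> T"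
    and loc: "\<And>r. \<exists>a\<in>A. \<exists>s\<in>T. s * r = a"
    and D: "deriv_on smul A to_fract D"
  shows "\<exists>E. deriv_on smul UNIV to_fract E \<and> (\<forall>a\<in>A. E a = D a)"
proof -
  interpret k_algebra smul by fact
  note cl = subalgebra_closed[OF A]
  note ts = to_fract_simps
  have Dadd: "D (a + b) = D a + D b" and Dmult: "D (a * b) = to_fract a * D b + to_fract b * D a"
    if "a \<in> A" "b \<in> A" for a b using D that by (auto simp: deriv_on_def)
  obtain den where den: "\<And>r. den r \<in> T" "\<And>r. den r * r \<in> A"
    using loc by metis
  define E where "E r = (D (den r * r) - to_fract r * D (den r)) / to_fract (den r)" for r
  have nz: "to_fract s \<noteq> 0" if "s \<in> T" for s using that T(3) ts(3) by metis
  \<comment> \<open>The formula holds for every denominator and not only for the chosen one; this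
    allows sums and products to be computed with a common denominator.\<close>
  have E: "to_fract s * E r = D (s * r) - to_fract r * D s" if s: "s \<in> T" "s * r \<in> A" for s r
  proof -
    let ?t = "den r"
    have tA: "?t \<in> A" "s \<in> A" using den(1) s(1) T(1) by auto
    have "D (?t * (s * r)) = D (s * (?t * r))" by (simp add: ac_simps)
    then have *: "to_fract ?t * D (s * r) + to_fract s * to_fract r * D ?t = to_fract s * D (?t * r) + to_fract ?t * to_fract r * D s"
      using Dmult[OF tA(1) s(2)] Dmult[OF tA(2) den(2)[of r]] ts(7) by metis
    have "to_fract ?t * (to_fract s * E r) = to_fract s * (to_fract ?t * E r)" by (simp only: ac_simps)
    also have "to_fract ?t * E r = D (?t * r) - to_fract r * D ?t"
      unfolding E_def using nz[OF den(1)] by simp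
    also have "to_fract s * (D (?t * r) - to_fract r * D ?t) = to_fract ?t * (D (s * r) - to_fract r * D s)"
      using * by (simp only: right_diff_distrib) (simp only: algebra_simps)
    finally show ?thesis using nz[OF den(1), of r] by simp
  qed
  have EA: "E a = D a" if "a \<in> A" for a
  proof -
    have "D 1 = 0" using D by (metis deriv_on_def scale_one)
    with E[of 1 a] T that show ?thesis by (simp add: ts)
  qed
  have "E (r + r') = E r + E r' \<and> E (r * r') = to_fract r * E r' + to_fract r' * E r" for r r'
  proof -
    let ?s = "den r" and ?t = "den r'"
    have s: "?s \<in> A" "?t \<in> A" "?s * ?t \<in> T" using den(1) T(1,4) by auto
    have eq1: "?s * ?t * (r + r') = ?t * (?s * r) + ?s * (?t * r')" by (simp add: algebra_simps)
    have eq2: "?s * ?t * (r * r') = (?s * r) * (?t * r')" by (simp add: algebra_simps)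
    have inA: "?s * ?t * (r + r') \<in> A" "?s * ?t * (r * r') \<in> A"
      unfolding eq1 eq2 by (intro cl(3) cl(4) s den(2))+
    have Er: "D (?s * r) = to_fract ?s * E r + to_fract r * D ?s"
      and Er': "D (?t * r') = to_fract ?t * E r' + to_fract r' * D ?t"
      using E[OF den(1) den(2), of r] E[OF den(1) den(2), of r'] by simp_all
    have "D (?s * ?t) = to_fract ?s * D ?t + to_fract ?t * D ?s" by (rule Dmult[OF s(1,2)])
    note st = this
    have "to_fract (?s * ?t) * E (r + r') = D (?t * (?s * r) + ?s * (?t * r')) - to_fract (r + r') * D (?s * ?t)"
      using E[OF s(3) inA(1)] unfolding eq1 .
    also have "D (?t * (?s * r) + ?s * (?t * r')) = D (?t * (?s * r)) + D (?s * (?t * r'))"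
      by (intro Dadd cl(4) s den(2))
    also have "D (?t * (?s * r)) = to_fract ?t * D (?s * r) + to_fract (?s * r) * D ?t" by (intro Dmult s den(2))
    also have "D (?s * (?t * r')) = to_fract ?s * D (?t * r') + to_fract (?t * r') * D ?s" by (intro Dmult s den(2))
    finally have "to_fract (?s * ?t) * E (r + r') =
      to_fract ?t * D (?s * r) + to_fract (?s * r) * D ?t + (to_fract ?s * D (?t * r') + to_fract (?t * r') * D ?s)
       - to_fract (r + r') * D (?s * ?t)" .
    also have "\<dots> = to_fract (?s * ?t) * (E r + E r')"
      unfolding st Er Er' ts(5,7) by (simp add: algebra_simps)
    finally have "to_fract (?s * ?t) * E (r + r') = to_fract (?s * ?t) * (E r + E r')" .
    then have 1: "E (r + r') = E r + E r'" using nz[OF s(3)] by simp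
    have "to_fract (?s * ?t) * E (r * r') = D ((?s * r) * (?t * r')) - to_fract (r * r') * D (?s * ?t)"
      using E[OF s(3) inA(2)] unfolding eq2 .
    also have "D ((?s * r) * (?t * r')) = to_fract (?s * r) * D (?t * r') + to_fract (?t * r') * D (?s * r)"
      by (intro Dmult den(2))
    finally have "to_fract (?s * ?t) * E (r * r') =
      to_fract (?s * r) * D (?t * r') + to_fract (?t * r') * D (?s * r) - to_fract (r * r') * D (?s * ?t)" .
    also have "\<dots> = to_fract (?s * ?t) * (to_fract r * E r' + to_fract r' * E r)"
      unfolding st Er Er' ts(5,7) by (simp add: algebra_simps)
    finally have "to_fract (?s * ?t) * E (r * r') = to_fract (?s * ?t) * (to_fract r * E r' + to_fract r' * E r)" .
    then have "E (r * r') = to_fract r * E r' + to_fract r' * E r" using nz[OF s(3)] by simp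
    with 1 show ?thesis by simp
  qed
  moreover have "E (smul c 1) = 0" for c
    using EA[OF cl(7)[OF cl(2)]] D by (simp add: deriv_on_def)
  ultimately have "deriv_on smul UNIV to_fract E" by (simp add: deriv_on_def)
  with EA show ?thesis by blast
qed

text \<open>
  The data of the theorem: \<open>A\<close> is the coordinate ring of an affine neighbourhood of \<open>P\<close>, with
  generators \<open>S\<close>, and \<open>M\<close> is the ideal of \<open>P\<close> in \<open>A\<close>.
\<close>

locale nonsingular_point = k_algebra smul
  for smul :: "'k::alg_closed_field \<Rightarrow> 'r::{idom, local_ring} \<Rightarrow> 'r" +
  fixes d :: nat and x :: "nat \<Rightarrow> 'r" and S A M :: "'r set"
  assumes finite_S: "finite S" and A_def: "A = sub_alg smul S" and d: "d > 0"
    and M: "maximal_ideal_of A M" and loc: "is_localization_at A M"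
    and dim: "\<And>M. maximal_ideal_of A M \<Longrightarrow>
      has_quot_dim smul M (module.span smul {x * y |x y. x \<in> M \<and> y \<in> M}) d"
    and rsp: "regular_system_of_parameters d x"
begin

lemma A: "is_subalgebra smul A"
  unfolding A_def by (rule is_subalgebra_sub_alg)

lemmas A_closed = subalgebra_closed[OF A]

lemma M_ideal: "is_ideal_of A M"
  using M by (simp add: maximal_ideal_of_def)

lemmas M_closed = is_ideal_ofD[OF M_ideal]

lemma denominator: "\<exists>a\<in>A. \<exists>s\<in>A - M. s * r = a"
  using loc unfolding is_localization_at_def by blast

lemma denominator_unit: "s \<in> A - M \<Longrightarrow> s dvd 1"
  using loc unfolding is_localization_at_def by blast

lemma one_notin_M: "1 \<notin> M"
proof
  assume "1 \<in> M"
  then have "A \<subseteq> M" using M_closed(4)[of _ 1] by auto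
  then show False using M M_closed(1) by (auto simp: maximal_ideal_of_def)
qed

lemma denominator_mult: "s \<in> A - M \<Longrightarrow> t \<in> A - M \<Longrightarrow> s * t \<in> A - M"
proof -
  assume s: "s \<in> A - M" and t: "t \<in> A - M"
  obtain u where u: "u \<in> A" "u * s - 1 \<in> M" using maximal_ideal_inverse[OF A M, of s] s by blast
  have "t \<in> M" if "s * t \<in> M"
  proof -
    have "u * (s * t) \<in> M" "(- t) * (u * s - 1) \<in> M"
      using M_closed(4)[OF u(1) that] M_closed(4)[OF A_closed(6) u(2), of t] t by auto
    from M_closed(3)[OF this] show ?thesis by (simp add: algebra_simps)
  qed
  then show ?thesis using s t A_closed(4) by auto
qed

lemma M_subset_max_ideal: "M \<subseteq> max_ideal"
proof
  fix m assume m: "m \<in> M"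
  show "m \<in> max_ideal"
    unfolding max_ideal_def
  proof safe
    assume "m dvd 1"
    then obtain r where r: "1 = m * r" by (elim dvdE)
    obtain a s where as: "a \<in> A" "s \<in> A - M" "s * r = a" using denominator by blast
    have "a * m = s * (m * r)" unfolding as(3)[symmetric] by (simp only: ac_simps)
    also have "\<dots> = s" unfolding r[symmetric] by simp
    finally show False using M_closed(4)[OF as(1) m] as(2) by simp
  qed
qed

text \<open>A fraction \<open>a / s\<close> has the quotient of the residues of \<open>a\<close> and
  \<open>s\<close> as its residue; these are constants by the eigenvalue argument, which needs
  \<open>d > 0\<close>.\<close>

lemma residue_field: "\<exists>c. r - smul c 1 \<in> max_ideal"
proof -
  obtain a s where as: "a \<in> A" "s \<in> A - M" "s * r = a" using denominator by blast
  note res = maximal_ideal_residue[OF k_algebra_axioms A M dim[OF M] d]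
  obtain ca where ca: "a - smul ca 1 \<in> M" using res as(1) by blast
  obtain cs where cs: "s - smul cs 1 \<in> M" using res as(2) by blast
  have "cs \<noteq> 0" using cs as(2) by auto
  define c where "c = ca / cs"
  have "(- smul c 1) * (s - smul cs 1) \<in> M" by (intro M_closed(4) cs A_closed(6,7,2))
  from M_closed(3)[OF ca this]
  have "s * (r - smul c 1) \<in> M"
    unfolding c_def using \<open>cs \<noteq> 0\<close> as(3) by (simp add: algebra_simps smul_mult)
  then have "s * (r - smul c 1) \<in> max_ideal" using M_subset_max_ideal by blast
  moreover obtain u where "1 = s * u" using denominator_unit[OF as(2)] by (elim dvdE)
  then have "u * (s * (r - smul c 1)) = r - smul c 1" by (metis mult.assoc mult.commute mult_1_right)
  ultimately show ?thesis using max_ideal_closed(3) by metis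
qed

lemma max_ideal_sum: "r \<in> max_ideal \<Longrightarrow> \<exists>c. r = (\<Sum>i\<in>{1..d}. c i * x i)"
  using rsp module.span_image_sum[OF self_module, of "{1..d}" r x] unfolding regular_system_of_parameters_def by auto

lemma x_in: "i \<in> {1..d} \<Longrightarrow> x i \<in> max_ideal"
  using rsp module.span_base[OF self_module, of "x i" "x ` {1..d}"]
  unfolding regular_system_of_parameters_def by auto

lemma deriv_alg_grad:
  assumes "deriv_on smul A to_fract D" "alg_grad smul S a \<alpha>"
  shows "D a = (\<Sum>s\<in>S. to_fract (\<alpha> s) * D s)"
  using assms(1) unfolding A_def
  by (rule deriv_on_alg_grad[OF _ finite_S _ _ _ assms(2)]) (simp_all add: to_fract_simps)

text \<open>Writing a generator as a constant plus a combination of the \<open>x i\<close> shows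
  that \<open>D\<close> maps it into \<open>W\<close> plus the maximal ideal times the module
  generated by the values of \<open>D\<close> on \<open>S\<close>; Nakayama's lemma removes the
  second part. With \<open>W = {0}\<close> this gives uniqueness of derivations, with the ring as
  \<open>W\<close> their integrality.\<close>

lemma deriv_in_submodule:
  assumes D: "deriv_on smul UNIV to_fract D"
    and W: "module.subspace (\<lambda>r z. to_fract r * z) W" and xW: "\<And>i. i \<in> {1..d} \<Longrightarrow> D (x i) \<in> W"
  shows "D r \<in> W"
proof -
  interpret F: module "\<lambda>r z. to_fract r * (z :: 'r fract)" by (rule module_fract)
  note ts = to_fract_simps
  have Dadd: "D (a + b) = D a + D b" and Dmult: "D (a * b) = to_fract a * D b + to_fract b * D a"
    and Dc: "D (smul c 1) = 0" for a b c using D by (auto simp: deriv_on_def)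
  have D0: "D 0 = 0" using Dc[of 0] by simp
  have Dsum: "D (sum f I) = (\<Sum>i\<in>I. D (f i))" for f :: "nat \<Rightarrow> 'r" and I
    by (induction I rule: infinite_finite_induct) (simp_all add: D0 Dadd)
  have DA: "deriv_on smul A to_fract D" using D by (simp add: deriv_on_def)
  have span_A: "D a \<in> F.span (D ` S)" if aA: "a \<in> A" for a
  proof -
    obtain \<alpha> where "alg_grad smul S a \<alpha>"
      using alg_grad_exists[of a S] aA unfolding A_def by blast
    from deriv_alg_grad[OF DA this] have eq: "D a = (\<Sum>s\<in>S. to_fract (\<alpha> s) * D s)" .
    show ?thesis by (subst eq) (intro F.span_sum F.span_scale F.span_base imageI)
  qed
  have span: "D r \<in> F.span (D ` S)" for r
  proof -
    obtain a s where as: "a \<in> A" "s \<in> A - M" "s * r = a" using denominator by blast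
    obtain u where u: "1 = s * u" using denominator_unit[OF as(2)] by (elim dvdE)
    have "D a = to_fract s * D r + to_fract r * D s" using Dmult as(3) by metis
    then have "to_fract u * (D a - to_fract r * D s) = (to_fract u * to_fract s) * D r"
      by (simp add: algebra_simps)
    also have "to_fract u * to_fract s = 1" using u ts(2,7) by (metis mult.commute)
    finally have "D r = to_fract u * (D a - to_fract r * D s)" by simp
    moreover have "\<dots> \<in> F.span (D ` S)" using as by (intro F.span_scale F.span_diff span_A) auto
    ultimately show ?thesis by simp
  qed
  have fin: "finite (D ` S)" using finite_S by simp
  have "D ` S \<subseteq> W"
  proof (rule F.nakayama[OF fin W, of max_ideal])
    fix y z r :: 'r
    show "y \<in> max_ideal \<Longrightarrow> z \<in> max_ideal \<Longrightarrow> y + z \<in> max_ideal" "z \<in> max_ideal \<Longrightarrow> r * z \<in> max_ideal"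
      "z \<in> max_ideal \<Longrightarrow> \<exists>u. u * (1 - z) = 1"
      by (fact max_ideal_closed one_minus_max_ideal)+
  next
    fix g assume "g \<in> D ` S"
    then obtain s where s: "g = D s" by blast
    obtain c where "s - smul c 1 \<in> max_ideal" using residue_field by blast
    then obtain r where "s - smul c 1 = (\<Sum>i\<in>{1..d}. r i * x i)" using max_ideal_sum by blast
    then have "s = smul c 1 + (\<Sum>i\<in>{1..d}. r i * x i)" by (simp add: algebra_simps)
    then have "D s = (\<Sum>i\<in>{1..d}. to_fract (r i) * D (x i) + to_fract (x i) * D (r i))"
      by (simp add: Dadd Dc Dsum Dmult)
    also have "\<dots> = (\<Sum>i\<in>{1..d}. to_fract (r i) * D (x i)) + (\<Sum>i\<in>{1..d}. to_fract (x i) * D (r i))"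
      by (rule sum.distrib)
    finally have *: "D s = (\<Sum>i\<in>{1..d}. to_fract (r i) * D (x i)) + (\<Sum>i\<in>{1..d}. to_fract (x i) * D (r i))" .
    have "\<exists>c. D (r i) = (\<Sum>g\<in>D ` S. to_fract (c g) * g)" for i
      using span[of "r i"] unfolding F.span_finite[OF fin] by auto
    then obtain C where C: "\<And>i. D (r i) = (\<Sum>g\<in>D ` S. to_fract (C i g) * g)" by metis
    have "(\<Sum>i\<in>{1..d}. to_fract (x i) * D (r i)) = (\<Sum>g\<in>D ` S. to_fract (\<Sum>i\<in>{1..d}. x i * C i g) * g)"
      unfolding C ts(7,8) sum_distrib_left sum_distrib_right by (subst sum.swap) (simp add: mult.assoc)
    moreover have "(\<Sum>i\<in>{1..d}. x i * C i g) \<in> max_ideal" for g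
      by (intro max_ideal_closed(6) max_ideal_closed(4) x_in)
    moreover have "(\<Sum>i\<in>{1..d}. to_fract (r i) * D (x i)) \<in> W"
      by (intro F.subspace_sum[OF W] F.subspace_scale[OF W] xW)
    ultimately show "\<exists>w\<in>W. \<exists>c. (\<forall>g'\<in>D ` S. c g' \<in> max_ideal) \<and> g = w + (\<Sum>g'\<in>D ` S. to_fract (c g') * g')"
      using * s by (intro bexI[of _ "\<Sum>i\<in>{1..d}. to_fract (r i) * D (x i)"]
        exI[of _ "\<lambda>g. \<Sum>i\<in>{1..d}. x i * C i g"]) auto
  qed
  then show ?thesis using span[of r] F.span_minimal[OF _ W] by blast
qed

lemma alg_grad_0_scale:
  assumes "alg_grad smul S 0 \<delta>" "a \<in> A"
  shows "alg_grad smul S 0 (\<lambda>t. a * \<delta> t)"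
proof -
  obtain \<alpha> where "alg_grad smul S a \<alpha>" using alg_grad_exists[of a S] assms(2) unfolding A_def by blast
  from alg_grad.mult[OF this assms(1)] show ?thesis by simp
qed

text \<open>Any gradient of \<open>a\<close> may be used to define the value at \<open>a\<close>,
  because \<open>v\<close> annihilates the difference of two gradients.\<close>

lemma deriv_from_jacobian_solution:
  assumes v: "\<And>\<delta>. alg_grad smul S 0 \<delta> \<Longrightarrow> (\<Sum>s\<in>S. to_fract (\<delta> s) * v s) = 0"
  shows "\<exists>D. deriv_on smul UNIV to_fract D \<and> (\<forall>s\<in>S. D s = v s)"
proof -
  note ts = to_fract_simps
  define D where "D a = (\<Sum>s\<in>S. to_fract ((SOME \<alpha>. alg_grad smul S a \<alpha>) s) * v s)" for a
  have D: "D a = (\<Sum>s\<in>S. to_fract (\<alpha> s) * v s)" if "alg_grad smul S a \<alpha>" for a \<alpha>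
  proof -
    let ?\<beta> = "SOME \<alpha>. alg_grad smul S a \<alpha>"
    have "alg_grad smul S a ?\<beta>" using that by (rule someI[of "alg_grad smul S a"])
    from v[OF alg_grad_diff[OF this that]]
    show ?thesis unfolding D_def by (simp add: ts left_diff_distrib sum_subtractf)
  qed
  have "deriv_on smul A to_fract D"
    unfolding deriv_on_def
  proof (intro conjI ballI allI)
    show "D (smul c 1) = 0" for c using D[OF alg_grad.const[of smul S c]] by (simp add: ts)
    fix a b assume "a \<in> A" "b \<in> A"
    then obtain \<alpha> \<beta> where ab: "alg_grad smul S a \<alpha>" "alg_grad smul S b \<beta>"
      using alg_grad_exists[of a S] alg_grad_exists[of b S] unfolding A_def by blast
    show "D (a + b) = D a + D b"
      unfolding D[OF ab(1)] D[OF ab(2)] D[OF alg_grad.add[OF ab]]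
      by (simp add: ts distrib_right sum.distrib)
    show "D (a * b) = to_fract a * D b + to_fract b * D a"
      unfolding D[OF ab(1)] D[OF ab(2)] D[OF alg_grad.mult[OF ab]]
      by (simp add: ts distrib_right sum.distrib sum_distrib_left mult.assoc)
  qed
  from deriv_over_fract_extend[OF k_algebra_axioms A _ _ _ denominator_mult denominator this]
  obtain E where E: "deriv_on smul UNIV to_fract E" "\<forall>a\<in>A. E a = D a"
    using A_closed(2) one_notin_M M_closed(2) by blast
  have "E s = v s" if "s \<in> S" for s
  proof -
    have "s \<in> A" using that sub_alg_superset[of S] unfolding A_def by blast
    then have "E s = (\<Sum>t\<in>S. to_fract (if t = s then 1 else 0) * v t)"
      using E(2) D[OF alg_grad.gen[OF that]] by simp
    also have "\<dots> = (\<Sum>t\<in>S. if t = s then v t else 0)" by (intro sum.cong) (auto simp: ts)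
    finally show ?thesis using that finite_S by simp
  qed
  with E(1) show ?thesis by blast
qed

text \<open>In general \<open>x j\<close> is only a fraction \<open>a / s\<close>. The row is the
  numerator of the quotient rule, \<open>s\<close> times the gradient of \<open>a\<close> minus
  \<open>a\<close> times the gradient of \<open>s\<close>; hence the factor
  \<open>s j * s j\<close>.\<close>

lemma x_gradient:
  "\<exists>s row. \<forall>j. s j \<in> A - M \<and> (\<forall>t. row j t \<in> A) \<and> (\<forall>t. t \<notin> S \<longrightarrow> row j t = 0) \<and>
     (\<forall>D. deriv_on smul UNIV to_fract D \<longrightarrow> (\<Sum>t\<in>S. to_fract (row j t) * D t) = to_fract (s j * s j) * D (x j))"
proof -
  note ts = to_fract_simps
  have "\<exists>s row. s \<in> A - M \<and> (\<forall>t. row t \<in> A) \<and> (\<forall>t. t \<notin> S \<longrightarrow> row t = 0) \<and>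
     (\<forall>D. deriv_on smul UNIV to_fract D \<longrightarrow> (\<Sum>t\<in>S. to_fract (row t) * D t) = to_fract (s * s) * D (x j))" for j
  proof -
    obtain a s where as: "a \<in> A" "s \<in> A - M" "s * x j = a" using denominator by blast
    then obtain \<alpha> \<sigma> where g: "alg_grad smul S a \<alpha>" "alg_grad smul S s \<sigma>"
      using alg_grad_exists[of a S] alg_grad_exists[of s S] unfolding A_def by blast
    let ?row = "\<lambda>t. s * \<alpha> t - a * \<sigma> t"
    have "\<forall>t. ?row t \<in> A"
      using alg_grad_in(2)[OF g(1), folded A_def] alg_grad_in(2)[OF g(2), folded A_def] as A_closed(4,5) by auto
    moreover have "\<forall>t. t \<notin> S \<longrightarrow> ?row t = 0" using alg_grad_in(3)[OF g(1)] alg_grad_in(3)[OF g(2)] by auto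
    moreover have "(\<Sum>t\<in>S. to_fract (?row t) * D t) = to_fract (s * s) * D (x j)"
      if D: "deriv_on smul UNIV to_fract D" for D
    proof -
      have DA: "deriv_on smul A to_fract D" using D by (simp add: deriv_on_def)
      have "(\<Sum>t\<in>S. to_fract (?row t) * D t) = to_fract s * D a - to_fract a * D s"
        unfolding deriv_alg_grad[OF DA g(1)] deriv_alg_grad[OF DA g(2)]
        by (simp add: ts left_diff_distrib sum_subtractf sum_distrib_left mult.assoc)
      also have "D a = to_fract s * D (x j) + to_fract (x j) * D s"
        using D as(3) by (metis UNIV_I deriv_on_def)
      finally show ?thesis by (simp add: as(3)[symmetric] ts algebra_simps)
    qed
    ultimately show ?thesis using as(2) by (intro exI[of _ s] exI[of _ ?row]) simp
  qed
  then have "\<forall>j. \<exists>s row. s \<in> A - M \<and> (\<forall>t. row t \<in> A) \<and> (\<forall>t. t \<notin> S \<longrightarrow> row t = 0) \<and>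
     (\<forall>D. deriv_on smul UNIV to_fract D \<longrightarrow> (\<Sum>t\<in>S. to_fract (row t) * D t) = to_fract (s * s) * D (x j))" by blast
  then show ?thesis by (subst (asm) choice_iff) (elim exE, subst (asm) choice_iff, elim exE, blast)
qed

lemma fract_quotient_of_A:
  "\<exists>a\<in>A. \<exists>b\<in>A. b \<noteq> 0 \<and> to_fract b * c = to_fract a"
proof -
  obtain p q where pq: "c = Fraction_Field.Fract p q" "q \<noteq> 0" by (cases c) auto
  obtain a s where as: "a \<in> A" "s \<in> A - M" "s * p = a" using denominator by blast
  obtain b t where bt: "b \<in> A" "t \<in> A - M" "t * q = b" using denominator by blast
  have "s \<noteq> 0" "t \<noteq> 0" using as(2) bt(2) M_closed(2) by auto
  then have "s * b \<noteq> 0" using bt(3) pq(2) by auto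
  moreover have "to_fract (s * b) * c = to_fract (t * a)"
    using pq as(3) bt(3) by (auto simp: to_fract_def eq_fract)
  moreover have "s * b \<in> A" "t * a \<in> A" using A_closed(4) as bt by auto
  ultimately show ?thesis by blast
qed

text \<open>Multiplication by a single \<open>g\<close> turns a linear dependence over the fraction
  field into an identity in \<open>A\<close>, which can be evaluated at every closed point where
  \<open>g\<close> does not vanish.\<close>

lemma clear_denominators:
  fixes row :: "nat \<Rightarrow> 'r \<Rightarrow> 'r"
  assumes J: "finite J"
    and z: "z \<in> module.span (\<lambda>c f s. c * f s)
      ((\<lambda>\<delta> t. to_fract (\<delta> t)) ` {\<delta>. alg_grad smul S 0 \<delta>} \<union> (\<lambda>j t. to_fract (row j t)) ` J)"
  shows "\<exists>g w \<delta>. g \<in> A \<and> g \<noteq> 0 \<and> (\<forall>j. w j \<in> A) \<and> alg_grad smul S 0 \<delta> \<and>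
     (\<forall>s. to_fract g * z s = to_fract ((\<Sum>j\<in>J. w j * row j s) + \<delta> s))"
proof -
  note ts = to_fract_simps
  interpret V: vector_space "\<lambda>(c::'r fract) f (s::'r). c * f s" by (rule vector_space_fun)
  show ?thesis using z
  proof (induction rule: V.span_induct_alt)
    case base
    have "alg_grad smul S 0 (\<lambda>_. 0)" using alg_grad.const[of smul S 0] by simp
    then show ?case using A_closed(1,2)
      by (intro exI[of _ 1] exI[of _ "\<lambda>_. 0"]) (auto simp: ts zero_fun_def)
  next
    case (step c y z)
    obtain g w \<delta> where IH: "g \<in> A" "g \<noteq> 0" "\<forall>j. w j \<in> A" "alg_grad smul S 0 \<delta>"
      "\<forall>s. to_fract g * z s = to_fract ((\<Sum>j\<in>J. w j * row j s) + \<delta> s)" using step.IH by blast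
    obtain a b where ab: "a \<in> A" "b \<in> A" "b \<noteq> 0" "to_fract b * c = to_fract a"
      using fract_quotient_of_A by blast
    have gb: "g * b \<in> A" "g * b \<noteq> 0" "g * a \<in> A" using IH ab A_closed(4) by auto
    have eq: "to_fract (g * b) * ((\<lambda>s. c * y s) + z) s
      = to_fract (g * a) * y s + to_fract (b * ((\<Sum>j\<in>J. w j * row j s) + \<delta> s))" for s
    proof -
      have "to_fract (g * b) * ((\<lambda>s. c * y s) + z) s
        = to_fract g * (to_fract b * c) * y s + to_fract b * (to_fract g * z s)"
        by (simp add: ts plus_fun_def algebra_simps)
      then show ?thesis unfolding ab(4) IH(5)[rule_format] by (simp only: ts)
    qed
    from step.hyps(1) consider \<delta>' where "alg_grad smul S 0 \<delta>'" "y = (\<lambda>t. to_fract (\<delta>' t))"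
      | i where "i \<in> J" "y = (\<lambda>t. to_fract (row i t))" by blast
    then show ?case
    proof cases
      case 1
      have "alg_grad smul S 0 (\<lambda>t. b * \<delta> t + (g * a) * \<delta>' t)"
        using alg_grad.add[OF alg_grad_0_scale[OF IH(4) ab(2)] alg_grad_0_scale[OF 1(1) gb(3)]] by simp
      moreover have "to_fract (g * b) * ((\<lambda>s. c * y s) + z) s
        = to_fract ((\<Sum>j\<in>J. (b * w j) * row j s) + (b * \<delta> s + (g * a) * \<delta>' s))" for s
        by (subst eq) (simp add: 1(2) ts distrib_left sum_distrib_left mult.assoc)
      ultimately show ?thesis using gb IH(3) A_closed(4) ab(2)
        by (intro exI[of _ "g * b"] exI[of _ "\<lambda>j. b * w j"] exI[of _ "\<lambda>t. b * \<delta> t + (g * a) * \<delta>' t"]) simp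
    next
      case 2
      let ?w = "\<lambda>j. b * w j + (if j = i then g * a else 0)"
      have "(\<Sum>j\<in>J. ?w j * row j s) = (\<Sum>j\<in>J. b * (w j * row j s) + (if j = i then g * a * row j s else 0))" for s
        by (intro sum.cong) (auto simp: algebra_simps)
      then have "(\<Sum>j\<in>J. ?w j * row j s) = b * (\<Sum>j\<in>J. w j * row j s) + g * a * row i s" for s
        using 2(1) J by (simp add: sum.distrib sum_distrib_left)
      then have "to_fract (g * b) * ((\<lambda>s. c * y s) + z) s
        = to_fract ((\<Sum>j\<in>J. ?w j * row j s) + b * \<delta> s)" for s
        by (subst eq) (simp add: 2(2) ts algebra_simps)
      moreover have "\<forall>j. ?w j \<in> A" using IH(3) A_closed(1,3,4) ab(2) gb(3) by auto
      ultimately show ?thesis using gb alg_grad_0_scale[OF IH(4) ab(2)]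
        by (intro exI[of _ "g * b"] exI[of _ ?w] exI[of _ "\<lambda>t. b * \<delta> t"]) blast
    qed
  qed
qed

lemma kernel_maximal_ideal:
  assumes \<psi>: "hom_on smul A \<psi>"
  shows "maximal_ideal_of A {a \<in> A. \<psi> a = 0}" (is "maximal_ideal_of A ?M")
proof -
  note h = hom_on_simps[OF \<psi> A]
  have "is_ideal_of A ?M"
    unfolding is_ideal_of_def using A_closed(1,3,4) h(1,3,4) by auto
  moreover have "?M \<noteq> A" using A_closed(2) h(2) by (metis (mono_tags, lifting) mem_Collect_eq zero_neq_one)
  moreover have "I = ?M \<or> I = A" if I: "is_ideal_of A I" "?M \<subseteq> I" for I
  proof (cases "I \<subseteq> ?M")
    case False
    then obtain a where a: "a \<in> I" "a \<in> A" "\<psi> a \<noteq> 0" using is_ideal_ofD(1)[OF I(1)] by blast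
    let ?c = "inverse (\<psi> a)"
    have "smul ?c 1 * a \<in> I" by (intro is_ideal_ofD(4)[OF I(1)] a A_closed(7,2))
    moreover have "1 - smul ?c 1 * a \<in> ?M"
      using a A_closed(2,4,5,7) by (auto simp: h)
    then have "1 - smul ?c 1 * a \<in> I" using I(2) by blast
    ultimately have "1 \<in> I" using is_ideal_ofD(3)[OF I(1)] by fastforce
    then have "I = A" using is_ideal_ofD(1,4)[OF I(1)] by (metis mult.right_neutral subsetI subset_antisym)
    then show ?thesis ..
  qed (use I in auto)
  ultimately show ?thesis unfolding maximal_ideal_of_def by blast
qed

text \<open>Every point of the affine variety carries \<open>d\<close> independent tangent vectors, the coordinates with
  respect to a basis of the cotangent space.\<close>

lemma tangent_vectors:
  assumes \<psi>: "hom_on smul A \<psi>"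
  shows "\<exists>D b. \<forall>i\<in>{1..d}. deriv_on smul A \<psi> (D i) \<and> b i \<in> A \<and>
     (\<forall>j\<in>{1..d}. D i (b j) = (if i = j then 1 else 0))"
proof -
  note h = hom_on_simps[OF \<psi> A]
  let ?M = "{a \<in> A. \<psi> a = 0}"
  define U where "U = span {x * y |x y. x \<in> ?M \<and> y \<in> ?M}"
  obtain b where b0: "\<forall>i\<in>{1..d}. b i \<in> ?M"
    "\<forall>c. (\<Sum>i=1..d. smul (c i) (b i)) \<in> U \<longrightarrow> (\<forall>i\<in>{1..d}. c i = 0)"
    "\<forall>v\<in>?M. \<exists>c. v - (\<Sum>i=1..d. smul (c i) (b i)) \<in> U"
    using dim[OF kernel_maximal_ideal[OF \<psi>]] unfolding has_quot_dim_def U_def[symmetric]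
    by (elim exE conjE) (rule that)
  note b = b0[rule_format]
  have U_sum: "sum f I \<in> U" if "\<And>i. i \<in> I \<Longrightarrow> f i \<in> U" for f and I :: "nat set"
    using that unfolding U_def by (rule span_sum)
  have U_add: "y + z \<in> U" and U_diff: "y - z \<in> U" if "y \<in> U" "z \<in> U" for y z
    using that unfolding U_def by (simp_all add: span_add span_diff)
  have U_scale: "smul c y \<in> U" if "y \<in> U" for c y using that unfolding U_def by (rule span_scale)
  have centre: "a - smul (\<psi> a) 1 \<in> ?M" if "a \<in> A" for a
    using that A_closed(2,5,7) by (simp add: h)
  define c where "c v = (SOME c. v - (\<Sum>i=1..d. smul (c i) (b i)) \<in> U)" for v
  have c: "v - (\<Sum>i=1..d. smul (c v i) (b i)) \<in> U" if "v \<in> ?M" for v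
    unfolding c_def using b(3)[OF that] by (rule someI_ex)
  have c_eq: "c v i = e i" if "v \<in> ?M" "v - (\<Sum>i=1..d. smul (e i) (b i)) \<in> U" "i \<in> {1..d}" for v e i
  proof -
    have "(\<Sum>i=1..d. smul (c v i - e i) (b i)) =
      (v - (\<Sum>i=1..d. smul (e i) (b i))) - (v - (\<Sum>i=1..d. smul (c v i) (b i)))"
      by (simp add: scale_left_diff_distrib sum_subtractf)
    then have "(\<Sum>i=1..d. smul (c v i - e i) (b i)) \<in> U" using U_diff[OF that(2) c[OF that(1)]] by simp
    from b(2)[OF this that(3)] show ?thesis by simp
  qed
  \<comment> \<open>The \<open>i\<close>-th coordinate of the class of \<open>a\<close> in the
    cotangent space, after its value at the point has been subtracted.\<close>
  define D where "D i a = c (a - smul (\<psi> a) 1) i" for i a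
  have "deriv_on smul A \<psi> (D i)" if i: "i \<in> {1..d}" for i
    unfolding deriv_on_def
  proof (intro conjI ballI allI)
    fix k
    have "smul k 1 - smul (\<psi> (smul k 1)) 1 = 0" by (simp add: h(5))
    then show "D i (smul k 1) = 0" unfolding D_def
      using c_eq[of 0 "\<lambda>_. 0" i] i A_closed(1) by (simp add: h(1) U_def span_zero)
  next
    fix a a' assume a: "a \<in> A" "a' \<in> A"
    let ?v = "a - smul (\<psi> a) 1" and ?v' = "a' - smul (\<psi> a') 1"
    note v = centre[OF a(1)] centre[OF a(2)]
    let ?sum = "\<lambda>e. \<Sum>i=1..d. smul (e i) (b i)"
    have "(a + a') - smul (\<psi> (a + a')) 1 - ?sum (\<lambda>i. c ?v i + c ?v' i) = (?v - ?sum (c ?v)) + (?v' - ?sum (c ?v'))"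
      by (simp add: h(3) a scale_left_distrib sum.distrib)
    also have "\<dots> \<in> U" by (intro U_add c v)
    finally show "D i (a + a') = D i a + D i a'"
      unfolding D_def by (intro c_eq centre A_closed(3) a i)
    \<comment> \<open>For the centred elements \<open>?v\<close> and \<open>?v'\<close> the mixed
      term \<open>?v * ?v'\<close> lies in \<open>U\<close>; what remains is the product
      rule.\<close>
    have "(a * a') - smul (\<psi> (a * a')) 1 - ?sum (\<lambda>i. \<psi> a * c ?v' i + \<psi> a' * c ?v i)
      = ?v * ?v' + (smul (\<psi> a) (?v' - ?sum (c ?v')) + smul (\<psi> a') (?v - ?sum (c ?v)))"
      by (simp add: h(4) a scale_left_distrib scale_right_diff_distrib sum.distrib scale_sum_right
        algebra_simps smul_mult mult_smul)
    also have "\<dots> \<in> U"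
      by (intro U_add U_scale c v) (use v in \<open>auto simp: U_def intro!: span_base\<close>)
    finally show "D i (a * a') = \<psi> a * D i a' + \<psi> a' * D i a"
      unfolding D_def by (intro c_eq centre A_closed(4) a i)
  qed
  moreover have "D i (b j) = (if i = j then 1 else 0)" if ij: "i \<in> {1..d}" "j \<in> {1..d}" for i j
  proof -
    have "(\<Sum>i=1..d. smul (if i = j then 1 else 0) (b i)) = (\<Sum>i=1..d. if i = j then b i else 0)"
      by (intro sum.cong) auto
    then have "b j - (\<Sum>i=1..d. smul (if i = j then 1 else 0) (b i)) \<in> U"
      using ij by (simp add: U_def span_zero)
    from c_eq[OF b(1)[OF ij(2)] this ij(1)] b(1)[OF ij(2)] show ?thesis by (simp add: D_def)
  qed
  ultimately show ?thesis using b(1) by (intro exI[of _ D] exI[of _ b]) auto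
qed

text \<open>
  The generic rank of the Jacobian is its rank at a general closed point, and by nonsingularity
  the latter is known there.
\<close>
theorem partial_derivatives_exist:
  "\<exists>\<Delta>. \<forall>i\<in>{1..d}. deriv_on smul UNIV (\<lambda>r. r) (\<Delta> i) \<and> (\<forall>j\<in>{1..d}. \<Delta> i (x j) = (if i = j then 1 else 0))"
proof -
  note ts = to_fract_simps
  interpret V: vector_space "\<lambda>(c::'r fract) f (s::'r). c * f s" by (rule vector_space_fun)
  interpret F: module "\<lambda>r z. to_fract r * (z :: 'r fract)" by (rule module_fract)
  obtain den row where "\<forall>j. den j \<in> A - M \<and> (\<forall>t. row j t \<in> A) \<and> (\<forall>t. t \<notin> S \<longrightarrow> row j t = 0) \<and>
     (\<forall>D. deriv_on smul UNIV to_fract D \<longrightarrow> (\<Sum>t\<in>S. to_fract (row j t) * D t) = to_fract (den j * den j) * D (x j))"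
    using x_gradient by blast
  then have den: "\<And>j. den j \<in> A - M" and rowA: "\<And>j t. row j t \<in> A" and row0: "\<And>j t. t \<notin> S \<Longrightarrow> row j t = 0"
    and row: "\<And>j D. deriv_on smul UNIV to_fract D \<Longrightarrow>
      (\<Sum>t\<in>S. to_fract (row j t) * D t) = to_fract (den j * den j) * D (x j)" by blast+
  have den0: "to_fract (den j * den j) \<noteq> 0" for j using den[of j] M_closed(2) ts(3)[of "den j * den j"] by auto
  let ?R = "(\<lambda>\<delta> t. to_fract (\<delta> t)) ` {\<delta>. alg_grad smul S 0 \<delta>}"
  let ?X = "\<lambda>J. ?R \<union> (\<lambda>j t. to_fract (row j t)) ` J"
  have X0: "r s = 0" if "r \<in> ?X J" "s \<notin> S" for r s J
    using that row0 alg_grad_in(3)[where S = S] by (auto simp: ts)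
  \<comment> \<open>Relations and rows together span all unit vectors: otherwise some derivation
    kills every \<open>x j\<close> but not \<open>s\<close>, against
    \<open>deriv_in_submodule\<close> for the zero submodule.\<close>
  have span_unit: "(\<lambda>t. if t = s then 1 else 0) \<in> V.span (?X {1..d})" if s: "s \<in> S" for s
  proof (rule ccontr)
    assume not: "\<not> ?thesis"
    have "(\<lambda>t. if t = s then 1 else 0) \<in> V.span (?X {1..d}) \<or>
      (\<exists>v. (\<forall>r\<in>?X {1..d}. (\<Sum>t\<in>S. r t * v t) = 0) \<and> (\<Sum>t\<in>S. (if t = s then 1 else 0) * v t) = 1)"
      by (rule fredholm_alternative[OF finite_S]) (use s X0 row0 in \<open>auto simp: ts\<close>)
    then obtain v where v: "\<forall>r\<in>?X {1..d}. (\<Sum>t\<in>S. r t * v t) = 0" "(\<Sum>t\<in>S. (if t = s then 1 else 0) * v t) = 1"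
      using not by blast
    have "\<exists>D. deriv_on smul UNIV to_fract D \<and> (\<forall>s\<in>S. D s = v s)"
    proof (rule deriv_from_jacobian_solution)
      show "(\<Sum>s\<in>S. to_fract (\<delta> s) * v s) = 0" if "alg_grad smul S 0 \<delta>" for \<delta>
        using v(1)[rule_format, of "\<lambda>t. to_fract (\<delta> t)"] that by auto
    qed
    then obtain D where D: "deriv_on smul UNIV to_fract D" "\<forall>s\<in>S. D s = v s" by blast
    have Dx: "D (x i) = 0" if "i \<in> {1..d}" for i
    proof -
      have "(\<Sum>t\<in>S. to_fract (row i t) * v t) = 0"
        using v(1)[rule_format, of "\<lambda>t. to_fract (row i t)"] that by auto
      then show ?thesis using row[OF D(1), of i] D(2) den0[of i] by simp
    qed
    have "D s \<in> {0}" by (rule deriv_in_submodule[OF D(1) F.subspace_single_0]) (simp add: Dx)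
    moreover have "(\<Sum>t\<in>S. (if t = s then 1 else 0) * v t) = (\<Sum>t\<in>S. if t = s then v t else 0)"
      by (intro sum.cong) auto
    then have "(\<Sum>t\<in>S. (if t = s then 1 else 0) * v t) = v s" using s finite_S by simp
    then have "v s = 1" using v(2) by metis
    moreover have "D s = v s" using D(2) s by blast
    ultimately show False by simp
  qed
  \<comment> \<open>Conversely no row is redundant: otherwise, at a point where no denominator
    vanishes, \<open>d - 1\<close> linear conditions would force a tangent vector to be zero,
    although there are \<open>d\<close> independent ones.\<close>
  have not_span: "(\<lambda>t. to_fract (row i t)) \<notin> V.span (?X ({1..d} - {i}))" if i: "i \<in> {1..d}" for i
  proof
    assume in_span: "(\<lambda>t. to_fract (row i t)) \<in> V.span (?X ({1..d} - {i}))"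
    obtain g0 w0 \<delta>0 where 0: "g0 \<in> A" "g0 \<noteq> 0" "\<forall>j. w0 j \<in> A" "alg_grad smul S 0 \<delta>0"
      "\<forall>s. to_fract g0 * to_fract (row i s) = to_fract ((\<Sum>j\<in>{1..d} - {i}. w0 j * row j s) + \<delta>0 s)"
      using clear_denominators[OF _ in_span] by blast
    have "\<forall>s. \<exists>g w \<delta>. s \<in> S \<longrightarrow> g \<in> A \<and> g \<noteq> 0 \<and> (\<forall>j. w j \<in> A) \<and> alg_grad smul S 0 \<delta> \<and>
       (\<forall>t. to_fract g * (if t = s then 1 else 0) = to_fract ((\<Sum>j\<in>{1..d}. w j * row j t) + \<delta> t))"
      using clear_denominators[OF finite_atLeastAtMost span_unit] by blast
    then obtain g where "\<forall>s. \<exists>w \<delta>. s \<in> S \<longrightarrow> g s \<in> A \<and> g s \<noteq> 0 \<and> (\<forall>j. w j \<in> A) \<and> alg_grad smul S 0 \<delta> \<and>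
       (\<forall>t. to_fract (g s) * (if t = s then 1 else 0) = to_fract ((\<Sum>j\<in>{1..d}. w j * row j t) + \<delta> t))"
      by (rule choice[THEN exE]) 
    then have g: "\<exists>w \<delta>. g s \<in> A \<and> g s \<noteq> 0 \<and> (\<forall>j. w j \<in> A) \<and> alg_grad smul S 0 \<delta> \<and>
       (\<forall>t. to_fract (g s) * (if t = s then 1 else 0) = to_fract ((\<Sum>j\<in>{1..d}. w j * row j t) + \<delta> t))"
      if "s \<in> S" for s using that by blast
    have prodA: "prod g T \<in> A" if "T \<subseteq> S" for T
      using that by (induction T rule: infinite_finite_induct) (use g A_closed(2,4) in auto)
    \<comment> \<open>The product of all denominators, so that one point \<open>\<psi>\<close> can
      evaluate the supposed dependence of row \<open>i\<close> and all expressions of unit vectors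
      simultaneously.\<close>
    have gA: "g0 * prod g S \<in> A" using 0(1) prodA A_closed(4) by blast
    moreover have "g0 * prod g S \<noteq> 0" using 0(2) g finite_S by auto
    ultimately obtain \<psi> where \<psi>: "hom_on smul A \<psi>" "\<psi> (g0 * prod g S) \<noteq> 0"
      using nullstellensatz_point[OF k_algebra_axioms finite_S] unfolding A_def by blast
    note h = hom_on_simps[OF \<psi>(1) A]
    have \<psi>g0: "\<psi> g0 \<noteq> 0" using \<psi>(2) h(4)[OF 0(1) prodA] by auto
    have \<psi>g: "\<psi> (g s) \<noteq> 0" if "s \<in> S" for s
    proof
      assume *: "\<psi> (g s) = 0"
      have "g0 * prod g S = g s * (g0 * prod g (S - {s}))"
        using that finite_S by (simp add: prod.remove ac_simps)
      moreover have "g s \<in> A" "g0 * prod g (S - {s}) \<in> A" using g[OF that] 0(1) prodA A_closed(4) by auto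
      ultimately show False using \<psi>(2) h(4)[of "g s" "g0 * prod g (S - {s})"] * by (metis mult_zero_left)
    qed
    obtain D b where Db: "\<forall>i\<in>{1..d}. deriv_on smul A \<psi> (D i) \<and> b i \<in> A \<and>
     (\<forall>j\<in>{1..d}. D i (b j) = (if i = j then 1 else 0))" using tangent_vectors[OF \<psi>(1)] by blast
    define \<xi> where "\<xi> E j = (\<Sum>t\<in>S. \<psi> (row j t) * E t)" for E :: "'r \<Rightarrow> 'k" and j
    \<comment> \<open>Dimension count: a nontrivial combination of the \<open>d\<close> tangent
      vectors is annihilated by the other \<open>d - 1\<close> rows.\<close>
    have "\<exists>t. (\<exists>l\<in>{1..d}. t l \<noteq> 0) \<and> (\<forall>j\<in>{1..d} - {i}. (\<Sum>l\<in>{1..d}. \<xi> (D l) j * t l) = 0)"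
      by (rule homogeneous_system_nontrivial_solution) (use i d in auto)
    then obtain t l0 where t: "l0 \<in> {1..d}" "t l0 \<noteq> 0" "\<forall>j\<in>{1..d} - {i}. (\<Sum>l\<in>{1..d}. \<xi> (D l) j * t l) = 0" by blast
    define E where "E a = (\<Sum>l\<in>{1..d}. t l * D l a)" for a
    have E: "deriv_on smul A \<psi> E"
      unfolding deriv_on_def
    proof (intro conjI ballI allI)
      fix a b assume ab: "a \<in> A" "b \<in> A"
      have "D l (a + b) = D l a + D l b" "D l (a * b) = \<psi> a * D l b + \<psi> b * D l a" if "l \<in> {1..d}" for l
        using Db that ab unfolding deriv_on_def by blast+
      then show "E (a + b) = E a + E b" "E (a * b) = \<psi> a * E b + \<psi> b * E a"
        unfolding E_def by (simp_all add: sum.distrib[symmetric] sum_distrib_left algebra_simps)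
    next
      show "E (smul c 1) = 0" for c unfolding E_def using Db by (auto simp: deriv_on_def intro!: sum.neutral)
    qed
    have Egrad: "E a = (\<Sum>s\<in>S. \<psi> (\<alpha> s) * E s)" if "alg_grad smul S a \<alpha>" for a \<alpha>
      by (rule deriv_on_alg_grad[OF E[unfolded A_def] finite_S _ _ _ that]) (use h(1-4) in \<open>simp_all add: A_def\<close>)
    have E0: "(\<Sum>s\<in>S. \<psi> (\<delta> s) * E s) = 0" if "alg_grad smul S 0 \<delta>" for \<delta>
      using Egrad[OF that] E unfolding deriv_on_def by (metis scale_zero_left)
    have comb: "(\<Sum>s\<in>S. \<psi> ((\<Sum>j\<in>J. w j * row j s) + \<delta> s) * E s) = (\<Sum>j\<in>J. \<psi> (w j) * \<xi> E j)"
      if "\<forall>j. w j \<in> A" "alg_grad smul S 0 \<delta>" for J :: "nat set" and w \<delta>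
    proof -
      have \<delta>A: "\<delta> s \<in> A" for s using alg_grad_in(2)[OF that(2)] unfolding A_def .
      have wA: "w j * row j s \<in> A" for j s using that(1) rowA A_closed(4) by blast
      have "\<psi> ((\<Sum>j\<in>J. w j * row j s) + \<delta> s) * E s = (\<Sum>j\<in>J. \<psi> (w j) * (\<psi> (row j s) * E s)) + \<psi> (\<delta> s) * E s" for s
      proof -
        have "\<psi> ((\<Sum>j\<in>J. w j * row j s) + \<delta> s) = \<psi> (\<Sum>j\<in>J. w j * row j s) + \<psi> (\<delta> s)"
          by (intro h(3) A_closed(8) \<delta>A wA)
        also have "\<psi> (\<Sum>j\<in>J. w j * row j s) = (\<Sum>j\<in>J. \<psi> (w j * row j s))" by (intro h(7) wA)
        also have "\<dots> = (\<Sum>j\<in>J. \<psi> (w j) * \<psi> (row j s))" by (intro sum.cong refl h(4) that(1)[rule_format] rowA)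
        finally have "\<psi> ((\<Sum>j\<in>J. w j * row j s) + \<delta> s) = (\<Sum>j\<in>J. \<psi> (w j) * \<psi> (row j s)) + \<psi> (\<delta> s)" .
        then show ?thesis by (simp add: distrib_right sum_distrib_right mult.assoc)
      qed
      then show ?thesis
        unfolding \<xi>_def using E0[OF that(2)]
        by (simp add: sum.distrib sum_distrib_left) (rule sum.swap)
    qed
    have \<xi>j: "\<xi> E j = 0" if j: "j \<in> {1..d} - {i}" for j
    proof -
      have "\<xi> E j = (\<Sum>l\<in>{1..d}. \<xi> (D l) j * t l)"
        unfolding \<xi>_def E_def sum_distrib_left sum_distrib_right by (subst sum.swap) (simp add: ac_simps)
      then show ?thesis using t(3) j by simp
    qed
    have "\<psi> g0 * \<xi> E i = (\<Sum>s\<in>S. \<psi> (g0 * row i s) * E s)"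
      unfolding \<xi>_def sum_distrib_left by (simp add: h(4) 0(1) rowA mult.assoc)
    also have "\<dots> = (\<Sum>s\<in>S. \<psi> ((\<Sum>j\<in>{1..d} - {i}. w0 j * row j s) + \<delta>0 s) * E s)"
      using 0(5) by (metis ts(4,7))
    also have "\<dots> = 0" using comb[OF 0(3,4)] \<xi>j by simp
    finally have \<xi>: "\<xi> E j = 0" if "j \<in> {1..d}" for j using \<xi>j \<psi>g0 that by (cases "j = i") auto
    have ES: "E s = 0" if s: "s \<in> S" for s
    proof -
      obtain w \<delta> where w: "g s \<in> A" "\<forall>j. w j \<in> A" "alg_grad smul S 0 \<delta>"
        "\<forall>t. to_fract (g s) * (if t = s then 1 else 0) = to_fract ((\<Sum>j\<in>{1..d}. w j * row j t) + \<delta> t)"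
        using g[OF s] by blast
      have eq: "(\<Sum>j\<in>{1..d}. w j * row j t) + \<delta> t = (if t = s then g s else 0)" for t
      proof -
        have "to_fract (if t = s then g s else 0) = to_fract ((\<Sum>j\<in>{1..d}. w j * row j t) + \<delta> t)"
          using w(4)[rule_format, of t] by (cases "t = s") (simp_all add: ts(1))
        then show ?thesis by (simp only: ts(4))
      qed
      have "(\<Sum>t\<in>S. \<psi> (if t = s then g s else 0) * E t) = (\<Sum>j\<in>{1..d}. \<psi> (w j) * \<xi> E j)"
        using comb[OF w(2,3), of "{1..d}"] unfolding eq .
      also have "\<dots> = 0" using \<xi> by simp
      also have "(\<Sum>t\<in>S. \<psi> (if t = s then g s else 0) * E t) = (\<Sum>t\<in>S. if t = s then \<psi> (g s) * E s else 0)"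
        by (intro sum.cong) (auto simp: h(1))
      finally show ?thesis using \<psi>g[OF s] s finite_S by simp
    qed
    have "b l0 \<in> A" using Db t(1) by blast
    then obtain \<beta> where "alg_grad smul S (b l0) \<beta>" using alg_grad_exists[of "b l0" S] unfolding A_def by blast
    from Egrad[OF this] ES have "E (b l0) = 0" by simp
    moreover have "E (b l0) = (\<Sum>l\<in>{1..d}. if l = l0 then t l else 0)"
      unfolding E_def using Db t(1) by (intro sum.cong) auto
    ultimately show False using t(1,2) by simp
  qed
  have "\<exists>D. deriv_on smul UNIV (\<lambda>r. r) D \<and> (\<forall>j\<in>{1..d}. D (x j) = (if i = j then 1 else 0))" if i: "i \<in> {1..d}" for i
  proof -
    have "(\<lambda>t. to_fract (row i t)) \<in> V.span (?X ({1..d} - {i})) \<or>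
      (\<exists>v. (\<forall>r\<in>?X ({1..d} - {i}). (\<Sum>t\<in>S. r t * v t) = 0) \<and> (\<Sum>t\<in>S. to_fract (row i t) * v t) = 1)"
      by (rule fredholm_alternative[OF finite_S]) (use X0 row0 in \<open>auto simp: ts\<close>)
    then obtain v where v: "\<forall>r\<in>?X ({1..d} - {i}). (\<Sum>t\<in>S. r t * v t) = 0" "(\<Sum>t\<in>S. to_fract (row i t) * v t) = 1"
      using not_span[OF i] by blast
    have "\<exists>D. deriv_on smul UNIV to_fract D \<and> (\<forall>s\<in>S. D s = v s)"
    proof (rule deriv_from_jacobian_solution)
      show "(\<Sum>s\<in>S. to_fract (\<delta> s) * v s) = 0" if "alg_grad smul S 0 \<delta>" for \<delta>
        using v(1)[rule_format, of "\<lambda>t. to_fract (\<delta> t)"] that by auto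
    qed
    then obtain D0 where D0: "deriv_on smul UNIV to_fract D0" "\<forall>s\<in>S. D0 s = v s" by blast
    \<comment> \<open>By the choice of \<open>v\<close>, \<open>D0\<close> takes the inverse of this
      factor as its value at \<open>x i\<close>.\<close>
    define D where "D r = to_fract (den i * den i) * D0 r" for r
    have D: "deriv_on smul UNIV to_fract D"
      using D0(1) unfolding deriv_on_def D_def by (simp add: algebra_simps)
    have Dx: "D (x j) = to_fract (if i = j then 1 else 0)" if j: "j \<in> {1..d}" for j
    proof (cases "j = i")
      case True
      then show ?thesis using v(2) row[OF D0(1), of i] D0(2) by (simp add: D_def ts)
    next
      case False
      have "(\<Sum>t\<in>S. to_fract (row j t) * v t) = 0"
        using v(1)[rule_format, of "\<lambda>t. to_fract (row j t)"] j False by auto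
      then show ?thesis using row[OF D0(1), of j] D0(2) den0[of j] False by (simp add: D_def ts)
    qed
    \<comment> \<open>The values of \<open>D\<close> at the parameters are 0 or 1, so by Nakayama's
      lemma all values of \<open>D\<close> lie in the ring.\<close>
    have sub: "F.subspace (range to_fract)"
      unfolding F.subspace_def by (auto simp flip: ts(5,7) intro!: range_eqI[of _ _ 0] simp: ts(1))
    have "D r \<in> range to_fract" for r
      by (rule deriv_in_submodule[OF D sub]) (simp add: Dx)
    then have "\<forall>r. \<exists>e. D r = to_fract e" by blast
    then obtain E where E: "\<And>r. D r = to_fract (E r)" using choice[of "\<lambda>r e. D r = to_fract e"] by blast
    have "deriv_on smul UNIV (\<lambda>r. r) E"
      using D unfolding deriv_on_def E ts(5)[symmetric] ts(7)[symmetric] ts(4) ts(3) .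
    moreover have "\<forall>j\<in>{1..d}. E (x j) = (if i = j then 1 else 0)"
      using Dx unfolding E ts(4) by blast
    ultimately show ?thesis by blast
  qed
  then show ?thesis by (intro bchoice) blast
qed

end

section \<open>Powers of the maximal ideal and differential operators\<close>

lemma mono_pow_add: "mono_pow x I (\<lambda>i. J i + K i) = mono_pow x I J * mono_pow x I K"
  by (simp add: mono_pow_def power_add prod.distrib)

lemma mono_pow_zero: "mono_pow x I (\<lambda>_. 0) = 1"
  by (simp add: mono_pow_def)

lemma mono_pow_single:
  assumes "finite I" "i \<in> I"
  shows "mono_pow x I (\<lambda>j. if j = i then n else 0) = x i ^ n"
proof -
  have "mono_pow x I (\<lambda>j. if j = i then n else 0) = (\<Prod>j\<in>I. if j = i then x j ^ n else 1)"
    unfolding mono_pow_def by (intro prod.cong) auto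
  then show ?thesis using assms by simp
qed

lemma multi_idx_add: "J \<in> multi_idx I \<Longrightarrow> K \<in> multi_idx I \<Longrightarrow> (\<lambda>i. J i + K i) \<in> multi_idx I"
  by (simp add: multi_idx_def)

lemma finite_multi_idx_bounded:
  assumes "finite I"
  shows "finite {L \<in> multi_idx I. \<forall>i. L i \<le> (n::nat)}"
proof (rule finite_subset)
  show "{L \<in> multi_idx I. \<forall>i. L i \<le> n} \<subseteq> {f. \<forall>i. (i \<in> I \<longrightarrow> f i \<in> {..n}) \<and> (i \<notin> I \<longrightarrow> f i = 0)}"
    by (auto simp: multi_idx_def)
  show "finite \<dots>" using assms by (intro finite_set_of_finite_funs) auto
qed

lemma mpow_Suc_induct [consumes 1, case_names zero add mult]:
  fixes r :: "'a::local_ring"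
  assumes "r \<in> mpow (Suc n)" and "P 0" and add: "\<And>y z. P y \<Longrightarrow> P z \<Longrightarrow> P (y + z)"
    and mult: "\<And>y z. y \<in> max_ideal \<Longrightarrow> z \<in> mpow n \<Longrightarrow> P (y * z)"
  shows "P r"
proof -
  interpret module "(*) :: 'a \<Rightarrow> 'a \<Rightarrow> 'a" by (rule self_module)
  have "r \<in> span {x * y |x y. x \<in> max_ideal \<and> y \<in> mpow n}"
    using assms(1) unfolding ideal_power.simps .
  then show ?thesis
  proof (induction rule: span_induct_alt)
    case (step c y z)
    then obtain u v where "y = u * v" "u \<in> max_ideal" "v \<in> mpow n" by blast
    then have "P (c * u * v)" by (intro mult subspace_scale[OF is_ideal_max_ideal])
    then have "P (c * y)" using \<open>y = u * v\<close> by (simp only: mult.assoc)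
    then show ?case using step.IH by (rule add)
  qed (rule assms(2))
qed

lemma max_ideal_mult_mpow: "y \<in> max_ideal \<Longrightarrow> z \<in> mpow n \<Longrightarrow> y * z \<in> mpow (Suc n)"
  for y z :: "'a::local_ring"
  by (auto intro!: module.span_base[OF self_module])

lemma mpow_mult: "a \<in> mpow m \<Longrightarrow> b \<in> mpow n \<Longrightarrow> a * b \<in> mpow (m + n)"
  for a b :: "'a::local_ring"
proof (induction m arbitrary: a)
  case 0
  then show ?case by (simp add: mpow_simps)
next
  case (Suc m)
  from Suc.prems(1) show ?case
  proof (induction rule: mpow_Suc_induct)
    case zero
    show ?case by (simp only: mult_zero_left mpow_simps)
  next
    case (add y z)
    then show ?case by (simp only: distrib_right mpow_simps)
  next
    case (mult y z)
    have "z * b \<in> mpow (m + n)" by (rule Suc.IH[OF mult(2) Suc.prems(2)])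
    from max_ideal_mult_mpow[OF mult(1) this] show ?case by (simp only: mult.assoc add_Suc)
  qed
qed

lemma mpow_antimono: "m \<le> n \<Longrightarrow> a \<in> mpow n \<Longrightarrow> a \<in> mpow m"
  for a :: "'a::local_ring"
proof (induction rule: inc_induct)
  case (step k)
  then have "a \<in> mpow (Suc k)" by simp
  then show ?case by (induction rule: mpow_Suc_induct) (simp_all only: mpow_simps)
qed

lemma mpow_sum: "(\<And>i. i \<in> I \<Longrightarrow> f i \<in> mpow n) \<Longrightarrow> sum f I \<in> (mpow n :: 'a::local_ring set)"
  by (rule module.subspace_sum[OF self_module is_ideal_mpow])

lemma mpow_power: "a \<in> mpow m \<Longrightarrow> a ^ k \<in> mpow (m * k)"
  for a :: "'a::local_ring"
  by (induction k) (simp_all add: mpow_mult)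

lemma mono_pow_in_mpow:
  fixes x :: "'i \<Rightarrow> 'a::local_ring"
  assumes "\<And>i. i \<in> I \<Longrightarrow> x i \<in> mpow (w i)"
  shows "mono_pow x I L \<in> mpow (\<Sum>i\<in>I. w i * L i)"
  using assms unfolding mono_pow_def
proof (induction I rule: infinite_finite_induct)
  case (insert i I)
  then show ?case by (simp add: mpow_mult mpow_power)
qed simp_all

section \<open>Calculus of differential operators\<close>

lemma diff_op_linear: "diff_op smul t D \<Longrightarrow> Vector_Spaces.linear smul smul D"
  by (cases t) auto

context k_algebra begin

lemma linearI:
  "(\<And>a b. D (a + b) = D a + D b) \<Longrightarrow> (\<And>c a. D (smul c a) = smul c (D a)) \<Longrightarrow> Vector_Spaces.linear smul smul D"
  by (simp add: Vector_Spaces.linear_iff vector_space_axioms)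

lemma linearD:
  assumes "Vector_Spaces.linear smul smul D"
  shows "D (a + b) = D a + D b" "D (smul c a) = smul c (D a)" "D 0 = 0" "D (a - b) = D a - D b"
    "D (sum f I) = (\<Sum>i\<in>I. D (f i))"
proof -
  interpret Vector_Spaces.linear smul smul D by fact
  show "D (a + b) = D a + D b" "D (smul c a) = smul c (D a)" "D 0 = 0" "D (a - b) = D a - D b"
    "D (sum f I) = (\<Sum>i\<in>I. D (f i))" by (fact add scale zero diff sum)+
qed

lemma diff_op_0_eq: "diff_op smul 0 D \<Longrightarrow> D (f * g) = f * D g"
  by simp

lemma linear_plus:
  assumes D: "Vector_Spaces.linear smul smul D" and E: "Vector_Spaces.linear smul smul E"
  shows "Vector_Spaces.linear smul smul (\<lambda>g. D g + E g)"
  by (rule linearI) (simp_all add: linearD[OF D] linearD[OF E] scale_right_distrib)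

lemma linear_mult:
  assumes D: "Vector_Spaces.linear smul smul D"
  shows "Vector_Spaces.linear smul smul (\<lambda>g. a * D g)" "Vector_Spaces.linear smul smul (\<lambda>g. D (a * g))"
  by (rule linearI; simp add: linearD[OF D] mult_smul distrib_left)+

lemma diff_op_add: "diff_op smul t D \<Longrightarrow> diff_op smul t E \<Longrightarrow> diff_op smul t (\<lambda>g. D g + E g)"
proof (induction t arbitrary: D E)
  case 0
  have "D (f * g) + E (f * g) - f * (D g + E g) = 0" for f g
    by (simp only: diff_op_0_eq[OF 0(1)] diff_op_0_eq[OF 0(2)] distrib_left diff_self)
  with 0 show ?case by (simp add: linear_plus linear_mult)
next
  case (Suc t)
  have "diff_op smul t (\<lambda>g. D (f * g) + E (f * g) - f * (D g + E g))" for f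
  proof -
    have "(\<lambda>g. D (f * g) + E (f * g) - f * (D g + E g)) = (\<lambda>g. (D (f * g) - f * D g) + (E (f * g) - f * E g))"
      by (simp add: fun_eq_iff algebra_simps)
    then show ?thesis using Suc by simp
  qed
  with Suc.prems show ?case by (simp add: linear_plus linear_mult)
qed

lemma diff_op_mult_left: "diff_op smul t D \<Longrightarrow> diff_op smul t (\<lambda>g. a * D g)"
proof (induction t arbitrary: D)
  case 0
  have "a * D (f * g) - f * (a * D g) = 0" for f g
    by (simp add: diff_op_0_eq[OF 0] mult.left_commute)
  with 0 show ?case by (simp add: linear_plus linear_mult)
next
  case (Suc t)
  have "diff_op smul t (\<lambda>g. a * D (f * g) - f * (a * D g))" for f
  proof -
    have "(\<lambda>g. a * D (f * g) - f * (a * D g)) = (\<lambda>g. a * (D (f * g) - f * D g))"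
      by (simp add: fun_eq_iff algebra_simps)
    then show ?thesis using Suc by simp
  qed
  with Suc.prems show ?case by (simp add: linear_plus linear_mult)
qed

lemma diff_op_mult_right: "diff_op smul t D \<Longrightarrow> diff_op smul t (\<lambda>g. D (a * g))"
proof (induction t arbitrary: D)
  case 0
  have "D (a * (f * g)) - f * D (a * g) = 0" for f g
    by (simp add: diff_op_0_eq[OF 0] mult.left_commute)
  with 0 show ?case by (simp add: linear_plus linear_mult)
next
  case (Suc t)
  have "diff_op smul t (\<lambda>g. D (a * (f * g)) - f * D (a * g))" for f
  proof -
    have "diff_op smul t (\<lambda>g. D (f * g) - f * D g)" using Suc.prems by simp
    from Suc.IH[OF this] show ?thesis by (simp add: mult.left_commute)
  qed
  with Suc.prems show ?case by (simp add: linear_plus linear_mult)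
qed

lemma diff_op_zero: "diff_op smul t (\<lambda>_. 0)"
  by (induction t) (auto simp: Vector_Spaces.linear_iff vector_space_axioms)

text \<open>Induction on the total order by \<open>[DE, f] = D [E, f] + [D, f] E\<close>. Order 0 is
  treated apart, since there the commutator vanishes instead of dropping in order.\<close>

lemma diff_op_compose:
  "diff_op smul s D \<Longrightarrow> diff_op smul t E \<Longrightarrow> diff_op smul (s + t) (\<lambda>g. D (E g))"
proof (induction "s + t" arbitrary: s t D E rule: less_induct)
  case less
  note lD = linearD[OF diff_op_linear[OF less.prems(1)]] and lE = linearD[OF diff_op_linear[OF less.prems(2)]]
  have lin: "Vector_Spaces.linear smul smul (\<lambda>g. D (E g))" by (rule linearI) (simp_all add: lD lE)
  have comm: "D (E (f * g)) - f * D (E g) = D (E (f * g) - f * E g) + (D (f * E g) - f * D (E g))" for f g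
    by (simp add: lD)
  show ?case
  proof (cases s)
    case s: 0
    then have D: "D (f * g) = f * D g" for f g using less.prems by simp
    show ?thesis
    proof (cases t)
      case 0
      with s less.prems lin show ?thesis by (simp add: D)
    next
      case (Suc t')
      have "diff_op smul (s + t') (\<lambda>g. D (E (f * g) - f * E g))" for f
        by (rule less.hyps) (use Suc less.prems in auto)
      then show ?thesis using Suc s lin by (simp add: comm) (simp add: D)
    qed
  next
    case (Suc s')
    have 1: "diff_op smul (s' + t) (\<lambda>g. D (f * E g) - f * D (E g))" for f
      using less.hyps[of s' t "\<lambda>g. D (f * g) - f * D g" E] Suc less.prems by auto
    have 2: "diff_op smul (s' + t) (\<lambda>g. D (E (f * g) - f * E g))" for f
    proof (cases t)
      case 0
      then have "E (f * g) - f * E g = 0" for g using less.prems by simp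
      then show ?thesis using diff_op_zero by (simp add: lD)
    next
      case t: (Suc t')
      have "diff_op smul (s + t') (\<lambda>g. D (E (f * g) - f * E g))"
        by (rule less.hyps) (use t less.prems in auto)
      then show ?thesis using Suc t by simp
    qed
    show ?thesis using lin diff_op_add[OF 2 1] Suc by (simp add: comm)
  qed
qed

end

text \<open>By \<open>[D, f f'] = [D, f] f' + f [D, f']\<close> the order of an operator can be
  tested on the factors of a product.\<close>

lemma (in k_algebra) diff_op_commutator_mult:
  assumes f: "diff_op smul t (\<lambda>g. D (f * g) - f * D g)" and f': "diff_op smul t (\<lambda>g. D (f' * g) - f' * D g)"
  shows "diff_op smul t (\<lambda>g. D (f * f' * g) - f * f' * D g)"
proof -
  have "(\<lambda>g. D (f * f' * g) - f * f' * D g) = (\<lambda>g. (D (f * (f' * g)) - f * D (f' * g)) + f * (D (f' * g) - f' * D g))"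
    by (simp add: fun_eq_iff algebra_simps)
  then show ?thesis
    using diff_op_add[OF diff_op_mult_right[OF f, of f'] diff_op_mult_left[OF f', of f]] by simp
qed

text \<open>A factor from the maximal ideal is either pulled out of \<open>D\<close> or lost in the
  commutator, together with one order of the operator. The truncated difference covers
  \<open>n < t\<close>.\<close>

lemma diff_op_mpow:
  fixes smul :: "'k::field \<Rightarrow> 'a::local_ring \<Rightarrow> 'a"
  assumes "k_algebra smul"
  shows "diff_op smul t D \<Longrightarrow> r \<in> mpow n \<Longrightarrow> D r \<in> mpow (n - t)"
proof (induction t arbitrary: D r n)
  case 0
  interpret k_algebra smul by fact
  have "D r = r * D 1" using diff_op_0_eq[OF 0(1), of r 1] by simp
  then show ?case using 0 by (simp add: mpow_simps)
next
  case (Suc t)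
  interpret k_algebra smul by fact
  note l = linearD[OF diff_op_linear[OF Suc.prems(1)]] and IHt = Suc.IH and op = Suc.prems(1)
  show ?case using Suc.prems(2)
  proof (induction n arbitrary: r)
    case (Suc n)
    from Suc.prems show ?case
    proof (induction rule: mpow_Suc_induct)
      case zero
      show ?case by (simp only: l mpow_simps)
    next
      case (add y z)
      then show ?case by (simp only: l mpow_simps)
    next
      case (mult y z)
      have "D (y * z) - y * D z \<in> mpow (n - t)"
        by (rule IHt[where D = "\<lambda>g. D (y * g) - y * D g", OF _ mult(2)]) (use op in simp)
      moreover have "y * D z \<in> mpow (n - t)"
      proof (cases "n \<ge> Suc t")
        case True
        from max_ideal_mult_mpow[OF mult(1) Suc.IH[OF mult(2)]] True show ?thesis
          by (simp only: Suc_diff_le[symmetric] diff_Suc_Suc)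
      qed simp
      ultimately have "(D (y * z) - y * D z) + y * D z \<in> mpow (n - t)" by (rule mpow_simps)
      then show ?case by (simp only: diff_add_cancel diff_Suc_Suc)
    qed
  qed simp
qed

section \<open>Hasse operators\<close>

text \<open>The additive character \<open>(1 + X)\<^sup>a\<^sup>+\<^sup>q = (1 + X)\<^sup>a (1 + X\<^sup>q)\<close> of \<open>q\<close>, read off on coefficients.\<close>

definition frobenius_power :: "'a::comm_ring_1 itself \<Rightarrow> nat \<Rightarrow> bool" where
  "frobenius_power _ q \<longleftrightarrow> q > 0 \<and>
     (\<forall>a n. (of_nat ((a + q) choose n) :: 'a) = of_nat (a choose n) + (if q \<le> n then of_nat (a choose (n - q)) else 0))"

text \<open>Pascal's rule. The value 1 stands for \<open>p ^ 0\<close> in characteristic 0.\<close>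

lemma frobenius_power_1: "frobenius_power TYPE('a::comm_ring_1) 1"
  unfolding frobenius_power_def
proof (intro conjI allI)
  fix a n
  show "(of_nat ((a + 1) choose n) :: 'a) = of_nat (a choose n) + (if 1 \<le> n then of_nat (a choose (n - 1)) else 0)"
    by (cases n) (simp_all add: add.commute)
qed simp

lemma frobenius_power_char:
  assumes "prime CHAR('a::comm_ring_1)"
  shows "frobenius_power TYPE('a) (CHAR('a) ^ e)"
  unfolding frobenius_power_def
proof (intro conjI allI)
  let ?q = "CHAR('a) ^ e"
  show "?q > 0" using assms prime_gt_0_nat by simp
  fix a n
  have c: "coeff ([:1, 1 :: 'a:] ^ m) i = of_nat (m choose i)" for m i
    by (cases "i \<le> m") (simp_all add: coeff_linear_poly_power coeff_eq_0 degree_linear_power binomial_eq_0)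
  have "[:1, 1 :: 'a:] ^ ?q = ([:1:] + monom 1 1) ^ ?q" by (simp add: monom_altdef)
  also have "\<dots> = [:1:] ^ ?q + monom 1 1 ^ ?q"
    by (rule freshmans_dream') (use assms in simp_all)
  also have "\<dots> = 1 + monom 1 ?q" by (simp add: monom_power one_pCons flip: one_pCons)
  finally have q: "[:1, 1 :: 'a:] ^ ?q = 1 + monom 1 ?q" .
  have "[:1, 1 :: 'a:] ^ (a + ?q) = [:1, 1:] ^ a + monom 1 ?q * [:1, 1:] ^ a"
    unfolding power_add q by (simp add: algebra_simps)
  from arg_cong[OF this, of "\<lambda>p. coeff p n"]
  show "(of_nat ((a + ?q) choose n) :: 'a) = of_nat (a choose n) + (if ?q \<le> n then of_nat (a choose (n - ?q)) else 0)"
    by (simp add: c coeff_monom_mult)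
qed

text \<open>For \<open>n < q\<close> the second term of the recurrence is absent, so only the
  residue modulo \<open>q\<close> of the upper entry counts.\<close>

lemma frobenius_power_choose_mod:
  assumes "frobenius_power TYPE('a::comm_ring_1) q" "n < q"
  shows "(of_nat ((k + q * b) choose n) :: 'a) = of_nat (k choose n)"
proof (induction b)
  case (Suc b)
  have "(of_nat ((k + q * b + q) choose n) :: 'a) = of_nat ((k + q * b) choose n)"
    using assms unfolding frobenius_power_def by auto
  then show ?case using Suc by (simp add: ac_simps)
qed simp

text \<open>In orders divisible by \<open>q\<close> the recurrence becomes Pascal's rule for
  \<open>b choose j\<close>.\<close>

lemma frobenius_power_lucas:
  assumes q: "frobenius_power TYPE('a::comm_ring_1) q" and k: "k < q"
  shows "(of_nat ((k + q * b) choose (q * j)) :: 'a) = of_nat (b choose j)"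
proof (induction b arbitrary: j)
  case 0
  show ?case using k q by (cases j) (auto simp: frobenius_power_def binomial_eq_0)
next
  case (Suc b)
  have "(of_nat ((k + q * b + q) choose (q * j)) :: 'a) = of_nat ((k + q * b) choose (q * j))
    + (if q \<le> q * j then of_nat ((k + q * b) choose (q * j - q)) else 0)"
    using q unfolding frobenius_power_def by blast
  also have "q * j - q = q * (j - 1)" by (cases j) auto
  also have "of_nat ((k + q * b) choose (q * j)) + (if q \<le> q * j then of_nat ((k + q * b) choose (q * (j - 1))) else (0 :: 'a))
    = of_nat (Suc b choose j)"
    using Suc.IH[of j] Suc.IH[of "j - 1"] q by (cases j) (auto simp: frobenius_power_def)
  finally show ?case by (simp add: ac_simps)
qed

lemma mono_pow_remove:
  "finite I \<Longrightarrow> i \<in> I \<Longrightarrow> mono_pow x I L = x i ^ L i * mono_pow x (I - {i}) L"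
  by (simp add: mono_pow_def prod.remove)

lemma mono_pow_cong: "(\<And>i. i \<in> I \<Longrightarrow> L i = K i) \<Longrightarrow> mono_pow x I L = mono_pow x I K"
  by (auto simp: mono_pow_def intro: prod.cong)

lemma mono_pow_upd:
  "finite I \<Longrightarrow> i \<in> I \<Longrightarrow> mono_pow x I (L(i := n)) = x i ^ n * mono_pow x (I - {i}) L"
  by (simp add: mono_pow_remove) (metis Diff_iff fun_upd_other insertI1 mono_pow_cong)

lemma multi_idx_upd: "L \<in> multi_idx I \<Longrightarrow> i \<in> I \<Longrightarrow> L(i := n) \<in> multi_idx I"
  by (simp add: multi_idx_def)

lemma mono_pow_power:
  fixes x :: "'i \<Rightarrow> 'a::comm_semiring_1"
  shows "mono_pow x I (\<lambda>i. n * L i) = mono_pow x I L ^ n"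
  by (simp add: mono_pow_def prod_power_distrib mult.commute[of n] power_mult)

lemma Suc_times_choose_Suc: "Suc n * (m choose Suc n) = (m - n) * (m choose n)"
  by (metis binomial_absorption binomial_absorb_comp)

lemma (in k_algebra) of_nat_eq_smul: "of_nat n = smul (of_nat n) 1"
  by (induction n) (simp_all add: scale_left_distrib)

lemma (in k_algebra) CHAR_eq: "CHAR('a) = CHAR('k)"
  by (rule CHAR_eqI) (simp_all add: of_nat_eq_smul[of _] of_nat_eq_0_iff_char_dvd)

context nonsingular_point begin

abbreviation "mon \<equiv> mono_pow x {1..d}"
abbreviation "MI \<equiv> multi_idx {1..d}"

definition pd :: "nat \<Rightarrow> 'r \<Rightarrow> 'r" where
  "pd = (SOME \<Delta>. \<forall>i\<in>{1..d}. deriv_on smul UNIV (\<lambda>r. r) (\<Delta> i) \<and> (\<forall>j\<in>{1..d}. \<Delta> i (x j) = (if i = j then 1 else 0)))"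

lemma pd:
  assumes "i \<in> {1..d}"
  shows "pd i (a + b) = pd i a + pd i b" "pd i (a * b) = a * pd i b + b * pd i a" "pd i (smul c 1) = 0"
    "j \<in> {1..d} \<Longrightarrow> pd i (x j) = (if i = j then 1 else 0)" "pd i 0 = 0" "pd i 1 = 0" "pd i (smul c a) = smul c (pd i a)"
    "pd i (sum f F) = (\<Sum>j\<in>F. pd i (f j))"
proof -
  have *: "\<forall>i\<in>{1..d}. deriv_on smul UNIV (\<lambda>r. r) (pd i) \<and> (\<forall>j\<in>{1..d}. pd i (x j) = (if i = j then 1 else 0))"
    unfolding pd_def using partial_derivatives_exist by (rule someI_ex)
  have "deriv_on smul UNIV (\<lambda>r. r) (pd i)" using * assms by blast
  then have d: "pd i (a + b) = pd i a + pd i b" "pd i (a * b) = a * pd i b + b * pd i a" "pd i (smul c 1) = 0" for a b c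
    by (auto simp: deriv_on_def)
  show "pd i (a + b) = pd i a + pd i b" "pd i (a * b) = a * pd i b + b * pd i a" "pd i (smul c 1) = 0" by (fact d)+
  show "j \<in> {1..d} \<Longrightarrow> pd i (x j) = (if i = j then 1 else 0)" using * assms by blast
  show 0: "pd i 0 = 0" using d(3)[of 0] by simp
  show "pd i 1 = 0" using d(3)[of 1] by simp
  have "pd i (smul c 1 * a) = smul c 1 * pd i a" by (simp add: d(2,3))
  then show "pd i (smul c a) = smul c (pd i a)" by (simp add: smul_mult)
  show "pd i (sum f F) = (\<Sum>j\<in>F. pd i (f j))"
    by (induction F rule: infinite_finite_induct) (simp_all add: 0 d)
qed

lemma pd_power: "i \<in> {1..d} \<Longrightarrow> pd i (r ^ n) = of_nat n * r ^ (n - 1) * pd i r"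
proof (induction n)
  case (Suc n)
  then show ?case by (cases n) (simp_all add: pd algebra_simps)
qed (simp add: pd)

lemma pd_prod_zero: "i \<in> {1..d} \<Longrightarrow> (\<And>j. j \<in> F \<Longrightarrow> pd i (f j) = 0) \<Longrightarrow> pd i (prod f F) = 0"
  by (induction F rule: infinite_finite_induct) (simp_all add: pd)

lemma pd_mon:
  assumes i: "i \<in> {1..d}"
  shows "pd i (mon L) = of_nat (L i) * mon (L(i := L i - 1))"
proof -
  have "pd i (mono_pow x ({1..d} - {i}) L) = 0"
    unfolding mono_pow_def using i by (intro pd_prod_zero) (auto simp: pd_power pd)
  then have "pd i (mon L) = mono_pow x ({1..d} - {i}) L * (of_nat (L i) * x i ^ (L i - 1))"
    using i by (simp add: mono_pow_remove[of _ i] pd pd_power)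
  then show ?thesis using i by (simp add: mono_pow_upd mult_ac)
qed

lemma pd_diff_op: "i \<in> {1..d} \<Longrightarrow> diff_op smul 1 (pd i)"
proof -
  assume i: "i \<in> {1..d}"
  have "diff_op smul 0 (\<lambda>g. pd i (f * g) - f * pd i g)" for f
  proof -
    have eq: "(\<lambda>g. pd i (f * g) - f * pd i g) = (\<lambda>g. g * pd i f)" using i by (simp add: pd fun_eq_iff)
    show ?thesis unfolding eq using i by (auto intro!: linearI simp: distrib_right smul_mult)
  qed
  moreover have "Vector_Spaces.linear smul smul (pd i)" using i by (intro linearI) (simp_all add: pd)
  ultimately show ?thesis unfolding One_nat_def diff_op.simps(2) by blast
qed

lemma hasse_operator_char_0:
  assumes char: "CHAR('k) = 0" and i: "i \<in> {1..d}"
  shows "\<exists>D. diff_op smul n D \<and> (\<forall>L\<in>MI. D (mon L) = of_nat (L i choose n) * mon (L(i := L i - n)))"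
proof (induction n)
  case 0
  show ?case by (rule exI[of _ "\<lambda>r. r"]) (auto intro!: linearI)
next
  case (Suc n)
  then obtain D where D: "diff_op smul n D" "\<And>L. L \<in> MI \<Longrightarrow> D (mon L) = of_nat (L i choose n) * mon (L(i := L i - n))" by blast
  let ?c = "inverse (of_nat (Suc n)) :: 'k"
  have "(of_nat (Suc n) :: 'k) \<noteq> 0" using char by (subst of_nat_eq_0_iff_char_dvd) auto
  then have c: "smul ?c 1 * of_nat (Suc n) = 1"
    unfolding of_nat_eq_smul[of "Suc n"] smul_one_mult[symmetric] by (simp del: of_nat_Suc)
  have "diff_op smul (Suc n) (\<lambda>g. smul ?c 1 * pd i (D g))"
    using diff_op_mult_left[OF diff_op_compose[OF pd_diff_op[OF i] D(1)]] by simp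
  moreover have "smul ?c 1 * pd i (D (mon L)) = of_nat (L i choose Suc n) * mon (L(i := L i - Suc n))" if L: "L \<in> MI" for L
  proof -
    have "pd i (mon (L(i := L i - n))) = of_nat (L i - n) * mon (L(i := L i - Suc n))"
      using pd_mon[OF i, of "L(i := L i - n)"] by simp
    moreover have "pd i (D (mon L)) = of_nat (L i choose n) * pd i (mon (L(i := L i - n)))"
      unfolding D(2)[OF L] of_nat_eq_smul[of "L i choose n"] smul_mult using pd(7)[OF i] by simp
    ultimately have "pd i (D (mon L)) = of_nat (L i choose n) * (of_nat (L i - n) * mon (L(i := L i - Suc n)))"
      by simp
    also have "\<dots> = of_nat (Suc n * (L i choose Suc n)) * mon (L(i := L i - Suc n))"
      unfolding Suc_times_choose_Suc by (simp add: mult_ac)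
    finally have "smul ?c 1 * pd i (D (mon L)) = (smul ?c 1 * of_nat (Suc n)) * (of_nat (L i choose Suc n) * mon (L(i := L i - Suc n)))"
      by (simp only: of_nat_mult mult.assoc)
    then show ?thesis unfolding c by simp
  qed
  ultimately show ?case by blast
qed

end

lemma multi_idx_supp: "L \<in> multi_idx I \<Longrightarrow> L i \<noteq> 0 \<Longrightarrow> i \<in> I"
  by (auto simp: multi_idx_def)

context nonsingular_point begin

abbreviation deg_idx :: "(nat \<Rightarrow> nat) \<Rightarrow> nat" where
  "deg_idx L \<equiv> \<Sum>i\<in>{1..d}. L i"

abbreviation idx_box :: "'i set \<Rightarrow> nat \<Rightarrow> ('i \<Rightarrow> nat) set" where
  "idx_box I Q \<equiv> {K \<in> multi_idx I. \<forall>i. K i < Q}"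

lemma finite_idx_box: "finite I \<Longrightarrow> finite (idx_box I Q)"
  by (rule finite_subset[OF _ finite_multi_idx_bounded[of I Q]]) (auto intro: less_imp_le)

lemma mpow_subset_ideal_gen: "mpow n \<subseteq> ideal_gen (mon ` {L \<in> MI. deg_idx L = n})"
proof (induction n)
  case 0
  interpret Rmod: module "(*) :: 'r \<Rightarrow> 'r \<Rightarrow> 'r" by (rule self_module)
  have "mon (\<lambda>_. 0) \<in> Rmod.span (mon ` {L \<in> MI. deg_idx L = 0})"
    by (intro Rmod.span_base imageI) (simp add: multi_idx_def)
  then have "1 \<in> Rmod.span (mon ` {L \<in> MI. deg_idx L = 0})" by (simp only: mono_pow_zero)
  from Rmod.span_scale[OF this] show ?case by auto
next
  case (Suc n)
  interpret Rmod: module "(*) :: 'r \<Rightarrow> 'r \<Rightarrow> 'r" by (rule self_module)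
  let ?G = "\<lambda>n. mon ` {L \<in> MI. deg_idx L = n}"
  show ?case
  proof
    fix r :: 'r assume "r \<in> mpow (Suc n)"
    then show "r \<in> Rmod.span (?G (Suc n))"
    proof (induction rule: mpow_Suc_induct)
      case (mult y z)
      obtain c where y: "y = (\<Sum>i\<in>{1..d}. c i * x i)" using max_ideal_sum[OF mult(1)] by blast
      have "x i * z \<in> Rmod.span (?G (Suc n))" if i: "i \<in> {1..d}" for i
      proof -
        have "z \<in> Rmod.span (?G n)" using Suc.IH mult(2) by blast
        then show ?thesis
        proof (induction rule: Rmod.span_induct_alt)
          case base
          show ?case by (simp only: mult_zero_right Rmod.span_zero)
        next
          case (step c u z)
          then obtain L where L: "L \<in> MI" "deg_idx L = n" "u = mon L" by blast
          let ?L = "\<lambda>j. (if j = i then 1 else 0) + L j"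
          have "x i * u = mon ?L" unfolding mono_pow_add L(3) using i by (simp add: mono_pow_single)
          moreover have "?L \<in> MI" using L(1) i by (auto simp: multi_idx_def)
          moreover have "deg_idx ?L = Suc n" unfolding sum.distrib L(2) using i by simp
          ultimately have "x i * u \<in> Rmod.span (?G (Suc n))" by (intro Rmod.span_base) auto
          then have "c * (x i * u) + x i * z \<in> Rmod.span (?G (Suc n))"
            by (rule Rmod.span_add[OF Rmod.span_scale step.IH])
          then show ?case by (simp only: distrib_left mult.left_commute)
        qed
      qed
      then have "(\<Sum>i\<in>{1..d}. c i * (x i * z)) \<in> Rmod.span (?G (Suc n))"
        by - (rule Rmod.span_sum, rule Rmod.span_scale)
      then show ?case unfolding y by (simp only: sum_distrib_right mult.assoc)
    qed (auto intro: Rmod.span_zero Rmod.span_add)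
  qed
qed

lemma x_mpow: "i \<in> {1..d} \<Longrightarrow> x i \<in> mpow 1"
  unfolding mpow_1 by (rule x_in)

lemma mon_in_mpow: "mon L \<in> mpow (deg_idx L)"
  using mono_pow_in_mpow[of "{1..d}" x "\<lambda>_. 1" L] x_mpow by (simp del: ideal_power.simps)

text \<open>Modulo the next power only the residues of the coefficients count, and these are
  constants by \<open>residue_field\<close>.\<close>

lemma mpow_leading_form:
  assumes "r \<in> mpow n"
  shows "\<exists>p\<in>span (mon ` {L \<in> MI. deg_idx L = n}). r - p \<in> mpow (Suc n)"
proof -
  let ?G = "mon ` {L \<in> MI. deg_idx L = n}"
  have "r \<in> ideal_gen ?G" using mpow_subset_ideal_gen assms by blast
  then show ?thesis
  proof (induction rule: module.span_induct_alt[OF self_module, consumes 1])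
    case 1
    show ?case by (rule bexI[of _ 0]) (simp_all only: diff_self mpow_simps span_zero)
  next
    case (2 c y z)
    then obtain L p where L: "L \<in> MI" "deg_idx L = n" "y = mon L" and p: "p \<in> span ?G" "z - p \<in> mpow (Suc n)" by blast
    obtain c0 where c0: "c - smul c0 1 \<in> max_ideal" using residue_field by blast
    have "mon L \<in> mpow n" using mon_in_mpow[of L] L(2) by (simp only:)
    from max_ideal_mult_mpow[OF c0 this] have "(c - smul c0 1) * y \<in> mpow (Suc n)" unfolding L(3) .
    then have "(c - smul c0 1) * y + (z - p) \<in> mpow (Suc n)" using p(2) by (rule mpow_simps)
    moreover have "(c - smul c0 1) * y + (z - p) = c * y + z - (smul c0 y + p)"
      unfolding smul_eq_mult[of c0 y] by (simp add: algebra_simps)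
    ultimately have "c * y + z - (smul c0 y + p) \<in> mpow (Suc n)" by (simp only:)
    moreover have "smul c0 y + p \<in> span ?G" using L p(1)
      by (intro span_add span_scale) (auto intro: span_base)
    ultimately show ?case by blast
  qed
qed

lemma polynomial_approximation: "\<exists>p\<in>span (mon ` MI). r - p \<in> mpow n"
proof (induction n)
  case 0
  show ?case by (rule bexI[of _ 0]) (simp_all add: span_zero)
next
  case (Suc n)
  then obtain p where p: "p \<in> span (mon ` MI)" "r - p \<in> mpow n" by blast
  from mpow_leading_form[OF p(2)] obtain p' where p': "p' \<in> span (mon ` {L \<in> MI. deg_idx L = n})"
    "r - p - p' \<in> mpow (Suc n)" by blast
  have "p' \<in> span (mon ` MI)" using p'(1) span_mono[of "mon ` {L \<in> MI. deg_idx L = n}" "mon ` MI"] by blast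
  then have "p + p' \<in> span (mon ` MI)" using p(1) by (rule span_add[rotated])
  moreover have "r - (p + p') \<in> mpow (Suc n)" using p'(2) by (simp only: diff_diff_add)
  ultimately show ?case by blast
qed

lemma sum_idx_box_single:
  assumes "\<And>K. K \<in> idx_box {1..d} p \<Longrightarrow> K \<noteq> (\<lambda>_. 0) \<Longrightarrow> c K = 0"
    and "(\<Sum>K\<in>idx_box {1..d} p. c K * mon K) = 0" and K: "K \<in> idx_box {1..d} p"
  shows "c K = 0"
proof (cases "K = (\<lambda>_. 0)")
  case True
  have "(\<Sum>K\<in>idx_box {1..d} p. c K * mon K) = (\<Sum>K\<in>{\<lambda>_. 0}. c K * mon K)"
    using assms(1) K True finite_idx_box[of "{1..d}" p] by (intro sum.mono_neutral_right) auto
  then show ?thesis using assms(2) True by (simp add: mono_pow_zero)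
qed (use assms in blast)

text \<open>Coefficients killed by all partial derivatives behave like constants. Differentiating in
  a variable that occurs lowers the degree bound \<open>n\<close>, and the factors
  \<open>K i\<close> this produces are nonzero because they are below \<open>p\<close>.\<close>

lemma pd_independent:
  assumes "\<And>i K. i \<in> {1..d} \<Longrightarrow> pd i (c K) = 0" "(\<Sum>K\<in>idx_box {1..d} p. c K * mon K) = 0"
    and p: "\<And>m. 0 < m \<Longrightarrow> m < p \<Longrightarrow> (of_nat m :: 'r) \<noteq> 0" and K: "K \<in> idx_box {1..d} p"
    and "\<And>K. K \<in> idx_box {1..d} p \<Longrightarrow> deg_idx K > n \<Longrightarrow> c K = 0"
  shows "c K = 0"
  using assms(1,2,4,5)
proof (induction n arbitrary: c K)
  case 0
  show ?case
  proof (rule sum_idx_box_single[OF _ 0(2,3)])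
    fix K assume K: "K \<in> idx_box {1..d} p" "K \<noteq> (\<lambda>_. 0)"
    then obtain i where "K i \<noteq> 0" by (auto simp: fun_eq_iff)
    moreover from this have "i \<in> {1..d}" by (rule multi_idx_supp[rotated]) (use K(1) in simp)
    ultimately have "deg_idx K > 0" by (metis finite_atLeastAtMost gr_zeroI sum_eq_0_iff)
    then show "c K = 0" by (rule 0(4)[OF K(1)])
  qed
next
  case (Suc n)
  let ?B = "idx_box {1..d} p"
  have fin: "finite ?B" by (rule finite_idx_box) simp
  have "c K = 0" if K: "K \<in> ?B" "K \<noteq> (\<lambda>_. 0)" for K
  proof -
    obtain i where i: "K i \<noteq> 0" using K(2) by (auto simp: fun_eq_iff)
    then have iI: "i \<in> {1..d}" by (rule multi_idx_supp[rotated]) (use K(1) in simp)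
    \<comment> \<open>The coefficient of the derivative at \<open>K'\<close> comes from
      \<open>K'\<close> raised by one in place \<open>i\<close>, provided that this is still in the
      box.\<close>
    define c' where "c' K' = (if Suc (K' i) < p then of_nat (Suc (K' i)) * c (K'(i := Suc (K' i))) else 0)" for K'
    have pdn: "pd j (of_nat m * r) = of_nat m * pd j r" if "j \<in> {1..d}" for j m r
      unfolding of_nat_eq_smul[of m] smul_mult using pd(7)[OF that] by simp
    have "pd i (\<Sum>K\<in>?B. c K * mon K) = (\<Sum>K\<in>?B. c K * (of_nat (K i) * mon (K(i := K i - 1))))"
      using Suc.prems(1)[OF iI] by (simp only: pd[OF iI] pd_mon[OF iI] mult_zero_right add_0_right)
    also have "\<dots> = (\<Sum>K\<in>{K \<in> ?B. K i \<noteq> 0}. c K * (of_nat (K i) * mon (K(i := K i - 1))))"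
      by (intro sum.mono_neutral_right fin) (auto intro!: gr0I)
    also have "\<dots> = (\<Sum>K\<in>{K \<in> ?B. Suc (K i) < p}. c' K * mon K)"
    proof (rule sum.reindex_bij_witness[of _ "\<lambda>K. K(i := Suc (K i))" "\<lambda>K. K(i := K i - 1)"])
      fix K assume K: "K \<in> {K \<in> ?B. K i \<noteq> 0}"
      then have Ki: "Suc (K i - 1) = K i" "K i < p" by auto
      show 1: "(K(i := K i - 1))(i := Suc ((K(i := K i - 1)) i)) = K" using Ki(1) by simp
      show "K(i := K i - 1) \<in> {K \<in> ?B. Suc (K i) < p}"
        using K Ki iI by (auto simp: multi_idx_def less_imp_diff_less)
      show "c' (K(i := K i - 1)) * mon (K(i := K i - 1)) = c K * (of_nat (K i) * mon (K(i := K i - 1)))"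
        using Ki unfolding c'_def 1 by (simp add: mult_ac)
    next
      fix K assume K: "K \<in> {K \<in> ?B. Suc (K i) < p}"
      show "(K(i := Suc (K i)))(i := (K(i := Suc (K i))) i - 1) = K" by simp
      show "K(i := Suc (K i)) \<in> {K \<in> ?B. K i \<noteq> 0}" using K iI by (auto simp: multi_idx_def)
    qed
    also have "\<dots> = (\<Sum>K\<in>?B. c' K * mon K)"
      by (intro sum.mono_neutral_left) (use fin in \<open>auto simp: c'_def\<close>)
    finally have sum: "(\<Sum>K\<in>?B. c' K * mon K) = 0" using Suc.prems(2) pd(5)[OF iI] by simp
    let ?K = "K(i := K i - 1)"
    have K': "?K \<in> ?B" using K(1) iI by (auto simp: multi_idx_def less_imp_diff_less)
    have "c' ?K = 0"
    proof (rule Suc.IH[OF _ sum K'])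
      show "pd j (c' L) = 0" if "j \<in> {1..d}" for j L
        using Suc.prems(1)[OF that] pdn[OF that] pd(5)[OF that] by (simp add: c'_def del: of_nat_Suc)
      fix L assume L: "L \<in> ?B" "deg_idx L > n"
      show "c' L = 0"
      proof (cases "Suc (L i) < p")
        case True
        have "deg_idx (L(i := Suc (L i))) = Suc (deg_idx L)" using iI by (simp add: sum.remove[of _ i])
        moreover have "L(i := Suc (L i)) \<in> ?B" using L(1) True iI by (auto simp: multi_idx_def)
        ultimately have "c (L(i := Suc (L i))) = 0" using Suc.prems(4) L(2) by simp
        then show ?thesis by (simp add: c'_def)
      qed (simp add: c'_def)
    qed
    moreover have "K i < p" using K(1) by blast
    ultimately have "of_nat (K i) * c K = 0" using i by (simp add: c'_def del: of_nat_Suc)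
    then show ?thesis using p[of "K i"] i \<open>K i < p\<close> by simp
  qed
  then show ?case by (rule sum_idx_box_single[OF _ Suc.prems(2,3)])
qed

section \<open>The ring as a module over its \<open>q\<close>-th powers\<close>

context
  fixes p :: nat
  assumes p: "p = CHAR('r)" "p > 0"
begin

lemma prime_p: "prime CHAR('r)"
  using p prime_CHAR_semidom[where 'a = 'r] by simp

lemma frob_add: "(a + b :: 'r) ^ (p ^ e) = a ^ (p ^ e) + b ^ (p ^ e)"
  by (rule freshmans_dream'[OF prime_p]) (simp add: p(1))

lemma frob_diff: "(a - b :: 'r) ^ (p ^ e) = a ^ (p ^ e) - b ^ (p ^ e)"
  using frob_add[of "a - b" b e] by (simp add: algebra_simps)

lemma frob_sum: "(sum f F :: 'r) ^ (p ^ e) = (\<Sum>i\<in>F. f i ^ (p ^ e))"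
  by (rule freshmans_dream_sum'[OF prime_p]) (simp add: p(1))

lemma q_pos: "p ^ e > 0"
  using p(2) by simp

lemma pd_frob: "i \<in> {1..d} \<Longrightarrow> pd i (r ^ p) = 0"
proof -
  assume "i \<in> {1..d}"
  moreover have "(of_nat p :: 'r) = 0" by (simp add: p(1))
  ultimately show ?thesis by (simp add: pd_power)
qed

lemma of_nat_nonzero: "0 < m \<Longrightarrow> m < p \<Longrightarrow> (of_nat m :: 'r) \<noteq> 0"
  unfolding of_nat_eq_0_iff_char_dvd using p(1) by (auto dest: dvd_imp_le)

text \<open>Splitting \<open>K = K0 + p K1\<close> gives a relation with coefficients
  \<open>c K0 ^ p\<close>, which all derivatives kill; so each \<open>c K0\<close> vanishes, and
  this is a relation for the exponent \<open>e\<close>.\<close>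

lemma frob_independent:
  assumes "(\<Sum>K\<in>idx_box {1..d} (p ^ e). r K ^ (p ^ e) * mon K) = 0" "K \<in> idx_box {1..d} (p ^ e)"
  shows "r K = 0"
  using assms
proof (induction e arbitrary: r K)
  case 0
  have box: "idx_box {1..d} (p ^ 0) = {\<lambda>_. 0}" by (auto simp: multi_idx_def)
  show ?case using 0 unfolding box by (simp add: mono_pow_zero)
next
  case (Suc e)
  let ?q = "p ^ e"
  let ?B = "idx_box {1..d} p" and ?C = "idx_box {1..d} ?q"
  have q0: "?q > 0" by (rule q_pos)
  define c where "c K0 = (\<Sum>K1\<in>?C. r (\<lambda>i. K0 i + p * K1 i) ^ ?q * mon K1)" for K0
  have idx: "(\<lambda>i. K0 i + p * K1 i) \<in> idx_box {1..d} (p ^ Suc e)" if "K0 \<in> ?B" "K1 \<in> ?C" for K0 K1 :: "nat \<Rightarrow> nat"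
  proof -
    have "K0 i + p * K1 i < p * ?q" for i
    proof -
      have "K0 i < p" "K1 i + 1 \<le> ?q" using that by (auto simp: Suc_le_eq)
      then have "K0 i + p * K1 i < p * (K1 i + 1)" "p * (K1 i + 1) \<le> p * ?q"
        by (simp, intro mult_le_mono2)
      then show ?thesis by linarith
    qed
    then show ?thesis using that by (simp add: multi_idx_def)
  qed
  have "(\<Sum>K0\<in>?B. c K0 ^ p * mon K0) = (\<Sum>K0\<in>?B. \<Sum>K1\<in>?C. r (\<lambda>i. K0 i + p * K1 i) ^ (p ^ Suc e) * mon (\<lambda>i. K0 i + p * K1 i))"
  proof (intro sum.cong refl)
    fix K0
    have "c K0 ^ p = (\<Sum>K1\<in>?C. (r (\<lambda>i. K0 i + p * K1 i) ^ ?q * mon K1) ^ p)"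
      unfolding c_def using frob_sum[of _ _ 1] by simp
    also have "\<dots> = (\<Sum>K1\<in>?C. r (\<lambda>i. K0 i + p * K1 i) ^ (p ^ Suc e) * mon (\<lambda>i. p * K1 i))"
      by (simp add: power_mult_distrib mono_pow_power power_mult[symmetric] mult.commute)
    finally show "c K0 ^ p * mon K0 = (\<Sum>K1\<in>?C. r (\<lambda>i. K0 i + p * K1 i) ^ (p ^ Suc e) * mon (\<lambda>i. K0 i + p * K1 i))"
      by (simp add: sum_distrib_left mono_pow_add mult_ac)
  qed
  also have "\<dots> = (\<Sum>(K0, K1)\<in>?B \<times> ?C. r (\<lambda>i. K0 i + p * K1 i) ^ (p ^ Suc e) * mon (\<lambda>i. K0 i + p * K1 i))"
    by (rule sum.cartesian_product)
  also have "\<dots> = (\<Sum>K\<in>idx_box {1..d} (p ^ Suc e). r K ^ (p ^ Suc e) * mon K)"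
  proof (rule sum.reindex_bij_witness[of _ "\<lambda>K. (\<lambda>i. K i mod p, \<lambda>i. K i div p)" "\<lambda>(K0, K1) i. K0 i + p * K1 i"])
    fix a assume "a \<in> ?B \<times> ?C"
    then obtain K0 K1 where a: "a = (K0, K1)" "K0 \<in> ?B" "K1 \<in> ?C" by auto
    have "K0 i < p" for i using a by auto
    then show "(\<lambda>i. (case a of (K0, K1) \<Rightarrow> \<lambda>i. K0 i + p * K1 i) i mod p, \<lambda>i. (case a of (K0, K1) \<Rightarrow> \<lambda>i. K0 i + p * K1 i) i div p) = a"
      using p(2) by (simp add: a(1))
    show "(case a of (K0, K1) \<Rightarrow> \<lambda>i. K0 i + p * K1 i) \<in> idx_box {1..d} (p ^ Suc e)"
      using idx[OF a(2,3)] by (simp add: a(1))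
    show "r (case a of (K0, K1) \<Rightarrow> \<lambda>i. K0 i + p * K1 i) ^ (p ^ Suc e) * mon (case a of (K0, K1) \<Rightarrow> \<lambda>i. K0 i + p * K1 i)
      = (case a of (K0, K1) \<Rightarrow> r (\<lambda>i. K0 i + p * K1 i) ^ (p ^ Suc e) * mon (\<lambda>i. K0 i + p * K1 i))"
      by (simp add: a(1))
  next
    fix K assume K: "K \<in> idx_box {1..d} (p ^ Suc e)"
    show "(case (\<lambda>i. K i mod p, \<lambda>i. K i div p) of (K0, K1) \<Rightarrow> \<lambda>i. K0 i + p * K1 i) = K" by simp
    show "(\<lambda>i. K i mod p, \<lambda>i. K i div p) \<in> ?B \<times> ?C"
      using K p(2) by (auto simp: multi_idx_def less_mult_imp_div_less mult.commute)
  qed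
  finally have sum: "(\<Sum>K0\<in>?B. c K0 ^ p * mon K0) = 0" using Suc.prems(1) by simp
  have c0: "c K0 = 0" if "K0 \<in> ?B" for K0
  proof -
    have bound: "deg_idx K \<le> d * p" if "K \<in> ?B" for K
    proof -
      have "deg_idx K \<le> of_nat (card {1..d}) * p"
        by (rule sum_bounded_above) (use that in \<open>simp add: less_imp_le\<close>)
      then show ?thesis by simp
    qed
    have "c K0 ^ p = 0"
    proof (rule pd_independent[where c = "\<lambda>K. c K ^ p" and n = "d * p", OF pd_frob sum of_nat_nonzero that])
      fix K assume "K \<in> ?B" "d * p < deg_idx K"
      then show "c K ^ p = 0" using bound[of K] by linarith
    qed
    then show ?thesis by simp
  qed
  let ?K0 = "\<lambda>i. K i mod p" and ?K1 = "\<lambda>i. K i div p"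
  have K0: "?K0 \<in> ?B" and K1: "?K1 \<in> ?C"
    using Suc.prems(2) p(2) by (auto simp: multi_idx_def less_mult_imp_div_less mult.commute)
  have "r (\<lambda>i. ?K0 i + p * ?K1 i) = 0"
    by (rule Suc.IH[OF c0[OF K0, unfolded c_def] K1])
  then show ?case by simp
qed

text \<open>The ring acts on itself through \<open>q\<close>-th powers of the scalars, additivity
  being the Frobenius identity. In this form spans and \<open>nakayama\<close> apply to it.\<close>

lemma module_frob: "module (\<lambda>r z. r ^ (p ^ e) * (z :: 'r))"
  by unfold_locales (simp_all add: frob_add power_mult_distrib algebra_simps)

lemma mono_pow_mod_div:
  fixes y :: "'i \<Rightarrow> 'r"
  shows "mono_pow y I L = mono_pow y I (\<lambda>i. L i div q) ^ q * mono_pow y I (\<lambda>i. L i mod q)"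
proof -
  have "mono_pow y I L = mono_pow y I (\<lambda>i. q * (L i div q) + L i mod q)" by simp
  then show ?thesis unfolding mono_pow_add mono_pow_power .
qed

lemma mono_pow_in_frob_span:
  fixes y :: "'i \<Rightarrow> 'r"
  assumes "L \<in> multi_idx I"
  shows "mono_pow y I L \<in> module.span (\<lambda>r z. r ^ (p ^ e) * z) (mono_pow y I ` idx_box I (p ^ e))"
proof -
  interpret Fr: module "\<lambda>r z. r ^ (p ^ e) * (z :: 'r)" by (rule module_frob)
  have "(\<lambda>i. L i mod p ^ e) \<in> idx_box I (p ^ e)" using assms q_pos by (simp add: multi_idx_def)
  then show ?thesis unfolding mono_pow_mod_div[of y I L "p ^ e"] by (intro Fr.span_scale Fr.span_base imageI)
qed

text \<open>Constants are \<open>q\<close>-th powers because \<open>k\<close> is perfect; hence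
  Frobenius spans are closed under constants.\<close>

lemma smul_eq_frob: "\<exists>b. smul c z = (smul b 1) ^ (p ^ e) * z"
proof -
  obtain b where "b ^ (p ^ e) = c" using nth_root_exists[OF q_pos] by blast
  moreover have "(smul b 1) ^ n = smul (b ^ n) 1" for n by (induction n) (simp_all add: smul_mult)
  ultimately show ?thesis using smul_eq_mult by metis
qed

lemma ring_eq_frob_span_generators:
  "r \<in> module.span (\<lambda>r z. r ^ (p ^ e) * z) (mono_pow (\<lambda>s. s) S ` idx_box S (p ^ e))"
proof -
  let ?Q = "p ^ e"
  interpret Fr: module "\<lambda>r z. r ^ ?Q * (z :: 'r)" by (rule module_frob)
  let ?V = "Fr.span (mono_pow (\<lambda>s. s) S ` idx_box S ?Q)"
  note mon = mono_pow_in_frob_span[of _ S "\<lambda>s. s" e]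
  have mult: "y * z \<in> ?V" if "y \<in> ?V" "z \<in> ?V" for y z
    using that(1)
  proof (induction rule: Fr.span_induct_alt)
    case base
    show ?case by (simp add: Fr.span_zero)
  next
    case (step c u w)
    then obtain K where K: "K \<in> idx_box S ?Q" "u = mono_pow (\<lambda>s. s) S K" by blast
    have "u * z \<in> ?V" using that(2)
    proof (induction rule: Fr.span_induct_alt)
      case base
      show ?case by (simp add: Fr.span_zero)
    next
      case (step a v z)
      then obtain L where L: "L \<in> idx_box S ?Q" "v = mono_pow (\<lambda>s. s) S L" by blast
      have "(\<lambda>i. K i + L i) \<in> multi_idx S" using K(1) L(1) by (simp add: multi_idx_add)
      from mon[OF this] have "u * v \<in> ?V" by (simp only: K(2) L(2) mono_pow_add)
      then have "a ^ ?Q * (u * v) + u * z \<in> ?V" by (rule Fr.span_add[OF Fr.span_scale step.IH])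
      then show ?case by (simp add: algebra_simps)
    qed
    then have "c ^ ?Q * (u * z) + w * z \<in> ?V" by (rule Fr.span_add[OF Fr.span_scale step.IH])
    then show ?case by (simp add: algebra_simps)
  qed
  have "is_subalgebra smul ?V"
    unfolding is_subalgebra_def subspace_def
  proof (intro conjI ballI allI)
    show "0 \<in> ?V" by (rule Fr.span_zero)
    have "(\<lambda>_. 0) \<in> multi_idx S" by (simp add: multi_idx_def)
    from mon[OF this] show "1 \<in> ?V" by (simp only: mono_pow_zero)
    show "y + z \<in> ?V" if "y \<in> ?V" "z \<in> ?V" for y z using that by (rule Fr.span_add)
    show "smul c y \<in> ?V" if "y \<in> ?V" for c y
    proof -
      obtain b where "smul c y = (smul b 1) ^ ?Q * y" using smul_eq_frob by blast
      then show ?thesis using Fr.span_scale[OF that, of "smul b 1"] by simp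
    qed
    show "y * z \<in> ?V" if "y \<in> ?V" "z \<in> ?V" for y z using that by (rule mult)
  qed
  moreover have "S \<subseteq> ?V"
  proof
    fix s assume s: "s \<in> S"
    then have "(\<lambda>t. if t = s then 1 else 0) \<in> multi_idx S" by (auto simp: multi_idx_def)
    from mon[OF this] show "s \<in> ?V" using s finite_S by (simp only: mono_pow_single power_one_right)
  qed
  ultimately have AV: "A \<subseteq> ?V" unfolding A_def by (intro sub_alg_minimal)
  obtain a s where as: "a \<in> A" "s \<in> A - M" "s * r = a" using denominator by blast
  obtain u where u: "1 = s * u" using denominator_unit[OF as(2)] by (elim dvdE)
  \<comment> \<open>The denominator is made a \<open>?Q\<close>-th power by expanding
    \<open>a / s\<close> with \<open>s ^ (?Q - 1)\<close>.\<close>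
  have "s ^ (?Q - 1) * a \<in> A" using as A_closed(4,9) by simp
  then have "u ^ ?Q * (s ^ (?Q - 1) * a) \<in> ?V" using AV by (intro Fr.span_scale) blast
  also have "u ^ ?Q * (s ^ (?Q - 1) * a) = u ^ ?Q * (s ^ (?Q - 1) * s) * r" by (simp add: as(3)[symmetric] mult_ac)
  also have "s ^ (?Q - 1) * s = s ^ ?Q" using q_pos[of e] by (metis power_minus_mult)
  also have "u ^ ?Q * s ^ ?Q = 1" using u by (simp add: power_mult_distrib[symmetric] mult.commute)
  finally show ?thesis by simp
qed

text \<open>By the pigeonhole principle a monomial of degree \<open>d * q\<close> has some exponent
  that is at least \<open>q\<close>.\<close>

lemma deep_power_in_frobenius_ideal:
  assumes "r \<in> mpow (d * q)"
  shows "\<exists>c. r = (\<Sum>i\<in>{1..d}. c i * x i ^ q)"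
proof -
  interpret Rmod: module "(*) :: 'r \<Rightarrow> 'r \<Rightarrow> 'r" by (rule self_module)
  have "mon ` {L \<in> MI. deg_idx L = d * q} \<subseteq> Rmod.span ((\<lambda>i. x i ^ q) ` {1..d})"
  proof
    fix z assume "z \<in> mon ` {L \<in> MI. deg_idx L = d * q}"
    then obtain L where L: "L \<in> MI" "deg_idx L = d * q" "z = mon L" by blast
    have "\<exists>i\<in>{1..d}. q \<le> L i"
    proof (rule ccontr)
      assume "\<not> ?thesis"
      then have "deg_idx L < (\<Sum>i\<in>{1..d}. q)" using d by (intro sum_strict_mono) (auto simp: not_le)
      then show False using L(2) by simp
    qed
    then obtain i where i: "i \<in> {1..d}" "q \<le> L i" by blast
    have "mon L = x i ^ (q + (L i - q)) * mono_pow x ({1..d} - {i}) L"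
      using i by (simp add: mono_pow_remove)
    then have "mon L = (x i ^ (L i - q) * mono_pow x ({1..d} - {i}) L) * x i ^ q"
      by (simp only: power_add mult_ac)
    then show "z \<in> Rmod.span ((\<lambda>i. x i ^ q) ` {1..d})"
      unfolding L(3) using i(1) by (simp only:) (intro Rmod.span_scale Rmod.span_base imageI)
  qed
  then have "Rmod.span (mon ` {L \<in> MI. deg_idx L = d * q}) \<subseteq> Rmod.span ((\<lambda>i. x i ^ q) ` {1..d})"
    by (rule Rmod.span_minimal[OF _ Rmod.subspace_span])
  then have "r \<in> Rmod.span ((\<lambda>i. x i ^ q) ` {1..d})" using assms mpow_subset_ideal_gen by blast
  from Rmod.span_image_sum[OF _ this] show ?thesis by simp
qed

text \<open>Each generator is a polynomial in the \<open>x i\<close> up to multiples of the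
  \<open>x i ^ ?Q\<close>. For the twisted action these powers are the scalars \<open>x i\<close> of
  the maximal ideal, so Nakayama's lemma applies to the generators found before.\<close>

lemma ring_eq_frob_span:
  "module.span (\<lambda>r z. r ^ (p ^ e) * z) (mon ` idx_box {1..d} (p ^ e)) = UNIV"
proof -
  let ?Q = "p ^ e"
  interpret Fr: module "\<lambda>r z. r ^ ?Q * (z :: 'r)" by (rule module_frob)
  let ?V = "Fr.span (mon ` idx_box {1..d} ?Q)"
  let ?G = "mono_pow (\<lambda>s. s) S ` idx_box S ?Q"
  have fin: "finite ?G" using finite_idx_box finite_S by blast
  have gen: "r \<in> Fr.span ?G" for r by (rule ring_eq_frob_span_generators)
  have poly: "span (mon ` MI) \<subseteq> ?V"
  proof (rule span_minimal)
    show "mon ` MI \<subseteq> ?V" using mono_pow_in_frob_span[of _ "{1..d}" x e] by blast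
    show "subspace ?V"
      unfolding subspace_def
    proof (intro conjI ballI allI Fr.span_zero Fr.span_add)
      fix c y assume y: "y \<in> ?V"
      obtain b where "smul c y = (smul b 1) ^ ?Q * y" using smul_eq_frob by blast
      then show "smul c y \<in> ?V" using Fr.span_scale[OF y, of "smul b 1"] by simp
    qed
  qed
  have "?G \<subseteq> ?V"
  proof (rule Fr.nakayama[OF fin Fr.subspace_span, of max_ideal])
    fix y z r :: 'r
    show "y \<in> max_ideal \<Longrightarrow> z \<in> max_ideal \<Longrightarrow> y + z \<in> max_ideal" "z \<in> max_ideal \<Longrightarrow> r * z \<in> max_ideal"
      "z \<in> max_ideal \<Longrightarrow> \<exists>u. u * (1 - z) = 1"
      by (fact max_ideal_closed one_minus_max_ideal)+
  next
    fix g
    obtain w where w: "w \<in> span (mon ` MI)" "g - w \<in> mpow (d * ?Q)" using polynomial_approximation by blast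
    obtain r where r: "g - w = (\<Sum>i\<in>{1..d}. r i * x i ^ ?Q)" using deep_power_in_frobenius_ideal[OF w(2)] by blast
    have "\<exists>c. r i = (\<Sum>g'\<in>?G. c g' ^ ?Q * g')" for i
      using Fr.span_image_sum[of ?G "r i" "\<lambda>g. g"] fin gen[of "r i"] by simp
    then have "\<forall>i. \<exists>c. r i = (\<Sum>g'\<in>?G. c g' ^ ?Q * g')" by (rule allI)
    from choice[OF this] obtain C where C: "\<And>i. r i = (\<Sum>g'\<in>?G. C i g' ^ ?Q * g')" by (elim exE) simp
    have "(\<Sum>i\<in>{1..d}. r i * x i ^ ?Q) = (\<Sum>i\<in>{1..d}. \<Sum>g'\<in>?G. (x i * C i g') ^ ?Q * g')"
      unfolding C sum_distrib_right by (simp add: power_mult_distrib mult_ac)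
    also have "\<dots> = (\<Sum>g'\<in>?G. (\<Sum>i\<in>{1..d}. x i * C i g') ^ ?Q * g')"
      unfolding frob_sum sum_distrib_right by (rule sum.swap)
    finally have "g = w + (\<Sum>g'\<in>?G. (\<Sum>i\<in>{1..d}. x i * C i g') ^ ?Q * g')" using r by (simp add: algebra_simps)
    moreover have "(\<Sum>i\<in>{1..d}. x i * C i g') \<in> max_ideal" for g'
      by (intro max_ideal_closed(6) max_ideal_closed(4) x_in)
    moreover have "w \<in> ?V" using w(1) poly by blast
    ultimately show "\<exists>w\<in>?V. \<exists>c. (\<forall>g'\<in>?G. c g' \<in> max_ideal) \<and> g = w + (\<Sum>g'\<in>?G. c g' ^ ?Q * g')"
      by (intro bexI[of _ w] exI[of _ "\<lambda>g'. \<Sum>i\<in>{1..d}. x i * C i g'"]) auto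
  qed
  then have "Fr.span ?G \<subseteq> ?V" by (rule Fr.span_minimal[OF _ Fr.subspace_span])
  then show ?thesis using gen by blast
qed

context
  fixes e :: nat
begin

definition frob_coeff :: "'r \<Rightarrow> (nat \<Rightarrow> nat) \<Rightarrow> 'r" where
  "frob_coeff f = (SOME c. f = (\<Sum>K\<in>idx_box {1..d} (p ^ e). c K ^ (p ^ e) * mon K))"

lemma frob_coeff: "f = (\<Sum>K\<in>idx_box {1..d} (p ^ e). frob_coeff f K ^ (p ^ e) * mon K)"
proof -
  interpret Fr: module "\<lambda>r z. r ^ (p ^ e) * (z :: 'r)" by (rule module_frob)
  have "f \<in> Fr.span (mon ` idx_box {1..d} (p ^ e))" unfolding ring_eq_frob_span by simp
  from Fr.span_image_sum[OF finite_idx_box this]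
  have "\<exists>c. f = (\<Sum>K\<in>idx_box {1..d} (p ^ e). c K ^ (p ^ e) * mon K)" by simp
  then show ?thesis unfolding frob_coeff_def by (rule someI_ex)
qed

lemma frob_coeff_unique:
  assumes "f = (\<Sum>K\<in>idx_box {1..d} (p ^ e). c K ^ (p ^ e) * mon K)" "K \<in> idx_box {1..d} (p ^ e)"
  shows "frob_coeff f K = c K"
proof -
  have "(\<Sum>K\<in>idx_box {1..d} (p ^ e). (frob_coeff f K - c K) ^ (p ^ e) * mon K) = f - f"
    unfolding frob_diff left_diff_distrib sum_subtractf frob_coeff[symmetric] assms(1)[symmetric] ..
  then have "frob_coeff f K - c K = 0" by (intro frob_independent[where r = "\<lambda>K. frob_coeff f K - c K", OF _ assms(2)]) simp
  then show ?thesis by simp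
qed

text \<open>The map that is linear over the \<open>p ^ e\<close>-th powers and has the values
  \<open>m\<close> on the monomial basis.\<close>

definition frob_op :: "((nat \<Rightarrow> nat) \<Rightarrow> 'r) \<Rightarrow> 'r \<Rightarrow> 'r" where
  "frob_op m f = (\<Sum>K\<in>idx_box {1..d} (p ^ e). frob_coeff f K ^ (p ^ e) * m K)"

lemma frob_op_add: "frob_op m (f + g) = frob_op m f + frob_op m g"
proof -
  have "f + g = (\<Sum>K\<in>idx_box {1..d} (p ^ e). (frob_coeff f K + frob_coeff g K) ^ (p ^ e) * mon K)"
    unfolding frob_add distrib_right sum.distrib frob_coeff[symmetric] ..
  from frob_coeff_unique[OF this] show ?thesis
    unfolding frob_op_def sum.distrib[symmetric] by (intro sum.cong) (auto simp: frob_add distrib_right)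
qed

lemma frob_op_scale: "frob_op m (r ^ (p ^ e) * f) = r ^ (p ^ e) * frob_op m f"
proof -
  have "r ^ (p ^ e) * f = (\<Sum>K\<in>idx_box {1..d} (p ^ e). (r * frob_coeff f K) ^ (p ^ e) * mon K)"
    unfolding power_mult_distrib mult.assoc sum_distrib_left[symmetric] frob_coeff[symmetric] ..
  from frob_coeff_unique[OF this] show ?thesis
    unfolding frob_op_def sum_distrib_left by (intro sum.cong) (auto simp: power_mult_distrib mult.assoc)
qed

lemma frob_op_mon:
  assumes "K \<in> idx_box {1..d} (p ^ e)"
  shows "frob_op m (mon K) = m K"
proof -
  have fin: "finite (idx_box {1..d} (p ^ e))" by (rule finite_idx_box) simp
  have delta: "(\<Sum>L\<in>idx_box {1..d} (p ^ e). (if L = K then 1 else 0) ^ (p ^ e) * u L) = u K" for u :: "(nat \<Rightarrow> nat) \<Rightarrow> 'r"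
  proof -
    have "(\<Sum>L\<in>idx_box {1..d} (p ^ e). (if L = K then 1 else 0) ^ (p ^ e) * u L)
      = (\<Sum>L\<in>idx_box {1..d} (p ^ e). if L = K then u L else 0)"
      by (intro sum.cong) (use q_pos in \<open>auto simp: power_0_left\<close>)
    then show ?thesis using fin assms by (subst (asm) sum.delta) auto
  qed
  have "frob_op m (mon K) = (\<Sum>L\<in>idx_box {1..d} (p ^ e). (if L = K then 1 else 0) ^ (p ^ e) * m L)"
    unfolding frob_op_def
    by (intro sum.cong refl) (simp only: frob_coeff_unique[OF delta[of mon, symmetric]])
  then show ?thesis using delta by simp
qed

lemma frob_op_linear: "Vector_Spaces.linear smul smul (frob_op m)"
proof (rule linearI)
  show "frob_op m (smul c f) = smul c (frob_op m f)" for c f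
  proof -
    obtain b where b: "b ^ (p ^ e) = c" using nth_root_exists[OF q_pos] by blast
    have "(smul b 1) ^ n = smul (b ^ n) 1" for n by (induction n) (simp_all add: smul_mult)
    then have "smul c z = (smul b 1) ^ (p ^ e) * z" for z using b smul_eq_mult[of c z] by simp
    then show ?thesis by (simp add: frob_op_scale)
  qed
qed (rule frob_op_add)

end

end

definition hasse_on :: "nat \<Rightarrow> nat \<Rightarrow> ('r \<Rightarrow> 'r) \<Rightarrow> bool" where
  "hasse_on i n D \<longleftrightarrow> (\<forall>L\<in>MI. D (mon L) = of_nat (L i choose n) * mon (L(i := L i - n)))"

lemma mon_shift:
  assumes "i \<in> {1..d}"
  shows "x i ^ m * mon (L(i := n)) = mon (L(i := m + n))"
  using assms by (simp add: mono_pow_upd power_add mult.assoc)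

text \<open>For \<open>n < p ^ e\<close> binomial coefficients of order \<open>n\<close> are
  periodic modulo \<open>p ^ e\<close>, so a Frobenius linear map can have the required values. Its
  order is found by induction: the commutator with \<open>x i\<close> is the operator for
  \<open>n - 1\<close>, and those with the other variables and with \<open>p ^ e\<close>-th powers
  vanish.\<close>

lemma hasse_operator_char_p:
  assumes p: "p = CHAR('r)" "p > 0" and i: "i \<in> {1..d}" and nQ: "n < p ^ e"
  shows "\<exists>D. diff_op smul n D \<and> (\<forall>L\<in>MI. D (mon L) = of_nat (L i choose n) * mon (L(i := L i - n)))"
proof -
  let ?Q = "p ^ e"
  note lin = frob_op_linear[OF p, where e = e] and scale = frob_op_scale[OF p, where e = e]
  interpret Fr: module "\<lambda>r z. r ^ ?Q * (z :: 'r)" by (rule module_frob[OF p])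
  have Q: "frobenius_power TYPE('r) ?Q"
    unfolding p(1) by (rule frobenius_power_char) (rule prime_p[OF p])
  define D where "D n = frob_op p e (\<lambda>K. of_nat (K i choose n) * mon (K(i := K i - n)))" for n
  note linD = linearD[OF lin]
  have Dadd: "D n (a + b) = D n a + D n b" and Dscale: "D n (r ^ ?Q * a) = r ^ ?Q * D n a" and D0: "D n 0 = 0" for n a b r
    unfolding D_def by (simp_all only: linD scale)
  \<comment> \<open>If \<open>n\<close> exceeds \<open>L i mod ?Q\<close>, the binomial coefficient
    vanishes, so the truncated difference of exponents does no harm.\<close>
  have Dmon: "D n (mon L) = of_nat (L i choose n) * mon (L(i := L i - n))" if n: "n < ?Q" and L: "L \<in> MI" for n L
  proof -
    let ?K = "\<lambda>j. L j mod ?Q"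
    have K: "?K \<in> idx_box {1..d} ?Q" using L q_pos[OF p] by (simp add: multi_idx_def)
    have "D n (mon L) = mon (\<lambda>j. L j div ?Q) ^ ?Q * D n (mon ?K)"
      unfolding D_def scale[symmetric] mono_pow_mod_div[OF p, of x "{1..d}" L ?Q, symmetric] ..
    also have "D n (mon ?K) = of_nat (?K i choose n) * mon (?K(i := ?K i - n))"
      unfolding D_def by (rule frob_op_mon[OF p K])
    also have "(of_nat (?K i choose n) :: 'r) = of_nat (L i choose n)"
      using frobenius_power_choose_mod[OF Q n, of "?K i" "L i div ?Q"] by simp
    finally have eq: "D n (mon L) = of_nat (L i choose n) * (mon (\<lambda>j. ?Q * (L j div ?Q)) * mon (?K(i := ?K i - n)))"
      by (simp only: mono_pow_power mult_ac)
    show ?thesis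
    proof (cases "n \<le> ?K i")
      case True
      have "?Q * (L i div ?Q) + (?K i - n) = L i - n" using True by (metis Nat.add_diff_assoc mult_div_mod_eq)
      then have "(\<lambda>j. ?Q * (L j div ?Q) + (?K(i := ?K i - n)) j) = L(i := L i - n)" by (auto simp: fun_eq_iff)
      then show ?thesis unfolding eq mono_pow_add[symmetric] by simp
    next
      case False
      then have "(of_nat (L i choose n) :: 'r) = 0"
        using frobenius_power_choose_mod[OF Q n, of "?K i" "L i div ?Q"] by (simp add: binomial_eq_0)
      then show ?thesis unfolding eq by simp
    qed
  qed
  have ext: "E g = 0" if E: "\<And>a b. E (a + b) = E a + E b" "\<And>r a. E (r ^ ?Q * a) = r ^ ?Q * E a"
    and mon0: "\<And>L. L \<in> MI \<Longrightarrow> E (mon L) = 0" for E :: "'r \<Rightarrow> 'r" and g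
  proof -
    have "g \<in> Fr.span (mon ` idx_box {1..d} ?Q)" unfolding ring_eq_frob_span[OF p] by simp
    then show ?thesis
    proof (induction rule: Fr.span_induct_alt)
      case base
      have "E 0 + E 0 = E 0 + 0" using E(1)[of 0 0] by (simp only: add_0_right)
      then show ?case by (simp only: add_left_cancel)
    next
      case (step c y z)
      then obtain K where K: "K \<in> MI" "y = mon K" by blast
      show ?case unfolding E K(2) mon0[OF K(1)] step.IH by simp
    qed
  qed
  have "diff_op smul n (D n)" if "n < ?Q" for n
    using that
  proof (induction n)
    case 0
    have "D 0 g = g" for g
    proof -
      have "D 0 g = (\<Sum>K\<in>idx_box {1..d} ?Q. frob_coeff p e g K ^ ?Q * mon K)"
        unfolding D_def frob_op_def[OF p] by (intro sum.cong refl) simp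
      also have "\<dots> = g" by (rule frob_coeff[OF p, symmetric])
      finally show ?thesis .
    qed
    then have "D 0 = (\<lambda>g. g)" by (simp add: fun_eq_iff)
    then show ?case by (auto intro!: linearI)
  next
    case (Suc n)
    let ?C = "\<lambda>f g. D (Suc n) (f * g) - f * D (Suc n) g"
    \<comment> \<open>Pascal's rule; by \<open>ext\<close> it is enough to compare both sides on
      monomials.\<close>
    have Cx: "?C (x j) g = (if j = i then D n g else 0)" if j: "j \<in> {1..d}" for j g
    proof -
      have "?C (x j) g - (if j = i then D n g else 0) = 0"
      proof (rule ext[where E = "\<lambda>g. ?C (x j) g - (if j = i then D n g else 0)"])
        fix a b r
        show "?C (x j) (a + b) - (if j = i then D n (a + b) else 0) =
          (?C (x j) a - (if j = i then D n a else 0)) + (?C (x j) b - (if j = i then D n b else 0))"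
          unfolding distrib_left Dadd by (simp add: algebra_simps)
        have h: "D (Suc n) (x j * (r ^ ?Q * a)) = r ^ ?Q * D (Suc n) (x j * a)"
          unfolding mult.left_commute[of "x j"] by (rule Dscale)
        show "?C (x j) (r ^ ?Q * a) - (if j = i then D n (r ^ ?Q * a) else 0) =
          r ^ ?Q * (?C (x j) a - (if j = i then D n a else 0))"
          unfolding h Dscale by (simp add: algebra_simps)
      next
        fix L assume L: "L \<in> MI"
        have xL: "x j * mon L = mon (L(j := Suc (L j)))"
          using mon_shift[OF j, of 1 L "L j"] by simp
        have L': "L(j := Suc (L j)) \<in> MI" using L j by (rule multi_idx_upd)
        show "?C (x j) (mon L) - (if j = i then D n (mon L) else 0) = 0"
        proof (cases "j = i")
          case False
          have "mon (L(j := Suc (L j), i := L i - Suc n)) = x j * mon (L(i := L i - Suc n))"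
            using mon_shift[OF j, of 1 "L(i := L i - Suc n)" "L j"] False by (simp add: fun_upd_twist fun_upd_idem)
          then show ?thesis unfolding xL Dmon[OF Suc.prems L] Dmon[OF Suc.prems L'] using False
            by (simp add: mult_ac)
        next
          case True
          have nQ: "n < ?Q" using Suc.prems by simp
          have "of_nat (L i choose Suc n) * (x i * mon (L(i := L i - Suc n))) = of_nat (L i choose Suc n) * mon (L(i := L i - n))"
          proof (cases "Suc n \<le> L i")
            case True
            then have "1 + (L i - Suc n) = L i - n" by simp
            then show ?thesis using mon_shift[OF i, of 1 L "L i - Suc n"] by simp
          qed (simp add: binomial_eq_0)
          then have eq: "x i * (of_nat (L i choose Suc n) * mon (L(i := L i - Suc n))) = of_nat (L i choose Suc n) * mon (L(i := L i - n))"
            by (simp only: mult.left_commute)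
          show ?thesis unfolding xL Dmon[OF Suc.prems L] Dmon[OF Suc.prems L'] Dmon[OF nQ L] unfolding True eq
            by (simp add: distrib_right)
        qed
      qed
      then show ?thesis by simp
    qed
    have gen: "diff_op smul n (?C (x j))" if "j \<in> {1..d}" for j
      unfolding Cx[OF that] using Suc by (cases "j = i") (simp_all add: diff_op_zero)
    have one: "diff_op smul n (?C 1)" using diff_op_zero by simp
    have pow: "diff_op smul n (?C (x j ^ m))" if "j \<in> {1..d}" for j m
    proof (induction m)
      case 0
      then show ?case using one by simp
    next
      case (Suc m)
      then show ?case using diff_op_commutator_mult[OF gen[OF that] Suc] by simp
    qed
    have monC: "diff_op smul n (?C (mon L))" for L
    proof -
      have "diff_op smul n (?C (\<Prod>j\<in>J. x j ^ L j))" if "J \<subseteq> {1..d}" for J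
        using finite_subset[OF that finite_atLeastAtMost] that
      proof (induction J rule: finite_induct)
        case empty
        then show ?case using one by simp
      next
        case (insert j J)
        then show ?case using diff_op_commutator_mult[OF pow[of j "L j"] insert.IH] by simp
      qed
      then show ?thesis unfolding mono_pow_def by blast
    qed
    have "diff_op smul n (?C f)" for f
    proof -
      have "f \<in> Fr.span (mon ` idx_box {1..d} ?Q)" unfolding ring_eq_frob_span[OF p] by simp
      then show ?thesis
      proof (induction rule: Fr.span_induct_alt)
        case base
        show ?case using diff_op_zero by (simp add: D0)
      next
        case (step c y z)
        have "?C (c ^ ?Q) = (\<lambda>_. 0)" by (simp add: Dscale fun_eq_iff)
        then have "diff_op smul n (?C (c ^ ?Q))" using diff_op_zero by simp
        moreover have "diff_op smul n (?C y)" using step.hyps monC by blast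
        ultimately have "diff_op smul n (?C (c ^ ?Q * y))" by (rule diff_op_commutator_mult)
        from diff_op_add[OF this step.IH]
        show ?case unfolding distrib_right Dadd by (simp only: add_diff_add)
      qed
    qed
    moreover have "Vector_Spaces.linear smul smul (D (Suc n))" unfolding D_def by (rule lin)
    ultimately show ?case by simp
  qed
  with Dmon nQ show ?thesis by blast
qed

theorem hasse_operators_exist:
  "\<exists>D. \<forall>i\<in>{1..d}. \<forall>n. diff_op smul n (D i n) \<and>
     (\<forall>L\<in>MI. D i n (mon L) = of_nat (L i choose n) * mon (L(i := L i - n)))"
proof -
  have "\<exists>D. diff_op smul n D \<and> (\<forall>L\<in>MI. D (mon L) = of_nat (L i choose n) * mon (L(i := L i - n)))"
    if i: "i \<in> {1..d}" for i n
  proof (cases "CHAR('r) = 0")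
    case True
    then show ?thesis using hasse_operator_char_0[OF _ i] CHAR_eq by simp
  next
    case False
    then have "CHAR('r) > 0" by simp
    from prime_p[OF refl this] have "CHAR('r) > 1" by (rule prime_gt_1_nat)
    then have "n < CHAR('r) ^ n" by (intro power_gt_expt) simp
    from hasse_operator_char_p[OF refl \<open>CHAR('r) > 0\<close> i this] show ?thesis .
  qed
  then have "\<forall>i. \<exists>D. i \<in> {1..d} \<longrightarrow> (\<forall>n. diff_op smul n (D n) \<and>
     (\<forall>L\<in>MI. D n (mon L) = of_nat (L i choose n) * mon (L(i := L i - n))))" by metis
  then show ?thesis by metis
qed

end

section \<open>Coefficients modulo powers of the maximal ideal\<close>

text \<open>The powers of the maximal ideal with integer exponents, so that no subtraction truncates.\<close>

definition ipow :: "int \<Rightarrow> 'a::local_ring set" where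
  "ipow n = mpow (nat n)"

lemma ipow_closed:
  fixes y z :: "'a::local_ring"
  shows "0 \<in> (ipow n :: 'a set)" "y \<in> ipow n \<Longrightarrow> z \<in> ipow n \<Longrightarrow> y + z \<in> ipow n"
    "y \<in> ipow n \<Longrightarrow> z \<in> ipow n \<Longrightarrow> y - z \<in> ipow n" "y \<in> ipow n \<Longrightarrow> r * y \<in> ipow n" "y \<in> ipow n \<Longrightarrow> - y \<in> ipow n"
    "(\<And>i. i \<in> I \<Longrightarrow> f i \<in> ipow n) \<Longrightarrow> sum f I \<in> (ipow n :: 'a set)"
  unfolding ipow_def by (simp_all only: mpow_simps mpow_sum)

lemma ipow_antimono: "m \<le> n \<Longrightarrow> y \<in> ipow n \<Longrightarrow> y \<in> ipow m"
  unfolding ipow_def by (rule mpow_antimono[of "nat m" "nat n"]) simp_all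

lemma ipow_mult: "y \<in> ipow m \<Longrightarrow> z \<in> ipow n \<Longrightarrow> y * z \<in> ipow (m + n)"
proof -
  assume "y \<in> ipow m" "z \<in> ipow n"
  then have "y * z \<in> mpow (nat m + nat n)" unfolding ipow_def by (rule mpow_mult)
  then show ?thesis unfolding ipow_def by (rule mpow_antimono[rotated]) linarith
qed

lemma ipow_leading: "a - b \<in> ipow (n + 1) \<Longrightarrow> b \<in> ipow n \<Longrightarrow> a \<in> ipow n"
  using ipow_closed(2)[of "a - b" n b] ipow_antimono[of n "n + 1" "a - b"] by simp

lemma ipow_nonpos: "n \<le> 0 \<Longrightarrow> y \<in> ipow n"
  by (simp add: ipow_def)

lemma mpow_power_diff:
  fixes a b :: "'a::local_ring"
  assumes "a - b \<in> mpow (Suc w)" "b \<in> mpow w"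
  shows "a ^ n - b ^ n \<in> mpow (Suc (w * n))"
proof (induction n)
  case 0
  show ?case by (simp only: power_0 diff_self mpow_simps)
next
  case (Suc n)
  have "a = b + (a - b)" by simp
  then have "a \<in> mpow w" using assms mpow_simps(2)[OF assms(2)] mpow_antimono[of w "Suc w"] by (metis le_SucI order_refl)
  then have "a ^ n \<in> mpow (w * n)" by (rule mpow_power)
  from mpow_mult[OF this assms(1)] mpow_mult[OF Suc assms(2)]
  have "a ^ n * (a - b) + (a ^ n - b ^ n) * b \<in> mpow (Suc (w * Suc n))"
    by (intro mpow_simps(2)) (simp_all only: add_Suc add_Suc_right mult_Suc_right add.commute)
  also have "a ^ n * (a - b) + (a ^ n - b ^ n) * b = a ^ Suc n - b ^ Suc n" by (simp add: algebra_simps)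
  finally show ?case .
qed

lemma mpow_mono_pow_diff:
  fixes a b :: "'i \<Rightarrow> 'a::local_ring"
  assumes "finite I" "\<And>i. i \<in> I \<Longrightarrow> a i - b i \<in> mpow (Suc (w i))" "\<And>i. i \<in> I \<Longrightarrow> b i \<in> mpow (w i)"
  shows "mono_pow a I L - mono_pow b I L \<in> mpow (Suc (\<Sum>i\<in>I. w i * L i))"
  using assms
proof (induction I rule: finite_induct)
  case empty
  show ?case by (simp only: mono_pow_def prod.empty diff_self mpow_simps)
next
  case (insert i I)
  have 1: "a i ^ L i - b i ^ L i \<in> mpow (Suc (w i * L i))" using insert.prems by (intro mpow_power_diff) auto
  have 2: "mono_pow a I L - mono_pow b I L \<in> mpow (Suc (\<Sum>i\<in>I. w i * L i))" using insert by auto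
  have 3: "mono_pow b I L \<in> mpow (\<Sum>i\<in>I. w i * L i)" using insert.prems by (intro mono_pow_in_mpow) auto
  have 4: "b i ^ L i \<in> mpow (w i * L i)" using insert.prems by (intro mpow_power) auto
  have 5: "mono_pow a I L \<in> mpow (\<Sum>i\<in>I. w i * L i)"
    using mpow_simps(2)[OF mpow_antimono[OF _ 2] 3] by simp
  have "(a i ^ L i - b i ^ L i) * mono_pow a I L + b i ^ L i * (mono_pow a I L - mono_pow b I L)
    \<in> mpow (Suc (w i * L i + (\<Sum>i\<in>I. w i * L i)))"
    using mpow_mult[OF 1 5] mpow_mult[OF 4 2] by (intro mpow_simps(2)) (simp_all only: add_Suc add_Suc_right)
  also have "(a i ^ L i - b i ^ L i) * mono_pow a I L + b i ^ L i * (mono_pow a I L - mono_pow b I L)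
    = mono_pow a (insert i I) L - mono_pow b (insert i I) L"
    using insert.hyps by (simp add: mono_pow_def algebra_simps)
  finally show ?case using insert.hyps by simp
qed

text \<open>Each summand factors as \<open>b choose c\<close> times a term of the alternating row
  sum for \<open>b - c\<close>, which vanishes unless \<open>b = c\<close>. The bound
  \<open>b \<le> c + m\<close> makes the truncated row complete.\<close>

lemma alternating_binomial_identity:
  assumes "b \<le> c + m"
  shows "(\<Sum>j\<le>m. (-1) ^ j * of_nat ((c + j) choose c) * of_nat (b choose (c + j))) = (if b = c then 1 else 0 :: 'a::comm_ring_1)"
proof (cases "c \<le> b")
  case False
  then show ?thesis by (intro trans[OF sum.neutral]) (auto simp: binomial_eq_0)
next
  case True
  have "(-1) ^ j * of_nat ((c + j) choose c) * of_nat (b choose (c + j))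
    = (of_nat (b choose c) * ((-1) ^ j * of_nat ((b - c) choose j)) :: 'a)" for j
  proof (cases "c + j \<le> b")
    case True
    have "(b choose (c + j)) * ((c + j) choose c) = (b choose c) * ((b - c) choose j)"
      using choose_mult[of c "c + j" b] True by simp
    then have "(of_nat (b choose (c + j)) * of_nat ((c + j) choose c) :: 'a) = of_nat (b choose c) * of_nat ((b - c) choose j)"
      by (metis of_nat_mult)
    then show ?thesis by (simp add: algebra_simps)
  qed (use \<open>c \<le> b\<close> in \<open>simp add: binomial_eq_0\<close>)
  then have "(\<Sum>j\<le>m. (-1) ^ j * of_nat ((c + j) choose c) * of_nat (b choose (c + j)))
    = (of_nat (b choose c) * (\<Sum>j\<le>m. (-1) ^ j * of_nat ((b - c) choose j)) :: 'a)"
    by (simp add: sum_distrib_left)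
  also have "(\<Sum>j\<le>m. (-1) ^ j * of_nat ((b - c) choose j)) = (\<Sum>j\<le>b - c. (-1) ^ j * of_nat ((b - c) choose j) :: 'a)"
    by (rule sum.mono_neutral_right) (use assms in \<open>auto simp: binomial_eq_0\<close>)
  also have "\<dots> = (if b = c then 1 else 0)"
    using choose_alternating_sum[of "b - c", where 'a = 'a] True by (cases "b = c") auto
  finally show ?thesis by simp
qed

text \<open>\<open>hx\<close> condenses the conditions on \<open>h\<close>, \<open>v\<close> and
  \<open>x\<close>: the leading form of \<open>h l\<close> is \<open>x l ^ q l\<close>. The property
  required of \<open>q l\<close> treats characteristic 0, where \<open>q l = 1\<close>, alongside
  positive characteristic.\<close>

locale coefficient_setup = nonsingular_point smul d x S A M
  for smul :: "'k::alg_closed_field \<Rightarrow> 'r::{idom, local_ring} \<Rightarrow> 'r" and d x S A M +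
  fixes N :: nat and h :: "nat \<Rightarrow> 'r" and q :: "nat \<Rightarrow> nat" and \<I> :: "('r \<times> real) set"
  assumes q: "\<And>l. l \<in> {1..N} \<Longrightarrow> frobenius_power TYPE('r) (q l)"
    and hx: "\<And>l. l \<in> {1..N} \<Longrightarrow> h l - x l ^ q l \<in> mpow (Suc (q l))"
    and N_le_d: "N \<le> d"
    and filt: "idealistic_filtration \<I>" and sat: "diff_saturated smul \<I>"
    and h_in: "\<And>l. l \<in> {1..N} \<Longrightarrow> (h l, real (q l)) \<in> \<I>"
begin

lemma q_pos: "l \<in> {1..N} \<Longrightarrow> q l > 0"
  using q by (simp add: frobenius_power_def)

lemma filt_closed:
  "(f, a) \<in> \<I> \<Longrightarrow> (g, a) \<in> \<I> \<Longrightarrow> (f + g, a) \<in> \<I>" "(f, a) \<in> \<I> \<Longrightarrow> (r * f, a) \<in> \<I>" "(0, a) \<in> \<I>"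
  "(f, a) \<in> \<I> \<Longrightarrow> (g, a) \<in> \<I> \<Longrightarrow> (f - g, a) \<in> \<I>"
  "(\<And>i. i \<in> F \<Longrightarrow> (\<phi> i, a) \<in> \<I>) \<Longrightarrow> (sum \<phi> F, a) \<in> \<I>"
  "a \<le> 0 \<Longrightarrow> (f, a) \<in> \<I>" "(f, a) \<in> \<I> \<Longrightarrow> (g, b) \<in> \<I> \<Longrightarrow> (f * g, a + b) \<in> \<I>" "(f, a) \<in> \<I> \<Longrightarrow> b \<le> a \<Longrightarrow> (f, b) \<in> \<I>"
proof -
  have i: "is_ideal (level \<I> a)" for a using filt by (simp add: idealistic_filtration_def)
  note sub = module.subspace_add[OF self_module i, unfolded level_def mem_Collect_eq]
    module.subspace_scale[OF self_module i, unfolded level_def mem_Collect_eq]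
    module.subspace_0[OF self_module i, unfolded level_def mem_Collect_eq]
    module.subspace_diff[OF self_module i, unfolded level_def mem_Collect_eq]
    module.subspace_sum[OF self_module i, unfolded level_def mem_Collect_eq]
  show "(f, a) \<in> \<I> \<Longrightarrow> (g, a) \<in> \<I> \<Longrightarrow> (f + g, a) \<in> \<I>" "(f, a) \<in> \<I> \<Longrightarrow> (r * f, a) \<in> \<I>" "(0, a) \<in> \<I>"
    "(f, a) \<in> \<I> \<Longrightarrow> (g, a) \<in> \<I> \<Longrightarrow> (f - g, a) \<in> \<I>"
    "(\<And>i. i \<in> F \<Longrightarrow> (\<phi> i, a) \<in> \<I>) \<Longrightarrow> (sum \<phi> F, a) \<in> \<I>"
    by (fact sub)+
  show "a \<le> 0 \<Longrightarrow> (f, a) \<in> \<I>" using filt unfolding idealistic_filtration_def level_def by blast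
  show "(f, a) \<in> \<I> \<Longrightarrow> (g, b) \<in> \<I> \<Longrightarrow> (f * g, a + b) \<in> \<I>" "(f, a) \<in> \<I> \<Longrightarrow> b \<le> a \<Longrightarrow> (f, b) \<in> \<I>"
    using filt unfolding idealistic_filtration_def by metis+
qed

definition Dh :: "nat \<Rightarrow> nat \<Rightarrow> 'r \<Rightarrow> 'r" where
  "Dh = (SOME D. \<forall>i\<in>{1..d}. \<forall>n. diff_op smul n (D i n) \<and>
     (\<forall>L\<in>MI. D i n (mon L) = of_nat (L i choose n) * mon (L(i := L i - n))))"

lemma Dh: "\<forall>i\<in>{1..d}. \<forall>n. diff_op smul n (Dh i n) \<and>
     (\<forall>L\<in>MI. Dh i n (mon L) = of_nat (L i choose n) * mon (L(i := L i - n)))"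
  unfolding Dh_def using hasse_operators_exist by (rule someI_ex)

lemma sub_d: "l \<in> {1..N} \<Longrightarrow> l \<in> {1..d}"
  using N_le_d by simp

lemma Dh_props:
  assumes "l \<in> {1..N}"
  shows "diff_op smul n (Dh l n)" "L \<in> MI \<Longrightarrow> Dh l n (mon L) = of_nat (L l choose n) * mon (L(l := L l - n))"
  using Dh sub_d[OF assms] by blast+

lemmas Dh_linear = linearD[OF diff_op_linear[OF Dh_props(1)]]

lemma Dh_filt: "l \<in> {1..N} \<Longrightarrow> (f, a) \<in> \<I> \<Longrightarrow> (Dh l n f, a - real n) \<in> \<I>"
  using sat Dh_props(1) unfolding diff_saturated_def by blast

lemma Dh_ipow: "l \<in> {1..N} \<Longrightarrow> f \<in> ipow m \<Longrightarrow> Dh l n f \<in> ipow (m - int n)"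
proof -
  assume "l \<in> {1..N}" "f \<in> ipow m"
  then have "Dh l n f \<in> mpow (nat m - n)"
    unfolding ipow_def by (intro diff_op_mpow[OF k_algebra_axioms Dh_props(1)])
  also have "nat m - n = nat (m - int n)" by simp
  finally show ?thesis unfolding ipow_def .
qed

section \<open>Weights and the leading forms of products of the \<open>h l\<close>\<close>

definition wt :: "(nat \<Rightarrow> nat) \<Rightarrow> nat" where "wt B = (\<Sum>l=1..N. q l * B l)"

abbreviation "MN \<equiv> multi_idx {1..N}"
abbreviation "hm \<equiv> mono_pow h {1..N}"
abbreviation "xq B \<equiv> mon (\<lambda>i. q i * B i)"

text \<open>The polynomials among the admissible coefficients of the expansion: only the exponents
  of the first \<open>N\<close> variables are bounded.\<close>

definition U0 :: "'r set" where "U0 = span (mon ` {K \<in> MI. \<forall>l\<in>{1..N}. K l < q l})"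

lemma wt_add: "wt (\<lambda>i. B i + C i) = wt B + wt C"
  by (simp add: wt_def distrib_left sum.distrib)

lemma wt_zero: "wt (\<lambda>_. 0) = 0"
  by (simp add: wt_def)

lemma le_wt: "l \<in> {1..N} \<Longrightarrow> B l \<le> wt B"
proof -
  assume l: "l \<in> {1..N}"
  then have "B l \<le> q l * B l" using q_pos[OF l] by (cases "q l") auto
  also have "\<dots> \<le> wt B" unfolding wt_def by (rule member_le_sum) (use l in auto)
  finally show ?thesis .
qed

lemma MN_MI: "B \<in> MN \<Longrightarrow> (\<lambda>i. q i * B i) \<in> MI"
  using N_le_d by (auto simp: multi_idx_def)

lemma deg_xq:
  assumes "B \<in> MN"
  shows "deg_idx (\<lambda>i. q i * B i) = wt B"
  unfolding wt_def by (rule sum.mono_neutral_right) (use assms N_le_d in \<open>auto simp: multi_idx_def\<close>)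

lemma xq_eq:
  assumes "B \<in> MN"
  shows "xq B = mono_pow (\<lambda>l. x l ^ q l) {1..N} B"
proof -
  have "xq B = (\<Prod>i\<in>{1..N}. x i ^ (q i * B i))"
    unfolding mono_pow_def by (rule prod.mono_neutral_right) (use assms N_le_d in \<open>auto simp: multi_idx_def\<close>)
  then show ?thesis by (simp add: mono_pow_def power_mult)
qed

lemma xq_ipow: "B \<in> MN \<Longrightarrow> xq B \<in> ipow (int (wt B))"
  using mon_in_mpow[of "\<lambda>i. q i * B i"] deg_xq[of B] unfolding ipow_def nat_int by simp

lemma x_power_mpow: "l \<in> {1..N} \<Longrightarrow> x l ^ n \<in> mpow n"
  using mpow_power[OF x_mpow[OF sub_d], of l n] by (simp del: ideal_power.simps)

lemma hm_diff_xq: "B \<in> MN \<Longrightarrow> hm B - xq B \<in> ipow (int (wt B) + 1)"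
proof -
  assume B: "B \<in> MN"
  have "hm B - mono_pow (\<lambda>l. x l ^ q l) {1..N} B \<in> mpow (Suc (wt B))"
    unfolding wt_def by (rule mpow_mono_pow_diff) (use hx x_power_mpow in auto)
  moreover have "nat (int (wt B) + 1) = Suc (wt B)" by simp
  ultimately show ?thesis unfolding ipow_def xq_eq[OF B] by (simp only:)
qed

lemma hm_ipow: "B \<in> MN \<Longrightarrow> hm B \<in> ipow (int (wt B))"
  by (rule ipow_leading[OF hm_diff_xq xq_ipow])

lemma h_power_diff: "l \<in> {1..N} \<Longrightarrow> h l ^ j - x l ^ (q l * j) \<in> ipow (int (q l * j) + 1)"
proof -
  assume l: "l \<in> {1..N}"
  have "h l ^ j - (x l ^ q l) ^ j \<in> mpow (Suc (q l * j))" by (rule mpow_power_diff[OF hx[OF l] x_power_mpow[OF l]])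
  moreover have "nat (int (q l * j) + 1) = Suc (q l * j)" by (simp del: of_nat_mult)
  ultimately show ?thesis unfolding ipow_def by (simp only: power_mult)
qed

lemma x_power_ipow: "l \<in> {1..N} \<Longrightarrow> x l ^ n \<in> ipow (int n)"
  unfolding ipow_def nat_int by (rule x_power_mpow)

lemma h_power_ipow: "l \<in> {1..N} \<Longrightarrow> h l ^ j \<in> ipow (int (q l * j))"
  by (rule ipow_leading[OF h_power_diff x_power_ipow])

lemma h_power_filt: "l \<in> {1..N} \<Longrightarrow> (h l ^ j, real (q l * j)) \<in> \<I>"
proof (induction j)
  case (Suc j)
  from filt_closed(7)[OF h_in[OF Suc.prems] Suc.IH[OF Suc.prems]] show ?case by (simp add: algebra_simps)
qed (simp add: filt_closed)

lemma hm_filt: "(hm B, real (wt B)) \<in> \<I>"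
proof -
  have "(\<Prod>l\<in>J. h l ^ B l, real (\<Sum>l\<in>J. q l * B l)) \<in> \<I>" if "J \<subseteq> {1..N}" for J
    using finite_subset[OF that finite_atLeastAtMost] that
  proof (induction J rule: finite_induct)
    case (insert l J)
    then have "l \<in> {1..N}" by auto
    from filt_closed(7)[OF h_power_filt[OF this, of "B l"] insert.IH] insert show ?case by simp
  qed (simp add: filt_closed)
  from this[OF order_refl] show ?thesis unfolding wt_def mono_pow_def .
qed

lemma U0_closed: "\<alpha> \<in> U0 \<Longrightarrow> \<beta> \<in> U0 \<Longrightarrow> \<alpha> + \<beta> \<in> U0" "\<alpha> \<in> U0 \<Longrightarrow> \<beta> \<in> U0 \<Longrightarrow> \<alpha> - \<beta> \<in> U0" "0 \<in> U0"
  "\<alpha> \<in> U0 \<Longrightarrow> smul c \<alpha> \<in> U0" "(\<And>i. i \<in> F \<Longrightarrow> \<phi> i \<in> U0) \<Longrightarrow> sum \<phi> F \<in> U0"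
  unfolding U0_def by (simp_all add: span_add span_diff span_zero span_scale span_sum)

text \<open>Lucas' theorem makes the operators of order \<open>q\<^sub>l b\<close> treat \<open>U0\<close> as constants.\<close>

lemma Dh_U0_xq:
  assumes l: "l \<in> {1..N}" and \<alpha>: "\<alpha> \<in> U0" and B: "B \<in> MN"
  shows "Dh l (q l * b) (\<alpha> * xq B) = of_nat (B l choose b) * (\<alpha> * xq (B(l := B l - b)))"
  using \<alpha> unfolding U0_def
proof (induction rule: span_induct_alt)
  case base
  show ?case by (simp add: Dh_linear[OF l])
next
  case (step c y z)
  then obtain K where K: "K \<in> MI" "\<forall>l\<in>{1..N}. K l < q l" "y = mon K" by blast
  let ?L = "\<lambda>i. K i + q i * B i"
  have L: "?L \<in> MI" using multi_idx_add[OF K(1) MN_MI[OF B]] .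
  have "Dh l (q l * b) (y * xq B) = of_nat (?L l choose (q l * b)) * mon (?L(l := ?L l - q l * b))"
    unfolding K(3) mono_pow_add[symmetric] by (rule Dh_props(2)[OF l L])
  also have "(of_nat (?L l choose (q l * b)) :: 'r) = of_nat (B l choose b)"
    using K(2) l by (intro frobenius_power_lucas[OF q[OF l]]) auto
  also have "of_nat (B l choose b) * mon (?L(l := ?L l - q l * b)) = of_nat (B l choose b) * (y * xq (B(l := B l - b)))"
  proof (cases "b \<le> B l")
    case True
    then have "q l * b \<le> q l * B l" by simp
    then have "?L(l := ?L l - q l * b) = (\<lambda>i. K i + q i * (B(l := B l - b)) i)"
      by (auto simp: fun_eq_iff diff_mult_distrib2)
    then show ?thesis by (simp only: K(3) mono_pow_add)
  qed (simp add: binomial_eq_0)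
  finally have y: "Dh l (q l * b) (y * xq B) = of_nat (B l choose b) * (y * xq (B(l := B l - b)))" .
  have "Dh l (q l * b) ((smul c y + z) * xq B) = smul c (Dh l (q l * b) (y * xq B)) + Dh l (q l * b) (z * xq B)"
    by (simp only: distrib_right smul_mult Dh_linear[OF l])
  also have "\<dots> = of_nat (B l choose b) * ((smul c y + z) * xq (B(l := B l - b)))"
    unfolding y step.IH by (simp only: distrib_right distrib_left smul_mult mult_smul)
  finally show ?case .
qed

lemma zero_MN: "(\<lambda>_. 0) \<in> MN"
  by (simp add: multi_idx_def)

text \<open>A truncated Taylor expansion of \<open>D\<^sub>l\<^sub>,\<^sub>q\<^sub>c\<close> at \<open>h\<^sub>l = 0\<close>: up to higher order it picks out the
  coefficient of \<open>h\<^sub>l\<^sup>c\<close>, and it maps the level \<open>a\<close> of the filtration to the level \<open>a - q\<^sub>l c\<close>.\<close>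

definition E :: "nat \<Rightarrow> nat \<Rightarrow> nat \<Rightarrow> 'r \<Rightarrow> 'r" where
  "E m l c f = (\<Sum>j\<le>m. ((-1) ^ j * of_nat ((c + j) choose c)) * (h l ^ j * Dh l (q l * (c + j)) f))"

lemma E_linear:
  assumes l: "l \<in> {1..N}"
  shows "E m l c (f + g) = E m l c f + E m l c g" "E m l c 0 = 0" "E m l c (f - g) = E m l c f - E m l c g"
    "E m l c (sum \<phi> F) = (\<Sum>i\<in>F. E m l c (\<phi> i))"
proof -
  show add: "E m l c (f + g) = E m l c f + E m l c g" for f g
    unfolding E_def Dh_linear(1)[OF l] distrib_left sum.distrib ..
  show 0: "E m l c 0 = 0" by (simp add: E_def Dh_linear[OF l])
  show "E m l c (f - g) = E m l c f - E m l c g" using add[of "f - g" g] by simp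
  show "E m l c (sum \<phi> F) = (\<Sum>i\<in>F. E m l c (\<phi> i))"
    by (induction F rule: infinite_finite_induct) (simp_all add: 0 add)
qed

lemma E_filt:
  assumes l: "l \<in> {1..N}" and f: "(f, a) \<in> \<I>"
  shows "(E m l c f, a - real (q l * c)) \<in> \<I>"
  unfolding E_def
proof (rule filt_closed(5), rule filt_closed(2))
  fix j
  have "real (q l * j) + (a - real (q l * (c + j))) = a - real (q l * c)" by (simp add: algebra_simps)
  with filt_closed(7)[OF h_power_filt[OF l, of j] Dh_filt[OF l f, of "q l * (c + j)"]]
  show "(h l ^ j * Dh l (q l * (c + j)) f, a - real (q l * c)) \<in> \<I>" by (simp only:)
qed

lemma E_ipow:
  assumes l: "l \<in> {1..N}" and f: "f \<in> ipow k"
  shows "E m l c f \<in> ipow (k - int (q l * c))"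
  unfolding E_def
proof (rule ipow_closed(6), rule ipow_closed(4))
  fix j
  have "int (q l * j) + (k - int (q l * (c + j))) = k - int (q l * c)" by (simp add: algebra_simps)
  with ipow_mult[OF h_power_ipow[OF l, of j] Dh_ipow[OF l f, of "q l * (c + j)"]]
  show "h l ^ j * Dh l (q l * (c + j)) f \<in> ipow (k - int (q l * c))" by (simp only:)
qed

lemma MN_upd: "B \<in> MN \<Longrightarrow> l \<in> {1..N} \<Longrightarrow> B(l := n) \<in> MN"
  by (rule multi_idx_upd)

lemma wt_upd:
  assumes "l \<in> {1..N}"
  shows "int (wt (B(l := n))) = int (wt B) - int (q l * B l) + int (q l * n)"
proof -
  have "(\<Sum>i\<in>{1..N} - {l}. q i * (B(l := n)) i) = (\<Sum>i\<in>{1..N} - {l}. q i * B i)" by (rule sum.cong) auto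
  moreover have "wt C = q l * C l + (\<Sum>i\<in>{1..N} - {l}. q i * C i)" for C
    unfolding wt_def using assms by (intro sum.remove) auto
  ultimately have "wt (B(l := n)) = q l * n + (\<Sum>i\<in>{1..N} - {l}. q i * B i)"
    "wt B = q l * B l + (\<Sum>i\<in>{1..N} - {l}. q i * B i)" by simp_all
  then show ?thesis by linarith
qed

text \<open>\<open>s\<close> bounds the order of \<open>\<alpha> * xq B\<close> from below.
  Replacing \<open>h l ^ j\<close> by \<open>x l ^ (q l * j)\<close> is an error of one order more;
  after that all terms are multiples of the same product, with the coefficient of
  \<open>alternating_binomial_identity\<close>.\<close>

lemma E_U0_xq:
  assumes l: "l \<in> {1..N}" and \<alpha>: "\<alpha> \<in> U0" "\<alpha> \<in> ipow (s - int (wt B))" and B: "B \<in> MN" "B l \<le> c + m"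
  shows "E m l c (\<alpha> * xq B) - (if B l = c then \<alpha> * xq (B(l := 0)) else 0) \<in> ipow (s + 1 - int (q l * c))"
proof -
  let ?k = "\<lambda>j. (-1) ^ j * of_nat ((c + j) choose c) :: 'r"
  let ?z = "\<alpha> * xq (B(l := B l - c))"
  have "E m l c (\<alpha> * xq B) - (\<Sum>j\<le>m. ?k j * of_nat (B l choose (c + j)) * ?z) \<in> ipow (s + 1 - int (q l * c))"
    unfolding E_def Dh_U0_xq[OF l \<alpha>(1) B(1)] sum_subtractf[symmetric]
  proof (rule ipow_closed(6))
    fix j
    show "?k j * (h l ^ j * (of_nat (B l choose (c + j)) * (\<alpha> * xq (B(l := B l - (c + j))))))
      - ?k j * of_nat (B l choose (c + j)) * ?z \<in> ipow (s + 1 - int (q l * c))"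
    proof (cases "c + j \<le> B l")
      case False
      then show ?thesis by (simp add: binomial_eq_0 ipow_closed(1))
    next
      case True
      let ?w = "xq (B(l := B l - (c + j)))"
      have B': "B(l := B l - (c + j)) \<in> MN" by (rule MN_upd[OF B(1) l])
      have xl: "x l ^ (q l * j) * ?w = xq (B(l := B l - c))"
      proof -
        have "q l * j + q l * (B l - (c + j)) = q l * (B l - c)" using True by (simp flip: distrib_left)
        then have "(\<lambda>i. q i * (B(l := B l - c)) i) = (\<lambda>i. (if i = l then q l * j else 0) + q i * (B(l := B l - (c + j))) i)"
          by (auto simp: fun_eq_iff)
        then have "xq (B(l := B l - c)) = mon (\<lambda>i. if i = l then q l * j else 0) * ?w" by (simp only: mono_pow_add)
        then show ?thesis using mono_pow_single[OF _ sub_d[OF l], of x "q l * j"] by simp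
      qed
      have eq: "s + 1 - int (q l * c) = (int (q l * j) + 1) + ((s - int (wt B)) + int (wt (B(l := B l - (c + j)))))"
      proof -
        obtain t where "B l = c + j + t" using True le_Suc_ex by blast
        then show ?thesis unfolding wt_upd[OF l] by (simp add: algebra_simps)
      qed
      have "(h l ^ j - x l ^ (q l * j)) * (\<alpha> * ?w) \<in> ipow (s + 1 - int (q l * c))"
        unfolding eq by (intro ipow_mult h_power_diff l \<alpha>(2) xq_ipow B')
      then have "?k j * of_nat (B l choose (c + j)) * ((h l ^ j - x l ^ (q l * j)) * (\<alpha> * ?w)) \<in> ipow (s + 1 - int (q l * c))"
        by (rule ipow_closed(4))
      also have "?k j * of_nat (B l choose (c + j)) * ((h l ^ j - x l ^ (q l * j)) * (\<alpha> * ?w))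
        = ?k j * (h l ^ j * (of_nat (B l choose (c + j)) * (\<alpha> * ?w))) - ?k j * of_nat (B l choose (c + j)) * (\<alpha> * (x l ^ (q l * j) * ?w))"
        by (simp only: left_diff_distrib right_diff_distrib mult_ac)
      finally show ?thesis unfolding xl .
    qed
  qed
  also have "(\<Sum>j\<le>m. ?k j * of_nat (B l choose (c + j)) * ?z) = (if B l = c then 1 else 0) * ?z"
    unfolding sum_distrib_right[symmetric] alternating_binomial_identity[OF B(2)] ..
  also have "\<dots> = (if B l = c then \<alpha> * xq (B(l := 0)) else 0)" by (cases "B l = c") simp_all
  finally show ?thesis .
qed

text \<open>An equation and not a congruence: the coefficient at exponent zero has no order bound in
  the main induction, so it has to disappear exactly.\<close>

lemma E_U0:
  assumes l: "l \<in> {1..N}" and \<alpha>: "\<alpha> \<in> U0"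
  shows "E m l c \<alpha> = (if c = 0 then \<alpha> else 0)"
proof -
  have D: "Dh l (q l * b) \<alpha> = of_nat (0 choose b) * \<alpha>" for b
    using Dh_U0_xq[OF l \<alpha> zero_MN, of b] by (simp add: mono_pow_zero fun_upd_idem)
  have "E m l c \<alpha> = (\<Sum>j\<le>m. if j = 0 then (if c = 0 then \<alpha> else 0) else 0)"
    unfolding E_def D by (intro sum.cong) (auto simp: binomial_eq_0)
  then show ?thesis by simp
qed

text \<open>One \<open>E\<close> for each variable in turn. For \<open>n = N\<close> this extracts
  the coefficient of \<open>hm C\<close> up to higher order, lowering the level by
  \<open>wt C\<close>.\<close>

primrec Gop :: "nat \<Rightarrow> (nat \<Rightarrow> nat) \<Rightarrow> nat \<Rightarrow> 'r \<Rightarrow> 'r" where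
  "Gop m C 0 f = f"
| "Gop m C (Suc n) f = E m (Suc n) (C (Suc n)) (Gop m C n f)"

lemma Gop_linear:
  "n \<le> N \<Longrightarrow> Gop m C n (f + g) = Gop m C n f + Gop m C n g"
  "n \<le> N \<Longrightarrow> Gop m C n (f - g) = Gop m C n f - Gop m C n g"
  "n \<le> N \<Longrightarrow> Gop m C n (sum \<phi> F) = (\<Sum>i\<in>F. Gop m C n (\<phi> i))"
  by (induction n) (simp_all add: E_linear)

lemma Gop_filt: "n \<le> N \<Longrightarrow> (f, a) \<in> \<I> \<Longrightarrow> (Gop m C n f, a - real (\<Sum>l=1..n. q l * C l)) \<in> \<I>"
proof (induction n)
  case (Suc n)
  then have "(E m (Suc n) (C (Suc n)) (Gop m C n f), a - real (\<Sum>l=1..n. q l * C l) - real (q (Suc n) * C (Suc n))) \<in> \<I>"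
    by (intro E_filt) auto
  then show ?case by (simp add: algebra_simps)
qed simp

lemma Gop_ipow: "n \<le> N \<Longrightarrow> f \<in> ipow k \<Longrightarrow> Gop m C n f \<in> ipow (k - int (\<Sum>l=1..n. q l * C l))"
proof (induction n)
  case (Suc n)
  then have "E m (Suc n) (C (Suc n)) (Gop m C n f) \<in> ipow (k - int (\<Sum>l=1..n. q l * C l) - int (q (Suc n) * C (Suc n)))"
    by (intro E_ipow) auto
  then show ?case by (simp add: algebra_simps)
qed simp

lemma Gop_U0: "n \<le> N \<Longrightarrow> \<alpha> \<in> U0 \<Longrightarrow> Gop m C n \<alpha> = (if \<forall>l\<in>{1..n}. C l = 0 then \<alpha> else 0)"
proof (induction n)
  case (Suc n)
  have *: "(\<forall>l\<in>{1..Suc n}. C l = 0) \<longleftrightarrow> (\<forall>l\<in>{1..n}. C l = 0) \<and> C (Suc n) = 0" by (auto simp: le_Suc_eq)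
  show ?case unfolding * using Suc by (simp add: E_U0 E_linear)
qed simp

text \<open>Each step compares one more exponent of \<open>B\<close> with \<open>C\<close> and
  removes it; the errors made before keep their relative order by \<open>E_ipow\<close>.\<close>

lemma Gop_U0_xq:
  assumes \<alpha>: "\<alpha> \<in> U0" "\<alpha> \<in> ipow (s - int (wt B))" and B: "B \<in> MN" "\<And>l. B l \<le> m"
  shows "n \<le> N \<Longrightarrow> Gop m C n (\<alpha> * xq B) - (if \<forall>l\<in>{1..n}. B l = C l then \<alpha> * xq (\<lambda>l. if l \<in> {1..n} then 0 else B l) else 0)
    \<in> ipow (s + 1 - int (\<Sum>l=1..n. q l * C l))"
proof (induction n)
  case 0
  show ?case by (simp add: ipow_closed(1))
next
  case (Suc n)
  let ?l = "Suc n"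
  let ?W = "\<lambda>n. int (\<Sum>l=1..n. q l * C l)"
  let ?B = "\<lambda>l. if l \<in> {1..n} then 0 else B l"
  let ?T = "if \<forall>l\<in>{1..n}. B l = C l then \<alpha> * xq ?B else 0"
  let ?T' = "if \<forall>l\<in>{1..?l}. B l = C l then \<alpha> * xq (\<lambda>l. if l \<in> {1..?l} then 0 else B l) else 0"
  have l: "?l \<in> {1..N}" using Suc.prems by simp
  have W: "?W ?l = ?W n + int (q ?l * C ?l)" by simp
  have "E m ?l (C ?l) (Gop m C n (\<alpha> * xq B) - ?T) \<in> ipow (s + 1 - ?W n - int (q ?l * C ?l))"
    using Suc by (intro E_ipow l) auto
  then have 1: "Gop m C ?l (\<alpha> * xq B) - E m ?l (C ?l) ?T \<in> ipow (s + 1 - ?W ?l)"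
    unfolding W by (simp add: E_linear[OF l] algebra_simps)
  have 2: "E m ?l (C ?l) ?T - ?T' \<in> ipow (s + 1 - ?W ?l)"
  proof (cases "\<forall>l\<in>{1..n}. B l = C l")
    case False
    then have "?T = 0" by (rule if_not_P)
    moreover have "?T' = 0" by (rule if_not_P) (use False in auto)
    ultimately show ?thesis by (simp only: E_linear(2)[OF l] diff_self ipow_closed(1))
  next
    case True
    have wtB: "int (wt ?B) = int (wt B) - ?W n"
    proof -
      have split: "wt D = (\<Sum>l=1..n. q l * D l) + (\<Sum>l=?l..N. q l * D l)" for D
      proof -
        have "{1..N} = {1..n} \<union> {?l..N}" using Suc.prems by auto
        then show ?thesis unfolding wt_def by (subst sum.union_disjoint[symmetric]) auto
      qed
      have "(\<Sum>l=1..n. q l * ?B l) = 0" by (intro sum.neutral) auto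
      with split[of ?B] have "wt ?B = (\<Sum>l=?l..N. q l * ?B l)" by simp
      moreover note split[of B]
      moreover have "(\<Sum>l=1..n. q l * B l) = (\<Sum>l=1..n. q l * C l)" using True by (intro sum.cong) auto
      moreover have "(\<Sum>l=?l..N. q l * ?B l) = (\<Sum>l=?l..N. q l * B l)" by (intro sum.cong) auto
      ultimately show ?thesis by simp
    qed
    have B': "?B \<in> MN" using B(1) by (auto simp: multi_idx_def)
    have "E m ?l (C ?l) (\<alpha> * xq ?B) - (if ?B ?l = C ?l then \<alpha> * xq (?B(?l := 0)) else 0) \<in> ipow ((s - ?W n) + 1 - int (q ?l * C ?l))"
      by (rule E_U0_xq[OF l \<alpha>(1) _ B']) (use wtB \<alpha>(2) B(2)[of ?l] in \<open>simp_all add: algebra_simps trans_le_add2\<close>)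
    moreover have "(if ?B ?l = C ?l then \<alpha> * xq (?B(?l := 0)) else 0) = ?T'"
    proof -
      have "?B(?l := 0) = (\<lambda>l. if l \<in> {1..?l} then 0 else B l)" by (auto simp: fun_eq_iff le_Suc_eq)
      moreover have "(\<forall>l\<in>{1..?l}. B l = C l) \<longleftrightarrow> B ?l = C ?l" using True by (auto simp: le_Suc_eq)
      ultimately show ?thesis by simp
    qed
    moreover have "?T = \<alpha> * xq ?B" using True by (rule if_P)
    moreover have "(s - ?W n) + 1 - int (q ?l * C ?l) = s + 1 - ?W ?l" unfolding W by simp
    ultimately show ?thesis by (simp only:)
  qed
  from ipow_closed(2)[OF 1 2] show ?case by simp
qed

text \<open>The exponents that matter modulo the \<open>n\<close>-th power of the maximal ideal: for
  weight at least \<open>n\<close> the product \<open>hm B\<close> lies in it.\<close>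

abbreviation WB :: "int \<Rightarrow> (nat \<Rightarrow> nat) set" where "WB n \<equiv> {B \<in> MN. int (wt B) < n}"

lemma finite_WB: "finite (WB n)"
proof (rule finite_subset)
  show "WB n \<subseteq> {B \<in> MN. \<forall>i. B i \<le> nat n}"
  proof safe
    fix B i assume B: "B \<in> MN" "int (wt B) < n"
    show "B i \<le> nat n"
    proof (cases "i \<in> {1..N}")
      case True
      from le_wt[OF this, of B] B(2) show ?thesis by linarith
    qed (use B(1) in \<open>simp add: multi_idx_def\<close>)
  qed
qed (rule finite_multi_idx_bounded, simp)

lemma hm_zero: "hm (\<lambda>_. 0) = 1"
  by (rule mono_pow_zero)

section \<open>Finite expansions modulo a power of the maximal ideal\<close>

lemma leading_expansion:
  assumes "r \<in> mpow n"
  shows "\<exists>\<beta>. (\<forall>B\<in>MN. \<beta> B \<in> U0 \<and> \<beta> B \<in> ipow (int n - int (wt B))) \<and>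
     r - (\<Sum>B\<in>WB (int n + 1). \<beta> B * hm B) \<in> ipow (int n + 1)"
proof -
  let ?P = "\<lambda>p \<beta>. (\<forall>B\<in>MN. \<beta> B \<in> U0 \<and> \<beta> B \<in> ipow (int n - int (wt B))) \<and>
     p - (\<Sum>B\<in>WB (int n + 1). \<beta> B * hm B) \<in> ipow (int n + 1)"
  obtain p where p: "p \<in> span (mon ` {L \<in> MI. deg_idx L = n})" "r - p \<in> mpow (Suc n)"
    using mpow_leading_form[OF assms] by blast
  from p(1) have "\<exists>\<beta>. ?P p \<beta>"
  proof (induction rule: span_induct_alt)
    case base
    show ?case by (intro exI[of _ "\<lambda>_. 0"]) (simp add: U0_closed ipow_closed)
  next
    case (step c y z)
    then obtain L \<beta> where L: "L \<in> MI" "deg_idx L = n" "y = mon L" and \<beta>: "?P z \<beta>" by blast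
    \<comment> \<open>Dividing the first \<open>N\<close> exponents by \<open>q i\<close> splits the
      monomial into an element of \<open>U0\<close> and some \<open>xq B\<close>, which
      \<open>hm B\<close> may replace modulo the next power.\<close>
    define K where "K i = (if i \<in> {1..N} then L i mod q i else L i)" for i
    define B where "B i = (if i \<in> {1..N} then L i div q i else 0)" for i
    have KB: "L = (\<lambda>i. K i + q i * B i)" by (auto simp: K_def B_def fun_eq_iff)
    have B: "B \<in> MN" by (simp add: B_def multi_idx_def)
    have K: "mon K \<in> U0" unfolding U0_def
      using L(1) q_pos by (intro span_base imageI) (auto simp: K_def multi_idx_def)
    have deg: "int (deg_idx K) = int n - int (wt B)"
    proof -
      have "n = deg_idx K + deg_idx (\<lambda>i. q i * B i)" unfolding L(2)[symmetric] by (subst KB) (rule sum.distrib)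
      then show ?thesis using deg_xq[OF B] by simp
    qed
    have Ki: "mon K \<in> ipow (int n - int (wt B))"
      unfolding deg[symmetric] ipow_def nat_int by (rule mon_in_mpow)
    have "0 \<le> int (deg_idx K)" by (rule of_nat_0_le_iff)
    then have BW: "B \<in> WB (int n + 1)" using B unfolding deg by simp
    let ?\<beta> = "\<lambda>C. (if C = B then smul c (mon K) else 0) + \<beta> C"
    have scale: "smul c (mon K) \<in> ipow (int n - int (wt B))"
      unfolding smul_eq_mult[of c "mon K"] by (intro ipow_closed(4) Ki)
    have 1: "\<forall>C\<in>MN. ?\<beta> C \<in> U0 \<and> ?\<beta> C \<in> ipow (int n - int (wt C))"
      using \<beta> scale U0_closed(4)[OF K] by (auto intro!: U0_closed(1) ipow_closed(2) simp: U0_closed(3) ipow_closed(1))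
    have 2: "smul c y + z - (\<Sum>C\<in>WB (int n + 1). ?\<beta> C * hm C) \<in> ipow (int n + 1)"
    proof -
      have "(\<Sum>C\<in>WB (int n + 1). ?\<beta> C * hm C) = (\<Sum>C\<in>WB (int n + 1). (if C = B then smul c (mon K) * hm C else 0) + \<beta> C * hm C)"
        by (intro sum.cong) (auto simp: distrib_right)
      also have "\<dots> = smul c (mon K) * hm B + (\<Sum>C\<in>WB (int n + 1). \<beta> C * hm C)"
        unfolding sum.distrib by (subst sum.delta[OF finite_WB]) (use BW in auto)
      finally have sum: "(\<Sum>C\<in>WB (int n + 1). ?\<beta> C * hm C) = smul c (mon K) * hm B + (\<Sum>C\<in>WB (int n + 1). \<beta> C * hm C)" .
      have "y = mon K * xq B" unfolding L(3) mono_pow_add[symmetric] KB[symmetric] ..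
      then have "smul c y = smul c (mon K) * xq B" by (simp only: smul_mult)
      then have "smul c y + z - (\<Sum>C\<in>WB (int n + 1). ?\<beta> C * hm C)
        = (z - (\<Sum>C\<in>WB (int n + 1). \<beta> C * hm C)) - smul c (mon K) * (hm B - xq B)"
        unfolding sum by (simp add: algebra_simps)
      moreover have "smul c (mon K) * (hm B - xq B) \<in> ipow (int n + 1)"
        using ipow_mult[OF scale hm_diff_xq[OF B]] by (rule ipow_antimono[rotated]) simp
      note ipow_closed(3)[OF conjunct2[OF \<beta>] this]
      ultimately show ?thesis by (simp only:)
    qed
    show ?case by (rule exI[of _ ?\<beta>]) (rule conjI[OF 1 2])
  qed
  then obtain \<beta> where \<beta>: "?P p \<beta>" by blast
  have "(r - p) + (p - (\<Sum>B\<in>WB (int n + 1). \<beta> B * hm B)) \<in> ipow (int n + 1)"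
  proof (rule ipow_closed(2))
    have "nat (int n + 1) = Suc n" by simp
    then show "r - p \<in> ipow (int n + 1)" using p(2) unfolding ipow_def by (simp only:)
  qed (use \<beta> in blast)
  then have "r - (\<Sum>B\<in>WB (int n + 1). \<beta> B * hm B) \<in> ipow (int n + 1)" by simp
  with \<beta> show ?thesis by blast
qed

text \<open>The remainder of the leading expansion is expanded again until its order reaches
  \<open>m\<close>. Negative \<open>n\<close> must be allowed, because the errors to be expanded
  have order bounds \<open>s + 1 - wt C\<close> that may be negative.\<close>

lemma expansion_exists:
  assumes "r \<in> ipow n"
  shows "\<exists>\<beta>. (\<forall>B\<in>MN. \<beta> B \<in> U0 \<and> \<beta> B \<in> ipow (n - int (wt B))) \<and> r - (\<Sum>B\<in>WB m. \<beta> B * hm B) \<in> ipow m"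
  using assms
proof (induction "nat (m - n)" arbitrary: n r)
  case 0
  then have "r \<in> ipow m" using ipow_antimono[of m n r] by simp
  then show ?case by (intro exI[of _ "\<lambda>_. 0"]) (simp add: U0_closed ipow_closed)
next
  case (Suc k)
  have k: "k = nat (m - (n + 1))" and nm: "n + 1 \<le> m" using Suc(2) by linarith+
  show ?case
  proof (cases "n < 0")
    case True
    then have "r \<in> ipow (n + 1)" by (intro ipow_nonpos) simp
    from Suc(1)[OF k this] obtain \<beta> where \<beta>: "\<forall>B\<in>MN. \<beta> B \<in> U0 \<and> \<beta> B \<in> ipow (n + 1 - int (wt B))"
      "r - (\<Sum>B\<in>WB m. \<beta> B * hm B) \<in> ipow m" by blast
    have "\<forall>B\<in>MN. \<beta> B \<in> U0 \<and> \<beta> B \<in> ipow (n - int (wt B))"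
      using \<beta>(1) ipow_antimono[of "n - int (wt B)" "n + 1 - int (wt B)" for B] by auto
    with \<beta>(2) show ?thesis by blast
  next
    case False
    then have n: "int (nat n) = n" by simp
    have "r \<in> mpow (nat n)" using Suc.prems unfolding ipow_def .
    from leading_expansion[OF this] obtain \<beta> where
      \<beta>: "\<forall>B\<in>MN. \<beta> B \<in> U0 \<and> \<beta> B \<in> ipow (n - int (wt B))"
        "r - (\<Sum>B\<in>WB (n + 1). \<beta> B * hm B) \<in> ipow (n + 1)" unfolding n by blast
    from Suc(1)[OF k \<beta>(2)] obtain \<beta>' where \<beta>': "\<forall>B\<in>MN. \<beta>' B \<in> U0 \<and> \<beta>' B \<in> ipow (n + 1 - int (wt B))"
      "r - (\<Sum>B\<in>WB (n + 1). \<beta> B * hm B) - (\<Sum>B\<in>WB m. \<beta>' B * hm B) \<in> ipow m" by blast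
    let ?\<beta> = "\<lambda>B. (if B \<in> WB (n + 1) then \<beta> B else 0) + \<beta>' B"
    have "(\<Sum>B\<in>WB m. ?\<beta> B * hm B) = (\<Sum>B\<in>WB m. if B \<in> WB (n + 1) then \<beta> B * hm B else 0) + (\<Sum>B\<in>WB m. \<beta>' B * hm B)"
      unfolding sum.distrib[symmetric] by (intro sum.cong) (auto simp: distrib_right)
    also have "(\<Sum>B\<in>WB m. if B \<in> WB (n + 1) then \<beta> B * hm B else 0) = (\<Sum>B\<in>WB (n + 1). \<beta> B * hm B)"
      by (rule sum.mono_neutral_cong_right) (use finite_WB nm in auto)
    finally have 1: "r - (\<Sum>B\<in>WB m. ?\<beta> B * hm B) \<in> ipow m" using \<beta>'(2) by (simp only: diff_diff_add)
    have 2: "\<forall>B\<in>MN. ?\<beta> B \<in> U0 \<and> ?\<beta> B \<in> ipow (n - int (wt B))"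
      using \<beta>(1) \<beta>'(1) ipow_antimono[of "n - int (wt B)" "n + 1 - int (wt B)" for B]
      by (auto intro!: U0_closed(1) ipow_closed(2) simp: U0_closed(3) ipow_closed(1))
    show ?thesis by (rule exI[of _ ?\<beta>]) (rule conjI[OF 2 1])
  qed
qed

text \<open>The term at exponent zero dies exactly since \<open>C\<close> is nonzero; the other
  terms have order \<open>s\<close>, so for them both \<open>Gop_U0_xq\<close> and the passage from
  \<open>xq B\<close> to \<open>hm B\<close> cost only the permitted error.\<close>

lemma Gop_extracts_coefficient:
  assumes \<alpha>: "\<And>B. B \<in> MN \<Longrightarrow> \<alpha> B \<in> U0" "\<And>B. B \<in> MN \<Longrightarrow> B \<noteq> (\<lambda>_. 0) \<Longrightarrow> \<alpha> B \<in> ipow (s - int (wt B))"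
    and f: "f - (\<Sum>B\<in>WB m. \<alpha> B * hm B) \<in> ipow m" and sm: "s + 1 \<le> m"
    and C: "C \<in> WB m" "C \<noteq> (\<lambda>_. 0)"
  shows "Gop (nat m) C N f - \<alpha> C \<in> ipow (s + 1 - int (wt C))"
proof -
  let ?G = "Gop (nat m) C N"
  let ?t = "\<lambda>B. if B = C then \<alpha> C else 0"
  note lin = Gop_linear[OF order_refl]
  have wtC: "(\<Sum>l=1..N. q l * C l) = wt C" by (simp add: wt_def)
  have G_ipow: "?G g \<in> ipow (s + 1 - int (wt C))" if "g \<in> ipow k" "s + 1 \<le> k" for g k
    using Gop_ipow[OF order_refl that(1), of "nat m" C] unfolding wtC by (rule ipow_antimono[rotated]) (use that in simp)
  have summand: "?G (\<alpha> B * hm B) - ?t B \<in> ipow (s + 1 - int (wt C))" if B: "B \<in> WB m" for B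
  proof (cases "B = (\<lambda>_. 0)")
    case True
    obtain i where i: "C i \<noteq> 0" using C(2) by (auto simp: fun_eq_iff)
    then have "i \<in> {1..N}" by (rule multi_idx_supp[rotated]) (use C(1) in simp)
    with i have "\<not> (\<forall>l\<in>{1..N}. C l = 0)" by auto
    then have "?G (\<alpha> B) = 0" using B \<alpha>(1) by (subst Gop_U0) auto
    then show ?thesis using True C(2) by (simp add: mono_pow_zero ipow_closed(1))
  next
    case False
    have BM: "B \<in> MN" using B by simp
    have Bl: "B l \<le> nat m" for l
    proof (cases "l \<in> {1..N}")
      case True
      have "int (wt B) < m" using B by simp
      with le_wt[OF True, of B] show ?thesis by linarith
    qed (use BM in \<open>simp add: multi_idx_def\<close>)
    have eq: "(\<forall>l\<in>{1..N}. B l = C l) \<longleftrightarrow> B = C"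
      using BM C(1) by (auto simp: multi_idx_def fun_eq_iff)
    have "(\<lambda>l. q l * (if l \<in> {1..N} then 0 else B l)) = (\<lambda>_. 0)" using BM by (auto simp: multi_idx_def fun_eq_iff)
    then have one: "xq (\<lambda>l. if l \<in> {1..N} then 0 else B l) = 1" by (simp only: mono_pow_zero)
    have t: "(if B = C then \<alpha> B * 1 else 0) = ?t B" by simp
    have 1: "?G (\<alpha> B * xq B) - ?t B \<in> ipow (s + 1 - int (wt C))"
      using Gop_U0_xq[OF \<alpha>(1)[OF BM] \<alpha>(2)[OF BM False] BM Bl order_refl, of C] unfolding one eq wtC t .
    have "\<alpha> B * (hm B - xq B) \<in> ipow ((s - int (wt B)) + (int (wt B) + 1))"
      by (intro ipow_mult \<alpha>(2) BM False hm_diff_xq)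
    then have 2: "?G (\<alpha> B * (hm B - xq B)) \<in> ipow (s + 1 - int (wt C))" by (rule G_ipow) simp
    have "\<alpha> B * hm B = \<alpha> B * xq B + \<alpha> B * (hm B - xq B)" by (simp add: algebra_simps)
    then have "?G (\<alpha> B * hm B) - ?t B = (?G (\<alpha> B * xq B) - ?t B) + ?G (\<alpha> B * (hm B - xq B))"
      by (simp only: lin(1)) simp
    then show ?thesis using ipow_closed(2)[OF 1 2] by (simp only:)
  qed
  have "f = (f - (\<Sum>B\<in>WB m. \<alpha> B * hm B)) + (\<Sum>B\<in>WB m. \<alpha> B * hm B)" by simp
  then have "?G f = ?G (f - (\<Sum>B\<in>WB m. \<alpha> B * hm B)) + (\<Sum>B\<in>WB m. ?G (\<alpha> B * hm B))" by (metis lin(1,3))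
  moreover have "(\<Sum>B\<in>WB m. ?t B) = \<alpha> C" by (subst sum.delta[OF finite_WB]) (use C(1) in auto)
  ultimately have "?G f - \<alpha> C = ?G (f - (\<Sum>B\<in>WB m. \<alpha> B * hm B)) + (\<Sum>B\<in>WB m. ?G (\<alpha> B * hm B) - ?t B)"
    by (simp add: sum_subtractf)
  moreover have "(\<Sum>B\<in>WB m. ?G (\<alpha> B * hm B) - ?t B) \<in> ipow (s + 1 - int (wt C))"
    by (rule ipow_closed(6)[OF summand])
  ultimately show ?thesis using ipow_closed(2)[OF G_ipow[OF f sm]] by (simp only:)
qed

lemma wt_diff: "C \<le> B \<Longrightarrow> wt C + wt (\<lambda>i. B i - C i) = wt B"
  unfolding wt_add[symmetric] by (simp add: le_fun_def)

text \<open>Products \<open>hm L * hm C\<close> are collected by their total exponent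
  \<open>B = C + L\<close>.\<close>

lemma sum_convolution:
  "(\<Sum>B\<in>WB m. (\<Sum>C\<in>{C \<in> WB m - {\<lambda>_. 0}. C \<le> B}. \<gamma> C (\<lambda>i. B i - C i)) * hm B)
    = (\<Sum>C\<in>WB m - {\<lambda>_. 0}. (\<Sum>L\<in>WB (m - int (wt C)). \<gamma> C L * hm L) * hm C)"
proof -
  let ?W = "WB m - {\<lambda>_. 0}"
  have "(\<Sum>B\<in>WB m. (\<Sum>C\<in>{C \<in> ?W. C \<le> B}. \<gamma> C (\<lambda>i. B i - C i)) * hm B)
    = (\<Sum>(B, C)\<in>(SIGMA B:WB m. {C \<in> ?W. C \<le> B}). \<gamma> C (\<lambda>i. B i - C i) * hm B)"
    unfolding sum_distrib_right by (rule sum.Sigma[OF finite_WB], rule ballI, rule finite_subset[OF _ finite_WB[of m]]) auto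
  also have "\<dots> = (\<Sum>(C, L)\<in>(SIGMA C:?W. WB (m - int (wt C))). \<gamma> C L * hm L * hm C)"
  proof (rule sum.reindex_bij_witness[of _ "\<lambda>(C, L). (\<lambda>i. C i + L i, C)" "\<lambda>(B, C). (C, \<lambda>i. B i - C i)"])
    fix z assume "z \<in> (SIGMA B:WB m. {C \<in> ?W. C \<le> B})"
    then obtain B C where z: "z = (B, C)" "B \<in> WB m" "C \<in> ?W" "C \<le> B" by blast
    have eq: "(\<lambda>i. C i + (B i - C i)) = B" using z(4) by (simp add: le_fun_def)
    show "(\<lambda>(C, L). (\<lambda>i. C i + L i, C)) (case z of (B, C) \<Rightarrow> (C, \<lambda>i. B i - C i)) = z"
      using eq by (simp add: z(1))
    have "(\<lambda>i. B i - C i) \<in> MN" using z(2) by (simp add: multi_idx_def)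
    then show "(case z of (B, C) \<Rightarrow> (C, \<lambda>i. B i - C i)) \<in> (SIGMA C:?W. WB (m - int (wt C)))"
      using z wt_diff[OF z(4)] by simp
    have "hm (\<lambda>i. B i - C i) * hm C = hm B" unfolding mono_pow_add[symmetric] using eq by (simp add: add.commute)
    then show "(case (case z of (B, C) \<Rightarrow> (C, \<lambda>i. B i - C i)) of (C, L) \<Rightarrow> \<gamma> C L * hm L * hm C)
      = (case z of (B, C) \<Rightarrow> \<gamma> C (\<lambda>i. B i - C i) * hm B)"
      by (simp add: z(1) mult.assoc)
  next
    fix z assume "z \<in> (SIGMA C:?W. WB (m - int (wt C)))"
    then obtain C L where z: "z = (C, L)" "C \<in> ?W" "L \<in> WB (m - int (wt C))" by blast
    show "(\<lambda>(B, C). (C, \<lambda>i. B i - C i)) (case z of (C, L) \<Rightarrow> (\<lambda>i. C i + L i, C)) = z" by (simp add: z(1))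
    show "(case z of (C, L) \<Rightarrow> (\<lambda>i. C i + L i, C)) \<in> (SIGMA B:WB m. {C \<in> ?W. C \<le> B})"
      using z by (auto simp: wt_add le_fun_def intro!: multi_idx_add)
  qed
  also have "\<dots> = (\<Sum>C\<in>?W. \<Sum>L\<in>WB (m - int (wt C)). \<gamma> C L * hm L * hm C)"
    by (rule sum.Sigma[symmetric, OF finite_Diff[OF finite_WB]]) (intro ballI finite_WB)
  finally show ?thesis unfolding sum_distrib_right .
qed

text \<open>
  The induction is on the precision \<open>t\<close>, for all \<open>s\<close> at once: the initial forms of the coefficients
  \<open>\<alpha>\<^sub>C\<close>, \<open>C \<noteq> 0\<close>, are realised by elements \<open>G\<^sub>C f\<close> of the filtration.  Subtracting \<open>\<Sum> G\<^sub>C f H\<^sup>C\<close>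
  raises \<open>s\<close>, and the elements \<open>G\<^sub>C f\<close> satisfy the hypothesis with smaller precision.
\<close>

lemma coefficient_mod_power:
  assumes "(f, a) \<in> \<I>" "\<And>B. B \<in> MN \<Longrightarrow> \<alpha> B \<in> U0"
    "\<And>B. B \<in> MN \<Longrightarrow> B \<noteq> (\<lambda>_. 0) \<Longrightarrow> \<alpha> B \<in> ipow (s - int (wt B))"
    "f - (\<Sum>B\<in>WB (s + int t). \<alpha> B * hm B) \<in> ipow (s + int t)" "B \<in> MN"
  shows "\<exists>g. (g, a - real (wt B)) \<in> \<I> \<and> \<alpha> B - g \<in> ipow (s + int t - int (wt B))"
  using assms
proof (induction t arbitrary: s f a \<alpha> B)
  case 0
  show ?case
  proof (cases "B = (\<lambda>_. 0)")
    case False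
    \<comment> \<open>Without precision beyond \<open>s\<close> the order bound makes 0 a sufficient
      approximation.\<close>
    with 0(3)[OF 0(5)] show ?thesis by (intro exI[of _ 0]) (simp add: filt_closed(3))
  next
    case True
    show ?thesis
    proof (cases "s \<le> 0")
      case True
      then show ?thesis by (intro exI[of _ 0]) (simp add: ipow_nonpos filt_closed(3))
    next
      case False
      have zero: "(\<lambda>_. 0) \<in> WB s" using False by (simp add: wt_zero multi_idx_def)
      have "(\<Sum>B\<in>WB s. \<alpha> B * hm B) = \<alpha> (\<lambda>_. 0) + (\<Sum>B\<in>WB s - {\<lambda>_. 0}. \<alpha> B * hm B)"
        unfolding sum.remove[OF finite_WB zero] hm_zero mult_1_right ..
      \<comment> \<open>The terms with nonzero exponent have order \<open>s\<close>, so
        \<open>f\<close> itself approximates the coefficient at exponent zero.\<close>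
      then have "\<alpha> (\<lambda>_. 0) - f = - (f - (\<Sum>B\<in>WB s. \<alpha> B * hm B)) - (\<Sum>B\<in>WB s - {\<lambda>_. 0}. \<alpha> B * hm B)"
        by (simp add: algebra_simps)
      moreover have "\<alpha> B * hm B \<in> ipow s" if "B \<in> WB s - {\<lambda>_. 0}" for B
        using ipow_mult[OF 0(3) hm_ipow, of B B] that by simp
      then have rest: "(\<Sum>B\<in>WB s - {\<lambda>_. 0}. \<alpha> B * hm B) \<in> ipow s" by (rule ipow_closed(6))
      have "f - (\<Sum>B\<in>WB s. \<alpha> B * hm B) \<in> ipow s" using 0(4) by simp
      note ipow_closed(3)[OF ipow_closed(5)[OF this] rest]
      ultimately have "\<alpha> (\<lambda>_. 0) - f \<in> ipow s" by (simp only:)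
      then show ?thesis using 0(1) \<open>B = (\<lambda>_. 0)\<close> by (intro exI[of _ f]) (simp add: wt_zero)
    qed
  qed
next
  case (Suc t)
  define m where "m = s + int (Suc t)"
  have sm: "s + 1 \<le> m" and st: "s + 1 + int t = m" unfolding m_def by auto
  let ?W = "WB m - {\<lambda>_. 0}"
  define G where "G C = Gop (nat m) C N f" for C
  have G_filt: "(G C, a - real (wt C)) \<in> \<I>" for C
    using Gop_filt[OF order_refl Suc.prems(1), of "nat m" C] unfolding G_def wt_def .
  have G_lead: "G C - \<alpha> C \<in> ipow (s + 1 - int (wt C))" if "C \<in> ?W" for C
    unfolding G_def
    by (rule Gop_extracts_coefficient[OF Suc.prems(2,3) Suc.prems(4)[folded m_def] sm]) (use that in auto)
  let ?Q = "\<lambda>C \<beta>. (\<forall>L\<in>MN. \<beta> L \<in> U0 \<and> \<beta> L \<in> ipow (s + 1 - int (wt C) - int (wt L))) \<and>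
    G C - \<alpha> C - (\<Sum>L\<in>WB (m - int (wt C)). \<beta> L * hm L) \<in> ipow (m - int (wt C))"
  have "\<forall>C\<in>?W. \<exists>\<beta>. ?Q C \<beta>" using expansion_exists[OF G_lead] by blast
  from bchoice[OF this] obtain \<beta> where \<beta>: "\<forall>C\<in>?W. ?Q C (\<beta> C)" by (elim exE)
  \<comment> \<open>The expansion of \<open>G C\<close>. Only its coefficient at exponent zero
    contains \<open>\<alpha> C\<close>; all others have gained one order, as the induction
    hypothesis for \<open>s + 1 - wt C\<close> demands.\<close>
  define \<gamma> where "\<gamma> C L = \<beta> C L + (if L = (\<lambda>_. 0) then \<alpha> C else 0)" for C L
  have \<gamma>U: "\<gamma> C L \<in> U0" if "C \<in> ?W" "L \<in> MN" for C L
    unfolding \<gamma>_def using \<beta> that Suc.prems(2) U0_closed(3) by (intro U0_closed(1)) auto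
  have \<gamma>P: "\<gamma> C L \<in> ipow (s + 1 - int (wt C) - int (wt L))" if "C \<in> ?W" "L \<in> MN" "L \<noteq> (\<lambda>_. 0)" for C L
    unfolding \<gamma>_def using \<beta> that by simp
  have \<gamma>G: "G C - (\<Sum>L\<in>WB (m - int (wt C)). \<gamma> C L * hm L) \<in> ipow (m - int (wt C))" if C: "C \<in> ?W" for C
  proof -
    have 0: "(\<lambda>_. 0) \<in> WB (m - int (wt C))" using C by (simp add: wt_zero multi_idx_def)
    have "(\<Sum>L\<in>WB (m - int (wt C)). \<gamma> C L * hm L)
      = (\<Sum>L\<in>WB (m - int (wt C)). \<beta> C L * hm L + (if L = (\<lambda>_. 0) then \<alpha> C * hm L else 0))"
      unfolding \<gamma>_def by (intro sum.cong) (auto simp: distrib_right)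
    also have "\<dots> = (\<Sum>L\<in>WB (m - int (wt C)). \<beta> C L * hm L) + \<alpha> C"
      unfolding sum.distrib by (subst sum.delta[OF finite_WB]) (use 0 in \<open>auto simp: mono_pow_zero\<close>)
    finally have "G C - (\<Sum>L\<in>WB (m - int (wt C)). \<gamma> C L * hm L) = G C - \<alpha> C - (\<Sum>L\<in>WB (m - int (wt C)). \<beta> C L * hm L)"
      by simp
    with conjunct2[OF bspec[OF \<beta> C]] show ?thesis by (simp only:)
  qed
  have \<gamma>I: "\<exists>g. (g, a - real (wt C) - real (wt L)) \<in> \<I> \<and> \<gamma> C L - g \<in> ipow (m - int (wt C) - int (wt L))"
    if C: "C \<in> ?W" and L: "L \<in> MN" for C L
  proof -
    have eq: "s + 1 - int (wt C) + int t = m - int (wt C)" using st by simp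
    show ?thesis
      using Suc.IH[of "G C" "a - real (wt C)" "\<gamma> C" "s + 1 - int (wt C)" L, OF G_filt \<gamma>U[OF C] \<gamma>P[OF C] _ L]
        \<gamma>G[OF C] unfolding eq by blast
  qed
  let ?R = "\<lambda>B. {C \<in> ?W. C \<le> B}"
  \<comment> \<open>The coefficients of \<open>f'\<close>, collected according to
    \<open>sum_convolution\<close>.\<close>
  define \<alpha>' where "\<alpha>' B = \<alpha> B - (\<Sum>C\<in>?R B. \<gamma> C (\<lambda>i. B i - C i))" for B
  define f' where "f' = f - (\<Sum>C\<in>?W. G C * hm C)"
  have finR: "finite (?R B)" for B by (rule finite_subset[OF _ finite_WB[of m]]) auto
  have diff_MN: "(\<lambda>i. B i - C i) \<in> MN" if "B \<in> MN" for B C using that by (simp add: multi_idx_def)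
  have f'_filt: "(f', a) \<in> \<I>"
    unfolding f'_def
  proof (intro filt_closed(4) Suc.prems(1) filt_closed(5))
    fix C
    from filt_closed(7)[OF G_filt[of C] hm_filt[of C]] show "(G C * hm C, a) \<in> \<I>" by simp
  qed
  have \<alpha>'U: "\<alpha>' B \<in> U0" if "B \<in> MN" for B
    unfolding \<alpha>'_def using that diff_MN by (intro U0_closed(2,5) Suc.prems(2) \<gamma>U) auto
  have \<alpha>'P: "\<alpha>' B \<in> ipow (s + 1 - int (wt B))" if B: "B \<in> MN" "B \<noteq> (\<lambda>_. 0)" for B
  proof (cases "B \<in> WB m")
    case False
    then have "s + 1 - int (wt B) \<le> 0" using B sm by simp
    then show ?thesis by (rule ipow_nonpos)
  next
    case True
    have BR: "B \<in> ?R B" and BW: "B \<in> ?W" using True B by auto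
    \<comment> \<open>The summand for \<open>C = B\<close> cancels \<open>\<alpha> B\<close> up to
      \<open>\<beta> B\<close>; this raises the order from \<open>s\<close> to
      \<open>s + 1\<close>.\<close>
    have "\<alpha>' B = (\<alpha> B - \<gamma> B (\<lambda>_. 0)) - (\<Sum>C\<in>?R B - {B}. \<gamma> C (\<lambda>i. B i - C i))"
      unfolding \<alpha>'_def by (subst sum.remove[OF finR BR]) simp
    moreover have "\<alpha> B - \<gamma> B (\<lambda>_. 0) \<in> ipow (s + 1 - int (wt B))"
    proof -
      have "\<beta> B (\<lambda>_. 0) \<in> ipow (s + 1 - int (wt B) - int (wt (\<lambda>_. 0)))" using \<beta> BW zero_MN by blast
      then show ?thesis using ipow_closed(5) by (simp add: \<gamma>_def wt_zero)
    qed
    moreover have "\<gamma> C (\<lambda>i. B i - C i) \<in> ipow (s + 1 - int (wt B))" if C: "C \<in> ?R B - {B}" for C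
    proof -
      have le: "C \<le> B" and ne: "C \<noteq> B" and CW: "C \<in> ?W" using C by auto
      have "(\<lambda>i. B i - C i) \<noteq> (\<lambda>_. 0)"
      proof
        assume "(\<lambda>i. B i - C i) = (\<lambda>_. 0)"
        then have "B \<le> C" by (simp add: fun_eq_iff le_fun_def)
        then show False using le ne by simp
      qed
      from \<gamma>P[OF CW diff_MN[OF B(1)] this]
      have "\<gamma> C (\<lambda>i. B i - C i) \<in> ipow (s + 1 - int (wt C) - int (wt (\<lambda>i. B i - C i)))" .
      moreover have "s + 1 - int (wt C) - int (wt (\<lambda>i. B i - C i)) = s + 1 - int (wt B)"
        unfolding wt_diff[OF le, symmetric] by simp
      ultimately show ?thesis by (simp only:)
    qed
    then have "(\<Sum>C\<in>?R B - {B}. \<gamma> C (\<lambda>i. B i - C i)) \<in> ipow (s + 1 - int (wt B))" by (rule ipow_closed(6))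
    ultimately show ?thesis using ipow_closed(3) by (simp only:)
  qed
  have f'_exp: "f' - (\<Sum>B\<in>WB (s + 1 + int t). \<alpha>' B * hm B) \<in> ipow (s + 1 + int t)"
  proof -
    have "(\<Sum>B\<in>WB m. \<alpha>' B * hm B) = (\<Sum>B\<in>WB m. \<alpha> B * hm B)
      - (\<Sum>C\<in>?W. (\<Sum>L\<in>WB (m - int (wt C)). \<gamma> C L * hm L) * hm C)"
      unfolding \<alpha>'_def left_diff_distrib sum_subtractf sum_convolution ..
    then have "f' - (\<Sum>B\<in>WB m. \<alpha>' B * hm B) = (f - (\<Sum>B\<in>WB m. \<alpha> B * hm B))
      - (\<Sum>C\<in>?W. (G C - (\<Sum>L\<in>WB (m - int (wt C)). \<gamma> C L * hm L)) * hm C)"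
      unfolding f'_def left_diff_distrib sum_subtractf by simp
    moreover have "(G C - (\<Sum>L\<in>WB (m - int (wt C)). \<gamma> C L * hm L)) * hm C \<in> ipow m" if C: "C \<in> ?W" for C
    proof -
      have "C \<in> MN" using C by simp
      from ipow_mult[OF \<gamma>G[OF C] hm_ipow[OF this]] show ?thesis by simp
    qed
    then have "(\<Sum>C\<in>?W. (G C - (\<Sum>L\<in>WB (m - int (wt C)). \<gamma> C L * hm L)) * hm C) \<in> ipow m" by (rule ipow_closed(6))
    ultimately show ?thesis unfolding st using ipow_closed(3)[OF Suc.prems(4)[folded m_def]] by (simp only:)
  qed
  obtain g' where g': "(g', a - real (wt B)) \<in> \<I>" "\<alpha>' B - g' \<in> ipow (m - int (wt B))"
    using Suc.IH[OF f'_filt \<alpha>'U \<alpha>'P f'_exp Suc.prems(5)] unfolding st by blast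
  have "\<forall>C\<in>?R B. \<exists>g. (g, a - real (wt B)) \<in> \<I> \<and> \<gamma> C (\<lambda>i. B i - C i) - g \<in> ipow (m - int (wt B))"
  proof
    fix C assume C: "C \<in> ?R B"
    have CW: "C \<in> ?W" and le: "C \<le> B" using C by auto
    have 1: "a - real (wt C) - real (wt (\<lambda>i. B i - C i)) = a - real (wt B)"
      and 2: "m - int (wt C) - int (wt (\<lambda>i. B i - C i)) = m - int (wt B)"
      unfolding wt_diff[OF le, symmetric] by simp_all
    show "\<exists>g. (g, a - real (wt B)) \<in> \<I> \<and> \<gamma> C (\<lambda>i. B i - C i) - g \<in> ipow (m - int (wt B))"
      using \<gamma>I[OF CW diff_MN[OF Suc.prems(5), of C]] unfolding 1 2 .
  qed
  from bchoice[OF this] obtain g where g: "\<forall>C\<in>?R B. (g C, a - real (wt B)) \<in> \<I> \<and>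
    \<gamma> C (\<lambda>i. B i - C i) - g C \<in> ipow (m - int (wt B))" by (elim exE)
  have 1: "(g' + (\<Sum>C\<in>?R B. g C), a - real (wt B)) \<in> \<I>"
    using g by (intro filt_closed(1,5) g'(1)) blast
  \<comment> \<open>Both parts of \<open>\<alpha> B\<close> are approximated at the same level,
    since the weights of \<open>C\<close> and of the difference of \<open>B\<close> and
    \<open>C\<close> add up to \<open>wt B\<close>.\<close>
  have eq: "\<alpha> B - (g' + (\<Sum>C\<in>?R B. g C)) = (\<alpha>' B - g') + (\<Sum>C\<in>?R B. \<gamma> C (\<lambda>i. B i - C i) - g C)"
    unfolding \<alpha>'_def sum_subtractf by simp
  have "(\<alpha>' B - g') + (\<Sum>C\<in>?R B. \<gamma> C (\<lambda>i. B i - C i) - g C) \<in> ipow (m - int (wt B))"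
    using g by (intro ipow_closed(2,6) g'(2)) blast
  then have 2: "\<alpha> B - (g' + (\<Sum>C\<in>?R B. g C)) \<in> ipow (m - int (wt B))" unfolding eq .
  show ?case unfolding m_def[symmetric] by (rule exI[of _ "g' + (\<Sum>C\<in>?R B. g C)"]) (rule conjI[OF 1 2])
qed

end

section \<open>Ideals are closed in the completion\<close>

text \<open>Induction on the variables. Elements that are large in place \<open>i\<close> are
  dominated through finitely many projections; for each of the finitely many smaller values in that
  place the slice is treated on its own.\<close>

lemma dickson:
  fixes E :: "('i \<Rightarrow> nat) set"
  assumes "finite I" "E \<subseteq> multi_idx I"
  shows "\<exists>F\<subseteq>E. finite F \<and> (\<forall>L\<in>E. \<exists>K\<in>F. K \<le> L)"
  using assms
proof (induction I arbitrary: E rule: finite_induct)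
  case empty
  then have "E \<subseteq> {\<lambda>_. 0}" by (auto simp: multi_idx_def)
  then have "finite E" by (rule finite_subset) simp
  then show ?case by blast
next
  case (insert i I)
  have *: "\<exists>F\<subseteq>E'. finite F \<and> (\<forall>L\<in>E'. \<exists>K\<in>F. K(i := 0) \<le> L(i := 0))" if E': "E' \<subseteq> E" for E'
  proof -
    let ?P = "(\<lambda>L. L(i := 0)) ` E'"
    have "?P \<subseteq> multi_idx I" using insert.prems E' by (auto simp: multi_idx_def)
    from insert.IH[OF this] obtain F where F: "F \<subseteq> ?P" "finite F" "\<forall>L\<in>?P. \<exists>K\<in>F. K \<le> L" by blast
    from F(1,2) obtain F' where F': "F' \<subseteq> E'" "finite F'" "F = (\<lambda>L. L(i := 0)) ` F'"
      by (meson finite_subset_image)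
    show ?thesis using F' F(3) by (intro exI[of _ F']) auto
  qed
  obtain F0 where F0: "F0 \<subseteq> E" "finite F0" "\<And>L. L \<in> E \<Longrightarrow> \<exists>K\<in>F0. K(i := 0) \<le> L(i := 0)" using *[of E] by auto
  define m where "m = (\<Sum>K\<in>F0. K i)"
  have m: "K i \<le> m" if "K \<in> F0" for K unfolding m_def using that F0(2) by (intro member_le_sum) auto
  have "\<forall>n. \<exists>F\<subseteq>{L \<in> E. L i = n}. finite F \<and> (\<forall>L\<in>{L \<in> E. L i = n}. \<exists>K\<in>F. K(i := 0) \<le> L(i := 0))"
    by (intro allI *) auto
  from choice[OF this] obtain F where F': "\<forall>n. F n \<subseteq> {L \<in> E. L i = n} \<and> finite (F n) \<and>
    (\<forall>L\<in>{L \<in> E. L i = n}. \<exists>K\<in>F n. K(i := 0) \<le> L(i := 0))" by (elim exE) (rule that)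
  then have F: "\<And>n. F n \<subseteq> {L \<in> E. L i = n}" "\<And>n. finite (F n)"
    "\<And>n L. L \<in> E \<Longrightarrow> L i = n \<Longrightarrow> \<exists>K\<in>F n. K(i := 0) \<le> L(i := 0)" by simp_all
  have le: "K \<le> L" if "K(i := 0) \<le> L(i := 0)" "K i \<le> L i" for K L :: "'i \<Rightarrow> nat"
    using that unfolding le_fun_def by (metis fun_upd_other)
  let ?F = "F0 \<union> (\<Union>n<m. F n)"
  have "\<exists>K\<in>?F. K \<le> L" if L: "L \<in> E" for L
  proof (cases "m \<le> L i")
    case True
    obtain K where K: "K \<in> F0" "K(i := 0) \<le> L(i := 0)" using F0(3)[OF L] by blast
    then have "K \<le> L" using le m[OF K(1)] True by auto
    then show ?thesis using K(1) by blast
  next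
    case False
    obtain K where K: "K \<in> F (L i)" "K(i := 0) \<le> L(i := 0)" using F(3)[OF L refl] by blast
    then have "K i = L i" using F(1) by blast
    then have "K \<le> L" using le K(2) by simp
    then show ?thesis using K(1) False by auto
  qed
  moreover have "?F \<subseteq> E" using F0(1) F(1) by blast
  moreover have "finite ?F" using F0(2) F(2) by blast
  ultimately show ?case by blast
qed

text \<open>The lexicographic order is compatible with multiplication of monomials.\<close>

lemma less_fun_add: "less_fun K L \<Longrightarrow> less_fun (\<lambda>i. K i + J i :: nat) (\<lambda>i. L i + J i)"
  unfolding less_fun_def by auto

lemma less_fun_minimum:
  fixes T :: "(nat \<Rightarrow> nat) set"
  assumes "finite I" "finite T" "T \<noteq> {}" "T \<subseteq> multi_idx I"
  shows "\<exists>L\<in>T. \<forall>K\<in>T - {L}. less_fun L K"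
  using assms(2-)
proof (induction T rule: finite_ne_induct)
  case (insert J F)
  then obtain L where L: "L \<in> F" "\<forall>K\<in>F - {L}. less_fun L K" by auto
  have "J \<in> multi_idx I" "L \<in> multi_idx I" using L(1) insert.prems by auto
  then have "finite {k. J k \<noteq> L k}"
    by (intro finite_subset[OF _ assms(1)]) (auto simp: multi_idx_def, metis)
  from less_fun_trichotomy[OF this] L(1) insert.hyps(3) consider "less_fun J L" | "less_fun L J" by blast
  then show ?case
  proof cases
    case 1
    then have "\<forall>K\<in>insert J F - {J}. less_fun J K" using L less_fun_trans by blast
    then show ?thesis by blast
  next
    case 2
    then have "\<forall>K\<in>insert J F - {L}. less_fun L K" using L by blast
    then show ?thesis using L(1) by blast
  qed
qed simp

section \<open>Congruences and limits in the completion\<close>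

lemma to_completion_simps:
  "to_completion (a + b) = to_completion a + to_completion b"
  "to_completion (a - b) = to_completion a - to_completion b"
  "to_completion (a * b) = to_completion a * to_completion b"
  "to_completion 0 = 0" "to_completion 1 = 1"
  for a b :: "'a::local_ring"
  by (transfer, rule compl_rel_eqI; simp add: coherent_intros)+

lemma to_completion_sum: "to_completion (sum f I) = (\<Sum>i\<in>I. to_completion (f i))"
  by (induction I rule: infinite_finite_induct) (simp_all add: to_completion_simps)

lemma compl_cong_to_completion: "compl_cong n (to_completion a) (to_completion b) \<longleftrightarrow> a - b \<in> mpow n"
  by transfer simp

lemma compl_cong_refl: "compl_cong n f f"
  by transfer (simp only: diff_self mpow_simps)

lemma compl_cong_sym: "compl_cong n f g \<Longrightarrow> compl_cong n g f"
  by transfer (rule mpow_minus_swap)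

lemma compl_cong_trans: "compl_cong n f g \<Longrightarrow> compl_cong n g h \<Longrightarrow> compl_cong n f h"
proof (transfer fixing: n)
  fix X Y Z :: "nat \<Rightarrow> 'a"
  assume "X n - Y n \<in> mpow n" "Y n - Z n \<in> mpow n"
  then have "(X n - Y n) + (Y n - Z n) \<in> mpow n" by (rule mpow_simps)
  then show "X n - Z n \<in> mpow n" by simp
qed

lemma compl_cong_add: "compl_cong n f g \<Longrightarrow> compl_cong n f' g' \<Longrightarrow> compl_cong n (f + f') (g + g')"
  by transfer (rule mpow_add_cong)

lemma compl_cong_diff: "compl_cong n f g \<Longrightarrow> compl_cong n f' g' \<Longrightarrow> compl_cong n (f - f') (g - g')"
  by transfer (rule mpow_diff_cong)

lemma compl_cong_mult: "compl_cong n f g \<Longrightarrow> compl_cong n f' g' \<Longrightarrow> compl_cong n (f * f') (g * g')"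
  by transfer (rule mpow_mult_cong)

lemma compl_cong_sum: "(\<And>i. i \<in> I \<Longrightarrow> compl_cong n (f i) (g i)) \<Longrightarrow> compl_cong n (sum f I) (sum g I)"
  by (induction I rule: infinite_finite_induct) (simp_all add: compl_cong_refl compl_cong_add)

lemma compl_eqI: "(\<And>n. compl_cong n f g) \<Longrightarrow> f = g"
proof (transfer)
  fix f g :: "nat \<Rightarrow> 'a"
  assume "compl_rel f f" "compl_rel g g" "\<And>n. f n - g n \<in> mpow n"
  then show "compl_rel f g" by (simp add: compl_rel_def)
qed

lemma compl_cong_representative: "\<exists>r. compl_cong n f (to_completion r)"
proof (transfer fixing: n)
  fix f :: "nat \<Rightarrow> 'a"
  show "\<exists>r. f n - r \<in> mpow n" by (rule exI[of _ "f n"]) (simp only: diff_self mpow_simps)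
qed

lemma compl_cong_Suc: "compl_cong (Suc n) f g \<Longrightarrow> compl_cong n f g"
proof (transfer fixing: n)
  fix f g :: "nat \<Rightarrow> 'a"
  assume f: "compl_rel f f" and g: "compl_rel g g" and d: "f (Suc n) - g (Suc n) \<in> mpow (Suc n)"
  have 1: "f (Suc n) - g (Suc n) \<in> mpow n" by (rule mpow_antimono[OF _ d]) simp
  have "f (Suc n) - f n \<in> mpow n" "g (Suc n) - g n \<in> mpow n"
    using f g by (simp_all add: compl_rel_def coherent_def)
  from mpow_simps(3)[OF 1 mpow_simps(3)[OF this]] show "f n - g n \<in> mpow n" by (simp add: algebra_simps)
qed

lemma compl_cong_antimono: "m \<le> n \<Longrightarrow> compl_cong n f g \<Longrightarrow> compl_cong m f g"
  by (induction rule: inc_induct) (auto intro: compl_cong_Suc)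

text \<open>The term with index \<open>n + c\<close> is the first one known to vanish at precision
  \<open>n\<close>, so the partial sums must be taken with the delay \<open>c\<close>.\<close>

lemma completion_series:
  fixes r :: "nat \<Rightarrow> 'a::local_ring"
  assumes "\<And>k. r k \<in> mpow (k - c)"
  shows "\<exists>\<phi>. \<forall>n. compl_cong n \<phi> (to_completion (\<Sum>k<n + c. r k))"
proof -
  let ?X = "\<lambda>n. \<Sum>k<n + c. r k"
  have coh: "coherent ?X" unfolding coherent_def
  proof
    fix n
    have "?X (Suc n) - ?X n = r (n + c)" by simp
    then show "?X (Suc n) - ?X n \<in> mpow n" using assms[of "n + c"] by (simp only: add_diff_cancel_right')
  qed
  then have rel: "compl_rel ?X ?X" by (simp add: compl_rel_def mpow_simps)
  have "compl_cong n (abs_completion ?X) (to_completion (\<Sum>k<n + c. r k))" for n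
  proof -
    have "compl_rel (\<lambda>_. \<Sum>k<n + c. r k) (\<lambda>_. \<Sum>k<n + c. r k)"
      by (simp add: compl_rel_def coherent_def mpow_simps)
    from compl_cong.abs_eq[OF rel this] show ?thesis
      unfolding to_completion.abs_eq by (simp only: diff_self mpow_simps)
  qed
  then show ?thesis by blast
qed

lemma has_sum_compl_cong:
  fixes f :: "'i \<Rightarrow> 'a::local_ring completion"
  assumes "(f has_sum g) A"
  shows "\<exists>F\<subseteq>A. finite F \<and> (\<forall>F'. F \<subseteq> F' \<longrightarrow> F' \<subseteq> A \<longrightarrow> finite F' \<longrightarrow> compl_cong n (sum f F') g)"
proof -
  let ?U = "{g'. compl_cong n g' g}"
  have "open ?U" unfolding open_completion_def using compl_cong_trans by blast
  moreover have "g \<in> ?U" by (simp add: compl_cong_refl)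
  ultimately have "\<forall>\<^sub>F F in finite_subsets_at_top A. sum f F \<in> ?U"
    using assms unfolding has_sum_def by (rule topological_tendstoD[rotated 1])
  then obtain X where X: "finite X" "X \<subseteq> A" "\<forall>Y. finite Y \<and> X \<subseteq> Y \<and> Y \<subseteq> A \<longrightarrow> sum f Y \<in> ?U"
    unfolding eventually_finite_subsets_at_top by (elim exE conjE) (rule that)
  show ?thesis by (intro exI[of _ X] conjI X(1,2)) (use X(3) in simp)
qed

section \<open>Division by elements with minimal leading exponents\<close>

context nonsingular_point begin

text \<open>
  Exponents of leading monomials of elements of \<open>J\<close>, for the order by degree and then lexicographic.
  The coefficients of the remaining monomials of the initial form are irrelevant.
\<close>

definition lead_exps :: "'r set \<Rightarrow> (nat \<Rightarrow> nat) set" where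
  "lead_exps J = {L \<in> MI. \<exists>j\<in>J. \<exists>p\<in>span (mon ` {K \<in> MI. deg_idx K = deg_idx L \<and> less_fun L K}).
     j - mon L - p \<in> mpow (Suc (deg_idx L))}"

text \<open>Division in one degree, by induction on the set \<open>T\<close> of exponents still
  allowed. \<open>T\<close> is closed upwards, so removing its least element \<open>L\<close> leaves
  exactly the exponents above \<open>L\<close>. A nonzero coefficient at \<open>L\<close> makes
  \<open>L\<close> a leading exponent, hence a multiple of some \<open>K\<close> in
  \<open>E0\<close>.\<close>

lemma standard_basis_reduction:
  fixes jj :: "(nat \<Rightarrow> nat) \<Rightarrow> 'r"
  assumes J: "is_ideal J" and E0: "finite E0"
    and jj: "\<And>K. K \<in> E0 \<Longrightarrow> K \<in> MI \<and> jj K \<in> J \<and>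
      (\<exists>p\<in>span (mon ` {K' \<in> MI. deg_idx K' = deg_idx K \<and> less_fun K K'}). jj K - mon K - p \<in> mpow (Suc (deg_idx K)))"
    and dom: "\<And>L. L \<in> lead_exps J \<Longrightarrow> \<exists>K\<in>E0. K \<le> L"
    and i: "i \<in> J" and T: "T \<subseteq> {L \<in> MI. deg_idx L = n}" "\<And>L K. L \<in> T \<Longrightarrow> K \<in> MI \<Longrightarrow> deg_idx K = n \<Longrightarrow> less_fun L K \<Longrightarrow> K \<in> T"
    and p: "p \<in> span (mon ` T)" "i - p \<in> mpow (Suc n)"
  shows "\<exists>r. (\<forall>K\<in>E0. r K \<in> mpow (n - deg_idx K)) \<and> i - (\<Sum>K\<in>E0. r K * jj K) \<in> mpow (Suc n)"
proof -
  have "finite {L \<in> MI. deg_idx L = n}"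
  proof (rule finite_subset)
    show "{L \<in> MI. deg_idx L = n} \<subseteq> {L \<in> MI. \<forall>i. L i \<le> n}"
    proof safe
      fix L j assume L: "L \<in> MI" "n = deg_idx L"
      show "L j \<le> deg_idx L"
      proof (cases "j \<in> {1..d}")
        case True
        then show ?thesis by (intro member_le_sum) auto
      qed (use L(1) in \<open>simp add: multi_idx_def\<close>)
    qed
  qed (rule finite_multi_idx_bounded, simp)
  then have "finite T" using T(1) finite_subset by blast
  then show ?thesis using i T p
  proof (induction "card T" arbitrary: T i p)
    case 0
    then have "i \<in> mpow (Suc n)" by simp
    then show ?case by (intro exI[of _ "\<lambda>_. 0"]) (simp add: mpow_simps del: ideal_power.simps)
  next
    case (Suc k)
    have "T \<noteq> {}" "T \<subseteq> MI" using Suc.hyps(2) Suc.prems(3) by auto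
    from less_fun_minimum[OF finite_atLeastAtMost Suc.prems(1) this]
    obtain L where L: "L \<in> T" "\<forall>K\<in>T - {L}. less_fun L K" by blast
    let ?U = "{K \<in> MI. deg_idx K = n \<and> less_fun L K}"
    have LM: "L \<in> MI" and Ln: "deg_idx L = n" using L(1) Suc.prems(3) by auto
    have TU: "T - {L} = ?U"
      using Suc.prems(3,4) L less_fun_irrefl[of L] by blast
    have cardU: "k = card ?U" unfolding TU[symmetric] using Suc.hyps(2) L(1) Suc.prems(1) by simp
    have finU: "finite ?U" unfolding TU[symmetric] using Suc.prems(1) by simp
    have upU: "K' \<in> ?U" if "K \<in> ?U" "K' \<in> MI" "deg_idx K' = n" "less_fun K K'" for K K'
      using that less_fun_trans[of L K K'] by simp
    have "mon ` T = insert (mon L) (mon ` ?U)" using L(1) TU by blast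
    with Suc.prems(5) have "p \<in> span (insert (mon L) (mon ` ?U))" by (simp only:)
    then obtain c where c: "p - smul c (mon L) \<in> span (mon ` ?U)"
      unfolding span_breakdown_eq by (elim exE) (rule that)
    have IH: "\<exists>r. (\<forall>K\<in>E0. r K \<in> mpow (n - deg_idx K)) \<and> i' - (\<Sum>K\<in>E0. r K * jj K) \<in> mpow (Suc n)"
      if "i' \<in> J" "p' \<in> span (mon ` ?U)" "i' - p' \<in> mpow (Suc n)" for i' p'
      by (rule Suc.hyps(1)[OF cardU finU that(1) _ _ that(2,3)]) (blast, rule upU)
    show ?case
    proof (cases "c = 0")
      case True
      then have "p \<in> span (mon ` ?U)" using c by simp
      from IH[OF Suc.prems(2) this Suc.prems(6)] show ?thesis .
    next
      case False
      let ?c = "inverse c"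
      have "smul ?c 1 * i \<in> J" using module.subspace_scale[OF self_module J Suc.prems(2)] .
      moreover have "smul ?c (p - smul c (mon L)) \<in> span (mon ` ?U)" using c by (rule span_scale)
      moreover have "smul ?c 1 * i - mon L - smul ?c (p - smul c (mon L)) \<in> mpow (Suc n)"
      proof -
        have "smul ?c 1 * i - mon L - smul ?c (p - smul c (mon L)) = smul ?c 1 * (i - p)"
          using False by (simp add: scale_right_diff_distrib smul_mult right_diff_distrib)
        then show ?thesis using mpow_simps(5)[OF Suc.prems(6)] by (simp only:)
      qed
      ultimately have "L \<in> lead_exps J" unfolding lead_exps_def using LM Ln by blast
      then obtain K where K: "K \<in> E0" "K \<le> L" using dom by blast
      then obtain pK where KM: "K \<in> MI" "jj K \<in> J"
        and pK: "pK \<in> span (mon ` {K' \<in> MI. deg_idx K' = deg_idx K \<and> less_fun K K'})" "jj K - mon K - pK \<in> mpow (Suc (deg_idx K))"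
        using jj by blast
      define D where "D = (\<lambda>i. L i - K i)"
      have KD: "(\<lambda>i. K i + D i) = L" using K(2) by (simp add: D_def le_fun_def)
      have DM: "D \<in> MI" using LM by (simp add: D_def multi_idx_def)
      have deg: "deg_idx K + deg_idx D = n" unfolding Ln[symmetric] KD[symmetric] by (rule sum.distrib[symmetric])
      \<comment> \<open>The other initial terms of the multiple of \<open>jj K\<close> stay
        lexicographically above \<open>L\<close>, so the term at \<open>L\<close> is removed without
        creating forbidden ones.\<close>
      have DpK: "mon D * pK \<in> span (mon ` ?U)" using pK(1)
      proof (induction rule: span_induct_alt)
        case base
        show ?case by (simp add: span_zero)
      next
        case (step a y z)
        then obtain K' where K': "K' \<in> MI" "deg_idx K' = deg_idx K" "less_fun K K'" "y = mon K'" by blast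
        have "(\<lambda>i. K' i + D i) \<in> ?U"
        proof (intro CollectI conjI)
          show "(\<lambda>i. K' i + D i) \<in> MI" using K'(1) DM by (rule multi_idx_add)
          show "deg_idx (\<lambda>i. K' i + D i) = n" unfolding sum.distrib K'(2) by (rule deg)
          show "less_fun L (\<lambda>i. K' i + D i)" using less_fun_add[OF K'(3), of D] unfolding KD .
        qed
        then have "mon (\<lambda>i. K' i + D i) \<in> span (mon ` ?U)" by (intro span_base imageI)
        then have "mon D * y \<in> span (mon ` ?U)" unfolding K'(4) mono_pow_add mult.commute[of "mon D"] .
        then have "smul a (mon D * y) + mon D * z \<in> span (mon ` ?U)" by (rule span_add[OF span_scale step.IH])
        then show ?case by (simp only: distrib_left mult_smul)
      qed
      let ?i = "i - smul c (mon D) * jj K" and ?p = "(p - smul c (mon L)) - smul c (mon D * pK)"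
      have pU: "?p \<in> span (mon ` ?U)" by (rule span_diff[OF c span_scale[OF DpK]])
      have iJ: "?i \<in> J"
        by (rule module.subspace_diff[OF self_module J Suc.prems(2) module.subspace_scale[OF self_module J KM(2)]])
      have rD: "smul c (mon D) \<in> mpow (n - deg_idx K)"
      proof -
        have "n - deg_idx K = deg_idx D" using deg by simp
        then show ?thesis unfolding smul_eq_mult[of c "mon D"] by (simp only: mpow_simps mon_in_mpow)
      qed
      have "?i - ?p = (i - p) - smul c (mon D) * (jj K - mon K - pK)"
      proof -
        have "mon L = mon K * mon D" unfolding mono_pow_add[symmetric] KD ..
        show ?thesis
          unfolding smul_eq_mult[of c "mon L"] smul_eq_mult[of c "mon D * pK"] smul_eq_mult[of c "mon D"]
          unfolding \<open>mon L = mon K * mon D\<close> by (simp add: algebra_simps)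
      qed
      moreover have "smul c (mon D) * (jj K - mon K - pK) \<in> mpow (Suc n)"
        using mpow_mult[OF rD pK(2)] deg by (metis add_Suc_right le_add1 le_add_diff_inverse2)
      ultimately have ip: "?i - ?p \<in> mpow (Suc n)" using mpow_simps(3)[OF Suc.prems(6)] by (simp only:)
      from IH[OF iJ pU ip] obtain r where r: "\<forall>K\<in>E0. r K \<in> mpow (n - deg_idx K)"
        "?i - (\<Sum>K\<in>E0. r K * jj K) \<in> mpow (Suc n)" by (elim exE conjE) (rule that)
      let ?r = "\<lambda>K'. (if K' = K then smul c (mon D) else 0) + r K'"
      have 1: "\<forall>K\<in>E0. ?r K \<in> mpow (n - deg_idx K)"
        using r(1) rD by (auto intro!: mpow_simps(2) mpow_simps(1))
      have "(\<Sum>K\<in>E0. ?r K * jj K) = (\<Sum>K'\<in>E0. (if K' = K then smul c (mon D) * jj K' else 0) + r K' * jj K')"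
        by (intro sum.cong) (auto simp: distrib_right)
      also have "\<dots> = smul c (mon D) * jj K + (\<Sum>K\<in>E0. r K * jj K)"
        unfolding sum.distrib by (subst sum.delta[OF E0]) (use K(1) in auto)
      finally have 2: "i - (\<Sum>K\<in>E0. ?r K * jj K) \<in> mpow (Suc n)" using r(2) by (simp only: diff_diff_add)
      show ?thesis by (rule exI[of _ ?r]) (rule conjI[OF 1 2])
    qed
  qed
qed

text \<open>Each \<open>n\<close> provides its own approximation in \<open>J\<close>. Division by
  the finitely many \<open>jj K\<close> combines them into one linear combination with convergent
  coefficients.\<close>

theorem ideal_closed_in_completion:
  fixes J :: "'r set"
  assumes J: "is_ideal J" and g: "\<And>n. \<exists>i\<in>J. compl_cong n g (to_completion i)"
  shows "g \<in> ideal_gen (to_completion ` J)"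
proof -
  have "lead_exps J \<subseteq> MI" by (auto simp: lead_exps_def)
  from dickson[OF finite_atLeastAtMost this] obtain E0 where
    E0: "E0 \<subseteq> lead_exps J" "finite E0" and dom: "\<And>L. L \<in> lead_exps J \<Longrightarrow> \<exists>K\<in>E0. K \<le> L" by blast
  have "\<forall>K\<in>E0. \<exists>j. K \<in> MI \<and> j \<in> J \<and>
      (\<exists>p\<in>span (mon ` {K' \<in> MI. deg_idx K' = deg_idx K \<and> less_fun K K'}). j - mon K - p \<in> mpow (Suc (deg_idx K)))"
    using E0(1) unfolding lead_exps_def by blast
  from bchoice[OF this] obtain jj where jj: "\<forall>K\<in>E0. K \<in> MI \<and> jj K \<in> J \<and>
      (\<exists>p\<in>span (mon ` {K' \<in> MI. deg_idx K' = deg_idx K \<and> less_fun K K'}). jj K - mon K - p \<in> mpow (Suc (deg_idx K)))"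
    by (elim exE)
  have jj_mpow: "jj K \<in> mpow (deg_idx K)" if K: "K \<in> E0" for K
  proof -
    obtain p where p: "p \<in> span (mon ` {K' \<in> MI. deg_idx K' = deg_idx K \<and> less_fun K K'})"
      "jj K - mon K - p \<in> mpow (Suc (deg_idx K))" using jj K by blast
    have "p \<in> mpow (deg_idx K)" using p(1)
    proof (induction rule: span_induct_alt)
      case base
      show ?case by (rule mpow_simps)
    next
      case (step c y z)
      then obtain K' where "deg_idx K' = deg_idx K" "y = mon K'" by blast
      then have "y \<in> mpow (deg_idx K)" using mon_in_mpow[of K'] by (simp only:)
      then show ?case unfolding smul_eq_mult[of c y] using step.IH by (simp only: mpow_simps)
    qed
    then have "mon K + p \<in> mpow (deg_idx K)" by (rule mpow_simps(2)[OF mon_in_mpow])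
    moreover have "jj K - mon K - p \<in> mpow (deg_idx K)" by (rule mpow_antimono[OF _ p(2)]) simp
    ultimately have "(mon K + p) + (jj K - mon K - p) \<in> mpow (deg_idx K)" by (rule mpow_simps)
    then show ?thesis by simp
  qed
  let ?Cl = "\<lambda>g. \<forall>n. \<exists>i\<in>J. compl_cong n g (to_completion i)"
  let ?step = "\<lambda>g r. g - (\<Sum>K\<in>E0. to_completion (r K) * to_completion (jj K))"
  have ex_step: "\<exists>r. (\<forall>K\<in>E0. r K \<in> mpow (n - deg_idx K)) \<and> ?Cl (?step g r) \<and> compl_cong (Suc n) (?step g r) 0"
    if gCl: "?Cl g" and g0: "compl_cong n g 0" for g n
  proof -
    obtain i where i: "i \<in> J" "compl_cong (Suc n) g (to_completion i)" using gCl by blast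
    have "compl_cong n (to_completion i) (to_completion 0)"
      using compl_cong_trans[OF compl_cong_sym[OF compl_cong_Suc[OF i(2)]] g0] by (simp add: to_completion_simps)
    then have "i \<in> mpow n" unfolding compl_cong_to_completion by simp
    from mpow_leading_form[OF this] obtain p where p: "p \<in> span (mon ` {L \<in> MI. deg_idx L = n})" "i - p \<in> mpow (Suc n)" by blast
    have "\<exists>r. (\<forall>K\<in>E0. r K \<in> mpow (n - deg_idx K)) \<and> i - (\<Sum>K\<in>E0. r K * jj K) \<in> mpow (Suc n)"
      by (rule standard_basis_reduction[OF J E0(2) _ dom i(1) order_refl _ p]) (use jj in auto)
    then obtain r where r: "\<forall>K\<in>E0. r K \<in> mpow (n - deg_idx K)" "i - (\<Sum>K\<in>E0. r K * jj K) \<in> mpow (Suc n)" by blast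
    have s: "(\<Sum>K\<in>E0. to_completion (r K) * to_completion (jj K)) = to_completion (\<Sum>K\<in>E0. r K * jj K)"
      by (simp add: to_completion_sum to_completion_simps)
    have sJ: "(\<Sum>K\<in>E0. r K * jj K) \<in> J"
      using jj by (intro module.subspace_sum[OF self_module J] module.subspace_scale[OF self_module J]) blast
    have "?Cl (?step g r)"
    proof
      fix m
      obtain i' where i': "i' \<in> J" "compl_cong m g (to_completion i')" using gCl by blast
      have "compl_cong m (?step g r) (to_completion (i' - (\<Sum>K\<in>E0. r K * jj K)))"
        unfolding s to_completion_simps by (rule compl_cong_diff[OF i'(2) compl_cong_refl])
      moreover have "i' - (\<Sum>K\<in>E0. r K * jj K) \<in> J" by (rule module.subspace_diff[OF self_module J i'(1) sJ])
      ultimately show "\<exists>i\<in>J. compl_cong m (?step g r) (to_completion i)" by blast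
    qed
    moreover have "compl_cong (Suc n) (?step g r) 0"
    proof -
      have "compl_cong (Suc n) (?step g r) (to_completion (i - (\<Sum>K\<in>E0. r K * jj K)))"
        unfolding s to_completion_simps by (rule compl_cong_diff[OF i(2) compl_cong_refl])
      moreover have "compl_cong (Suc n) (to_completion (i - (\<Sum>K\<in>E0. r K * jj K))) (to_completion 0)"
        unfolding compl_cong_to_completion using r(2) by (simp only: diff_0_right)
      ultimately show ?thesis unfolding to_completion_simps(4) by (rule compl_cong_trans)
    qed
    ultimately show ?thesis using r(1) by blast
  qed
  define R where "R n g = (SOME r. (\<forall>K\<in>E0. r K \<in> mpow (n - deg_idx K)) \<and> ?Cl (?step g r) \<and> compl_cong (Suc n) (?step g r) 0)" for n g
  \<comment> \<open>Successive remainders: \<open>H n\<close> is still approximated by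
    \<open>J\<close> and is congruent to 0 at precision \<open>n\<close>.\<close>
  define H where "H = rec_nat g (\<lambda>n g. ?step g (R n g))"
  have H0: "H 0 = g" and HS: "H (Suc n) = ?step (H n) (R n (H n))" for n by (simp_all add: H_def)
  have R: "(\<forall>K\<in>E0. R n g K \<in> mpow (n - deg_idx K)) \<and> ?Cl (?step g (R n g)) \<and> compl_cong (Suc n) (?step g (R n g)) 0"
    if "?Cl g" "compl_cong n g 0" for n g
    unfolding R_def using ex_step[OF that] by (rule someI_ex)
  have "compl_cong 0 g 0" by (transfer) simp
  then have H: "?Cl (H n) \<and> compl_cong n (H n) 0" for n
    by (induction n) (use g H0 HS R in auto)
  define r where "r n = R n (H n)" for n
  have r: "r n K \<in> mpow (n - deg_idx K)" if "K \<in> E0" for n K using R[of "H n" n] H[of n] that unfolding r_def by blast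
  have gH: "g = H n + (\<Sum>K\<in>E0. to_completion (\<Sum>k<n. r k K) * to_completion (jj K))" for n
  proof (induction n)
    case 0
    show ?case by (simp add: H0 to_completion_simps)
  next
    case (Suc n)
    then show ?case unfolding HS r_def[symmetric]
      by (simp add: to_completion_simps distrib_right sum.distrib)
  qed
  have "\<forall>K\<in>E0. \<exists>\<phi>. \<forall>n. compl_cong n \<phi> (to_completion (\<Sum>k<n + deg_idx K. r k K))"
    using completion_series[OF r] by blast
  from bchoice[OF this] obtain \<phi> where \<phi>: "\<forall>K\<in>E0. \<forall>n. compl_cong n (\<phi> K) (to_completion (\<Sum>k<n + deg_idx K. r k K))"
    by (elim exE)
  have "g = (\<Sum>K\<in>E0. \<phi> K * to_completion (jj K))"
  proof (rule compl_eqI)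
    fix n
    \<comment> \<open>The quotients converge with delay \<open>deg_idx K\<close>, but the terms in
      between are multiplied by \<open>jj K\<close>, which has that order.\<close>
    have cong_term: "compl_cong n (\<phi> K * to_completion (jj K)) (to_completion (\<Sum>k<n. r k K) * to_completion (jj K))" if K: "K \<in> E0" for K
    proof -
      have 1: "compl_cong n (\<phi> K * to_completion (jj K)) (to_completion (\<Sum>k<n + deg_idx K. r k K) * to_completion (jj K))"
        using \<phi> K by (intro compl_cong_mult compl_cong_refl) blast
      have split: "(\<Sum>k<n + deg_idx K. r k K) = (\<Sum>k<n. r k K) + (\<Sum>k\<in>{n..<n + deg_idx K}. r k K)"
        by (metis (no_types, lifting) add.commute atLeast0LessThan le_add1 le_add2 sum.atLeastLessThan_concat zero_le)
      have "r k K * jj K \<in> mpow n" if "k \<in> {n..<n + deg_idx K}" for k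
      proof -
        have "r k K * jj K \<in> mpow ((k - deg_idx K) + deg_idx K)" by (rule mpow_mult[OF r[OF K] jj_mpow[OF K]])
        then show ?thesis by (rule mpow_antimono[rotated]) (use that in auto)
      qed
      then have "(\<Sum>k\<in>{n..<n + deg_idx K}. r k K * jj K) \<in> mpow n" by (rule mpow_sum)
      then have "(\<Sum>k<n + deg_idx K. r k K) * jj K - (\<Sum>k<n. r k K) * jj K \<in> mpow n"
        unfolding split by (simp only: distrib_right add_diff_cancel_left' sum_distrib_right)
      then have "compl_cong n (to_completion (\<Sum>k<n + deg_idx K. r k K) * to_completion (jj K)) (to_completion (\<Sum>k<n. r k K) * to_completion (jj K))"
        unfolding to_completion_simps(3)[symmetric] compl_cong_to_completion .
      with 1 show ?thesis by (rule compl_cong_trans)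
    qed
    have "compl_cong n (H n + (\<Sum>K\<in>E0. to_completion (\<Sum>k<n. r k K) * to_completion (jj K)))
      (0 + (\<Sum>K\<in>E0. \<phi> K * to_completion (jj K)))"
      using H[of n] by (intro compl_cong_add compl_cong_sum compl_cong_sym[OF cong_term]) blast+
    then show "compl_cong n g (\<Sum>K\<in>E0. \<phi> K * to_completion (jj K))" unfolding gH[of n, symmetric] by simp
  qed
  moreover have "(\<Sum>K\<in>E0. \<phi> K * to_completion (jj K)) \<in> ideal_gen (to_completion ` J)"
    using jj by (intro module.span_sum[OF self_module] module.span_scale[OF self_module] module.span_base[OF self_module] imageI) blast
  ultimately show ?thesis by (simp only:)
qed

end

section \<open>Coefficients of power series expansions\<close>

context coefficient_setup begin

lemma power_series_approx:
  assumes "power_series_in smul x {N+1..d} b"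
  shows "\<exists>p\<in>span (mon ` {L \<in> MI. \<forall>l\<in>{1..N}. L l = 0}). compl_cong n b (to_completion p)"
proof -
  let ?I = "{N+1..d}"
  obtain c where c: "((\<lambda>J. to_completion (smul (c J) (mono_pow x ?I J))) has_sum b) (multi_idx ?I)"
    using assms unfolding power_series_in_def by blast
  obtain F where F: "F \<subseteq> multi_idx ?I" "finite F"
    "\<forall>F'. F \<subseteq> F' \<longrightarrow> F' \<subseteq> multi_idx ?I \<longrightarrow> finite F' \<longrightarrow>
       compl_cong n (\<Sum>J\<in>F'. to_completion (smul (c J) (mono_pow x ?I J))) b"
    using has_sum_compl_cong[OF c, of n] by (elim exE conjE) (rule that)
  let ?p = "\<Sum>J\<in>F. smul (c J) (mon J)"
  have mon_eq: "mono_pow x ?I J = mon J" if "J \<in> F" for J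
    unfolding mono_pow_def by (rule prod.mono_neutral_left) (use that F(1) in \<open>auto simp: multi_idx_def\<close>)
  have "compl_cong n (\<Sum>J\<in>F. to_completion (smul (c J) (mono_pow x ?I J))) b"
    using F(3)[rule_format, OF order_refl F(1,2)] .
  also have "(\<Sum>J\<in>F. to_completion (smul (c J) (mono_pow x ?I J))) = to_completion ?p"
    unfolding to_completion_sum by (intro sum.cong refl) (simp only: mon_eq)
  finally have 1: "compl_cong n b (to_completion ?p)" by (rule compl_cong_sym)
  have "?p \<in> span (mon ` {L \<in> MI. \<forall>l\<in>{1..N}. L l = 0})"
  proof (intro span_sum span_scale span_base imageI)
    fix J assume "J \<in> F"
    then have "J \<in> multi_idx ?I" using F(1) by blast
    then show "J \<in> {L \<in> MI. \<forall>l\<in>{1..N}. L l = 0}" by (auto simp: multi_idx_def)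
  qed
  with 1 show ?thesis by (rule bexI)
qed

text \<open>A truncated power series in the last variables leaves the first \<open>N\<close>
  exponents of \<open>mon K\<close> unchanged, and these are below \<open>q l\<close>.\<close>

lemma coefficient_approx:
  assumes "\<And>K. K \<in> index_box q N d \<Longrightarrow> power_series_in smul x {N+1..d} (b K)"
  shows "\<exists>\<alpha>\<in>U0. compl_cong n (\<Sum>K\<in>index_box q N d. b K * to_completion (mon K)) (to_completion \<alpha>)"
proof -
  let ?V = "span (mon ` {L \<in> MI. \<forall>l\<in>{1..N}. L l = 0})"
  have "\<forall>K\<in>index_box q N d. \<exists>p. p \<in> ?V \<and> compl_cong n (b K) (to_completion p)"
    using power_series_approx assms by blast
  from bchoice[OF this] obtain p where p: "\<forall>K\<in>index_box q N d. p K \<in> ?V \<and> compl_cong n (b K) (to_completion (p K))"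
    by (elim exE)
  let ?\<alpha> = "\<Sum>K\<in>index_box q N d. p K * mon K"
  have "compl_cong n (\<Sum>K\<in>index_box q N d. b K * to_completion (mon K)) (\<Sum>K\<in>index_box q N d. to_completion (p K) * to_completion (mon K))"
    using p by (intro compl_cong_sum compl_cong_mult compl_cong_refl) blast
  then have 1: "compl_cong n (\<Sum>K\<in>index_box q N d. b K * to_completion (mon K)) (to_completion ?\<alpha>)"
    by (simp only: to_completion_sum to_completion_simps)
  have "?\<alpha> \<in> U0"
  proof (rule U0_closed(5))
    fix K assume K: "K \<in> index_box q N d"
    then have "p K \<in> ?V" using p by blast
    then show "p K * mon K \<in> U0"
    proof (induction rule: span_induct_alt)
      case base
      show ?case by (simp only: mult_zero_left U0_closed(3))
    next
      case (step c y z)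
      then obtain J where J: "J \<in> MI" "\<forall>l\<in>{1..N}. J l = 0" "y = mon J" by blast
      have "(\<lambda>i. J i + K i) \<in> {K \<in> MI. \<forall>l\<in>{1..N}. K l < q l}"
      proof (intro CollectI conjI ballI)
        show "(\<lambda>i. J i + K i) \<in> MI" by (rule multi_idx_add[OF J(1)]) (use K in \<open>simp only: index_box_def mem_Collect_eq\<close>)
        fix l assume l: "l \<in> {1..N}"
        then have "K l \<le> q l - 1" using K by (simp add: index_box_def)
        then show "J l + K l < q l" using J(2) l q_pos[OF l] by simp
      qed
      then have "y * mon K \<in> U0" unfolding J(3) mono_pow_add[symmetric] U0_def by (intro span_base imageI)
      then have "smul c (y * mon K) + z * mon K \<in> U0" by (intro U0_closed(1,4) step.IH)
      then show ?case by (simp only: distrib_right smul_mult)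
    qed
  qed
  with 1 show ?thesis by (rule bexI)
qed

end

lemma filtration_completion_approx:
  assumes filt: "idealistic_filtration \<I>" and f: "(f, a) \<in> filtration_completion \<I>"
  shows "\<exists>F. (F, a) \<in> \<I> \<and> compl_cong n f (to_completion F)"
proof -
  have i: "is_ideal (level \<I> a)" using filt by (simp add: idealistic_filtration_def)
  have "f \<in> ideal_gen (to_completion ` level \<I> a)" using f by (simp add: filtration_completion_def)
  then have "\<exists>F\<in>level \<I> a. compl_cong n f (to_completion F)"
  proof (induction rule: module.span_induct_alt[OF self_module, consumes 1])
    case 1
    show ?case unfolding to_completion_simps(4)[symmetric]
      by (rule bexI[OF compl_cong_refl module.subspace_0[OF self_module i]])
  next
    case (2 c y z)
    then obtain i' where i': "i' \<in> level \<I> a" "y = to_completion i'" by blast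
    obtain F where F: "F \<in> level \<I> a" "compl_cong n z (to_completion F)" using 2 by blast
    obtain r where r: "compl_cong n c (to_completion r)" using compl_cong_representative by blast
    have "compl_cong n (c * y + z) (to_completion (r * i' + F))"
      unfolding i'(2) to_completion_simps by (intro compl_cong_add compl_cong_mult compl_cong_refl r F(2))
    moreover have "r * i' + F \<in> level \<I> a"
      by (intro module.subspace_add[OF self_module i] module.subspace_scale[OF self_module i] i'(1) F(1))
    ultimately show ?case by (rule bexI)
  qed
  then show ?thesis unfolding level_def by blast
qed

context coefficient_setup begin

theorem coefficient_in_filtration_completion:
  assumes f: "(f, a) \<in> filtration_completion \<I>" and star: "star_expansion smul q N d h x f aa" and B: "B \<in> MN"
  shows "(aa B, a - real (wt B)) \<in> filtration_completion \<I>"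
proof -
  obtain b where b: "\<forall>B\<in>MN. \<forall>K\<in>index_box q N d. power_series_in smul x {N+1..d} (b B K)"
    "\<forall>B\<in>MN. aa B = (\<Sum>K\<in>index_box q N d. b B K * to_completion (mon K))"
    and sum: "((\<lambda>B. aa B * to_completion (hm B)) has_sum f) MN"
    using star unfolding star_expansion_def by (elim exE conjE) (rule that)
  have approx: "\<exists>\<alpha>\<in>U0. compl_cong n (aa C) (to_completion \<alpha>)" if C: "C \<in> MN" for C n
    unfolding b(2)[rule_format, OF C] by (rule coefficient_approx) (rule b(1)[rule_format, OF C])
  have "aa B \<in> ideal_gen (to_completion ` level \<I> (a - real (wt B)))"
  proof (rule ideal_closed_in_completion)
    show "is_ideal (level \<I> (a - real (wt B)))" using filt by (simp add: idealistic_filtration_def)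
    fix n
    \<comment> \<open>The coefficient at \<open>B\<close> is known with a loss of
      \<open>wt B\<close> orders.\<close>
    define m where "m = n + wt B"
    have "\<forall>C\<in>MN. \<exists>\<alpha>. \<alpha> \<in> U0 \<and> compl_cong m (aa C) (to_completion \<alpha>)" using approx by blast
    from bchoice[OF this] obtain \<alpha> where \<alpha>: "\<forall>C\<in>MN. \<alpha> C \<in> U0 \<and> compl_cong m (aa C) (to_completion (\<alpha> C))"
      by (elim exE)
    obtain F where F: "(F, a) \<in> \<I>" "compl_cong m f (to_completion F)"
      using filtration_completion_approx[OF filt f] by blast
    obtain X where X: "X \<subseteq> MN" "finite X" "\<forall>F'. X \<subseteq> F' \<longrightarrow> F' \<subseteq> MN \<longrightarrow> finite F' \<longrightarrow>
       compl_cong m (\<Sum>C\<in>F'. aa C * to_completion (hm C)) f"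
      using has_sum_compl_cong[OF sum, of m] by (elim exE conjE) (rule that)
    let ?W = "WB (int m)"
    \<comment> \<open>\<open>X\<close> brings the sum close to \<open>f\<close>, and
      \<open>?W\<close> contributes all exponents of weight below \<open>m\<close>; the remaining
      terms vanish at precision \<open>m\<close>.\<close>
    let ?X = "X \<union> ?W"
    have XM: "?X \<subseteq> MN" using X(1) by blast
    have finX: "finite ?X" using X(2) finite_WB by blast
    have 1: "compl_cong m (\<Sum>C\<in>?X. aa C * to_completion (hm C)) f"
      using X(3)[rule_format, OF Un_upper1 XM finX] .
    have "compl_cong m (\<Sum>C\<in>?X. aa C * to_completion (hm C)) (\<Sum>C\<in>?X. to_completion (\<alpha> C) * to_completion (hm C))"
      using \<alpha> XM by (intro compl_cong_sum compl_cong_mult compl_cong_refl) blast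
    then have 2: "compl_cong m (\<Sum>C\<in>?X. aa C * to_completion (hm C)) (to_completion (\<Sum>C\<in>?X. \<alpha> C * hm C))"
      by (simp only: to_completion_sum to_completion_simps)
    have 3: "F - (\<Sum>C\<in>?X. \<alpha> C * hm C) \<in> mpow m"
      using compl_cong_trans[OF compl_cong_sym[OF F(2)] compl_cong_trans[OF compl_cong_sym[OF 1] 2]]
      unfolding compl_cong_to_completion .
    have 4: "(\<Sum>C\<in>?X - ?W. \<alpha> C * hm C) \<in> mpow m"
    proof (rule mpow_sum, rule mpow_simps(5))
      fix C assume C: "C \<in> ?X - ?W"
      then have CM: "C \<in> MN" and "m \<le> wt C" using XM by auto
      from hm_ipow[OF CM] have "hm C \<in> mpow (wt C)" unfolding ipow_def nat_int .
      then show "hm C \<in> mpow m" by (rule mpow_antimono[OF \<open>m \<le> wt C\<close>])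
    qed
    have "(\<Sum>C\<in>?X. \<alpha> C * hm C) = (\<Sum>C\<in>?X - ?W. \<alpha> C * hm C) + (\<Sum>C\<in>?W. \<alpha> C * hm C)"
      by (rule sum.subset_diff[OF Un_upper2 finX])
    then have "F - (\<Sum>C\<in>?W. \<alpha> C * hm C) = (F - (\<Sum>C\<in>?X. \<alpha> C * hm C)) + (\<Sum>C\<in>?X - ?W. \<alpha> C * hm C)" by simp
    with mpow_simps(2)[OF 3 4] have 5: "F - (\<Sum>C\<in>WB (0 + int m). \<alpha> C * hm C) \<in> ipow (0 + int m)"
      unfolding add_0 ipow_def nat_int by (simp only:)
    \<comment> \<open>For \<open>s = 0\<close> the order condition on the coefficients is empty, so
      the induction can start with any expansion.\<close>
    have 6: "\<alpha> C \<in> ipow (0 - int (wt C))" for C by (rule ipow_nonpos) simp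
    have "\<exists>g. (g, a - real (wt B)) \<in> \<I> \<and> \<alpha> B - g \<in> ipow (0 + int m - int (wt B))"
      by (rule coefficient_mod_power[OF F(1) _ _ 5 B]) (use \<alpha> 6 in blast)+
    then obtain g where g: "(g, a - real (wt B)) \<in> \<I>" "\<alpha> B - g \<in> ipow (0 + int m - int (wt B))"
      by (elim exE conjE) (rule that)
    have "nat (0 + int m - int (wt B)) = n" by (simp add: m_def)
    then have "\<alpha> B - g \<in> mpow n" using g(2) unfolding ipow_def by (simp only:)
    then have "compl_cong n (to_completion (\<alpha> B)) (to_completion g)" unfolding compl_cong_to_completion .
    moreover have "compl_cong n (aa B) (to_completion (\<alpha> B))"
      by (rule compl_cong_antimono[of n m]) (use \<alpha> B in \<open>simp_all add: m_def\<close>)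
    ultimately have "compl_cong n (aa B) (to_completion g)" by (rule compl_cong_trans[rotated])
    then show "\<exists>i\<in>level \<I> (a - real (wt B)). compl_cong n (aa B) (to_completion i)"
      by (rule bexI) (use g(1) in \<open>simp add: level_def\<close>)
  qed
  then show ?thesis by (simp add: filtration_completion_def)
qed

end

text \<open>In dimension 0 the eigenvalue argument for the residue field has no nonzero cotangent
  vector to work with; but then \<open>N = 0\<close>, and the sum over the only exponent is
  \<open>f\<close>.\<close>

lemma star_expansion_dim_0:
  fixes f :: "'r::local_ring completion"
  assumes "star_expansion smul q 0 d h x f aa"
  shows "aa (\<lambda>_. 0) = f"
proof (rule compl_eqI)
  fix n
  have MN: "multi_idx {1..0::nat} = {\<lambda>_. 0}" by (auto simp: multi_idx_def)
  have "((\<lambda>B. aa B * to_completion (mono_pow h {1..0} B)) has_sum f) (multi_idx {1..0})"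
    using assms unfolding star_expansion_def by blast
  from has_sum_compl_cong[OF this, of n] obtain F where F: "F \<subseteq> {\<lambda>_. 0}" 
    "\<forall>F'. F \<subseteq> F' \<longrightarrow> F' \<subseteq> {\<lambda>_. 0} \<longrightarrow> finite F' \<longrightarrow> compl_cong n (\<Sum>B\<in>F'. aa B * to_completion (mono_pow h {1..0} B)) f"
    unfolding MN by (elim exE conjE) (rule that)
  from F(2)[rule_format, OF F(1) order_refl finite.insertI[OF finite.emptyI]]
  show "compl_cong n (aa (\<lambda>_. 0)) f" by (simp add: mono_pow_def to_completion_simps)
qed

theorem lemma2p2p2p1:
  fixes smul :: "'k::alg_closed_field \<Rightarrow> 'r::{idom, local_ring} \<Rightarrow> 'r"
    and d N :: nat
    and h x :: "nat \<Rightarrow> 'r"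
    and e q :: "nat \<Rightarrow> nat"
    and v :: "nat \<Rightarrow> 'r set"
    and \<I> :: "('r \<times> real) set"
    and f :: "'r completion"
    and a :: real
    and aa :: "(nat \<Rightarrow> nat) \<Rightarrow> 'r completion"
  assumes R: "local_ring_of_nonsingular_variety smul d"
    and h_inj: "inj_on h {1..N}"
    and e_mono: "\<And>i j. 1 \<le> i \<Longrightarrow> i \<le> j \<Longrightarrow> j \<le> N \<Longrightarrow> e i \<le> e j"
    and e_char_0: "CHAR('k) = 0 \<Longrightarrow> \<forall>l\<in>{1..N}. e l = 0"
    and q: "\<And>l. q l = CHAR('k) ^ e l"
    and v: "\<And>l. l \<in> {1..N} \<Longrightarrow> v l \<in> cotangent_space"
    and h_mpow: "\<And>l. l \<in> {1..N} \<Longrightarrow> h l \<in> mpow (q l)"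
    and h_residue: "\<And>l. l \<in> {1..N} \<Longrightarrow> residue (q l) (h l) = gr_power (v l) (q l)"
    and v_inj: "inj_on v {1..N}"
    and v_indep: "cotangent_independent smul N v"
    and x: "regular_system_of_parameters d x"
    and N_le_d: "N \<le> d"
    and x_assoc: "\<And>l. l \<in> {1..N} \<Longrightarrow> v l = residue 1 (x l)"
    and filt: "idealistic_filtration \<I>"
    and sat: "diff_saturated smul \<I>"
    and h_in: "\<And>l. l \<in> {1..N} \<Longrightarrow> (h l, real (q l)) \<in> \<I>"
    and f: "(f, a) \<in> filtration_completion \<I>"
    and expansion: "star_expansion smul q N d h x f aa"
  shows "\<forall>B\<in>multi_idx {1..N}.
           (aa B, a - real (\<Sum>l=1..N. q l * B l)) \<in> filtration_completion \<I>"
proof (cases "d = 0")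
  case True
  then have N: "N = 0" using N_le_d by simp
  have "multi_idx {1..0::nat} = {\<lambda>_. 0}" by (auto simp: multi_idx_def)
  then show ?thesis using f star_expansion_dim_0[of smul q d h x f aa] expansion unfolding N by simp
next
  case False
  have alg: "k_algebra smul" using R by (simp add: local_ring_of_nonsingular_variety_def)
  obtain A M where A: "nonsingular_affine smul A d" and M: "maximal_ideal_of A M" "is_localization_at A M"
    using R unfolding local_ring_of_nonsingular_variety_def by blast
  have dim: "has_quot_dim smul M (module.span smul {x * y |x y. x \<in> M \<and> y \<in> M}) d" if "maximal_ideal_of A M" for M
    using A that unfolding nonsingular_affine_def by blast
  obtain S where S: "finite S" "A = sub_alg smul S"
    using A unfolding nonsingular_affine_def fin_gen_subalgebra_def sub_alg_def by blast
  interpret nonsingular_point smul d x S A M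
    by (intro nonsingular_point.intro nonsingular_point_axioms.intro alg S M dim x) (use False in simp)
  have frob: "frobenius_power TYPE('r) (q l)" if "l \<in> {1..N}" for l
  proof (cases "CHAR('k) = 0")
    case True
    then have "q l = 1" using e_char_0 that unfolding q by simp
    then show ?thesis using frobenius_power_1 by simp
  next
    case False
    then have "prime CHAR('r)" unfolding CHAR_eq using prime_CHAR_semidom[where 'a = 'k] by simp
    from frobenius_power_char[OF this, of "e l"] show ?thesis unfolding q CHAR_eq .
  qed
  \<comment> \<open>As \<open>x l\<close> represents \<open>v l\<close>, its \<open>q l\<close>-th
    power lies in the coset \<open>gr_power (v l) (q l)\<close>, which is the residue of
    \<open>h l\<close>.\<close>
  have hx: "h l - x l ^ q l \<in> mpow (Suc (q l))" if l: "l \<in> {1..N}" for l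
  proof -
    have self: "y \<in> residue n y" for y :: 'r and n
      unfolding residue_def elt_set_plus_def by (rule CollectI, rule bexI[of _ 0]) (simp_all only: add_0_right mpow_simps)
    have "x l \<in> v l" unfolding x_assoc[OF l] by (rule self)
    then have "x l ^ q l \<in> gr_power (v l) (q l)" unfolding gr_power_def using self by blast
    then have "x l ^ q l \<in> residue (q l) (h l)" unfolding h_residue[OF l] .
    then obtain c where c: "c \<in> mpow (Suc (q l))" "x l ^ q l = h l + c"
      unfolding residue_def elt_set_plus_def by blast
    have "h l - x l ^ q l = - c" unfolding c(2) by simp
    then show ?thesis using mpow_simps(4)[OF c(1)] by (simp only:)
  qed
  interpret coefficient_setup smul d x S A M N h q \<I>
    by (intro coefficient_setup.intro nonsingular_point_axioms coefficient_setup_axioms.intro frob hx N_le_d filt sat h_in)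
  show ?thesis using coefficient_in_filtration_completion[OF f expansion] unfolding wt_def by blast
qed

end
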